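(* For every positive integer $n$, the $\mathfrak{sp}(4)$ clasp $g_n$ of weight $(0,n)$ satisfies, in $\mathrm{Hom}(2^n,2^n)$, $$g_n=\sum_{i=0}^{n-1}\sum_{j=i+1}^{n}[2]^{\,2(1+i-j)}\,\frac{[2n+1-2i]\,[2n-2j+2]}{[2n]\,[2n+1]}\;D_{i,j},$$ where $D_{i,j}\in\mathrm{Hom}(2^n,2^n)$ are the webs, each containing one clasp $g_{n-1}$ of weight $(0,n-1)$, described in the context.
   Context: Ground field $K=\mathbb{C}(q^{1/2})$; $[n]=\frac{q^{n/2}-q^{-n/2}}{q^{1/2}-q^{-1/2}}$. Webs. An $\mathfrak{sp}(4)$ web in a rectangle is an unoriented planar graph (possibly with closed loops without vertices), up to isotopy, with edges of two types, type 1 (single) and type 2 (double), whose interior vertices are trivalent with two type 1 edges and one type 2 edge, and whose univalent vertices lie on the bottom and top sides. For words $s,t$ in the letters $1,2$, $\mathrm{Hom}(s,t)$ is the $K$-vector space spanned by webs whose bottom (top) endpoints have types $s$ (resp. $t$), left to right, modulo the local relations: a type 1 loop equals $-\frac{[6][2]}{[3]}$; a type 2 loop equals $\frac{[6][5]}{[3][2]}$; a type 2 edge ending at a vertex whose two type 1 half-edges form a loop bounding an empty disc equals $0$; a bigon of two type 1 edges with two type 2 legs equals $-[2]^2$ times a type 2 strand; a triangle of type 1 edges with three type 2 legs equals $0$; and, for four type 1 boundary points (top-left, top-right, bottom-left, bottom-right), $$I-J=U-V,$$ where $I$ joins the two top points at one vertex and the two bottom points at another vertex, connected by a vertical type 2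 edge; $J$ joins the two left points at one vertex and the two right points at another, connected by a horizontal type 2 edge; $U$ joins the top two points by an arc and the bottom two points by an arc; $V$ consists of two vertical strands. Composition stacks diagrams (the left factor on top), $\otimes$ is juxtaposition. The tetravalent vertex (crossing) $X^{(2)}$ of two type 2 strands is by definition the web consisting of a square of four type 1 edges with one type 2 leg attached at each of its four corners. Clasps. The weight of a word with $a$ letters $1$ and $b$ letters $2$ is $(a,b)$, meaning $a\lambda_1+b\lambda_2$ (fundamental weights of $\mathfrak{sp}(4)$, $\dim V_{\lambda_1}=4$, $\dim V_{\lambda_2}=5$). The partial order is generated by $(a,b)\succ(a-2,b+1)$ and $(a,b)\succ(a+2,b-2)$. The clasp of a word $s$ is the unique nonzero idempotent $P_s\in\mathrm{Hom}(s,s)$ such that $w\circ P_s=0$ for $w\in\mathrm{Hom}(s,t)$ and $P_s\circ w'=0$ for $w'\in\mathrm{Hom}(t,s)$ whenever the weight of $t$ is strictly less than that of $s$. Here $g_n=P_{2^n}$ ($g_0$ empty). The webs $D_{i,j}$, $0\le i<j\le n$. Place $g_{n-1}$ on the $n-1$ leftmost bottom endpoints. Call the remaining (rightmost) bottom endpoint "0", and label the $n$ top endpoints $1,\dots,n$ from right to left; so the $n+1$ points $0,1,\dots,n$ occur in this order along the region to the right of and above the clasp. Join the points $i$ and $j$ by a type 2 arc, and join the remaining $n-1$ points, in order, to the $n-1$ strands leaving the top of the clasp (the smallest remaining label to the rightmost strand, and so on) by pairwise disjoint type 2 strands; the arc crosses exactly once each of the $j-i-1$ strands ending at labels strictly between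 $i$ and $j$, and no other strand, and each crossing is a tetravalent vertex $X^{(2)}$. (Thus for $i\ge1$ the bottom point $0$ is joined by a cap to the rightmost top strand of the clasp, and $D_{0,1}=g_{n-1}\otimes\mathrm{id}_2$.) *)

theory Defs
  imports
    "HOL-Computational_Algebra.Fraction_Field"
    "HOL-Computational_Algebra.Polynomial"
    "HOL-Library.Poly_Mapping"
begin

section \<open>The ground field\<close>

text \<open>The field of rational functions over the complex numbers in one variable, which is
  \<open>q\<^sup>1\<^sup>/\<^sup>2\<close>; so \<open>q\<^sup>k\<^sup>/\<^sup>2\<close> is \<open>qhalf powi k\<close>.\<close>

type_synonym scalar = "complex poly fract"

definition qhalf :: scalar where
  "qhalf = Fraction_Field.Fract [:0, 1:] 1"

definition qint :: "int \<Rightarrow> scalar" where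
  "qint k = (qhalf powi k - qhalf powi (- k)) / (qhalf - inverse qhalf)"


section \<open>Webs\<close>

text \<open>
  A web is drawn in general position with respect to the height function of the rectangle: every
  horizontal line in generic position meets it in a word of strands, and between two such lines
  there is at most one \<^emph>\<open>piece\<close>, i.e. a local minimum of an edge (\<open>Cup\<close>), a local maximum of an
  edge (\<open>Cap\<close>) or a trivalent vertex. In \<open>Vertex a b\<close> the words \<open>a\<close> and \<open>b\<close> list, from left to
  right, the edges that leave the vertex downwards and upwards; \<open>a @ rev b\<close> lists them all in
  counterclockwise cyclic order. A \<open>layer\<close> \<open>(l, p, r)\<close> is the piece \<open>p\<close> with vertical strands
  \<open>l\<close> to its left and \<open>r\<close> to its right, and a web is a list of layers from bottom to top, together
  with the word of its bottom endpoints. Closed loops without vertices and arbitrary nesting of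
  components are thereby allowed.
\<close>

datatype edge = Single | Double

type_synonym word = "edge list"

datatype piece = Cup edge | Cap edge | Vertex word word

fun piece_bot :: "piece \<Rightarrow> word" where
  "piece_bot (Cup c) = []"
| "piece_bot (Cap c) = [c, c]"
| "piece_bot (Vertex a b) = a"

fun piece_top :: "piece \<Rightarrow> word" where
  "piece_top (Cup c) = [c, c]"
| "piece_top (Cap c) = []"
| "piece_top (Vertex a b) = b"

fun piece_ok :: "piece \<Rightarrow> bool" where
  "piece_ok (Vertex a b) \<longleftrightarrow>
     a @ rev b \<in> {[Single, Single, Double], [Single, Double, Single], [Double, Single, Single]}"
| "piece_ok _ \<longleftrightarrow> True"

type_synonym layer = "word \<times> piece \<times> word"

fun layer_bot :: "layer \<Rightarrow> word" where
  "layer_bot (l, p, r) = l @ piece_bot p @ r"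

fun layer_top :: "layer \<Rightarrow> word" where
  "layer_top (l, p, r) = l @ piece_top p @ r"

fun layer_ok :: "layer \<Rightarrow> bool" where
  "layer_ok (l, p, r) \<longleftrightarrow> piece_ok p"

datatype web = Web (web_bot: word) (web_layers: "layer list")

definition web_top :: "web \<Rightarrow> word" where
  "web_top D = fold (\<lambda>x _. layer_top x) (web_layers D) (web_bot D)"

fun layers_path :: "word \<Rightarrow> layer list \<Rightarrow> word \<Rightarrow> bool" where
  "layers_path s [] t \<longleftrightarrow> s = t"
| "layers_path s (x # xs) t \<longleftrightarrow> layer_ok x \<and> layer_bot x = s \<and> layers_path (layer_top x) xs t"

definition webs :: "word \<Rightarrow> word \<Rightarrow> web set" where
  "webs s t = {D. layers_path (web_bot D) (web_layers D) t \<and> web_bot D = s}"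

definition web_id :: "word \<Rightarrow> web" where
  "web_id s = Web s []"

text \<open>Stacking; the left factor is on top.\<close>

definition web_comp :: "web \<Rightarrow> web \<Rightarrow> web" where
  "web_comp D E = Web (web_bot E) (web_layers E @ web_layers D)"

text \<open>Juxtaposition; to reach general position, the left factor is drawn lower.\<close>

definition web_tensor :: "web \<Rightarrow> web \<Rightarrow> web" where
  "web_tensor D E = Web (web_bot D @ web_bot E)
     (map (\<lambda>(l, p, r). (l, p, r @ web_bot E)) (web_layers D) @
      map (\<lambda>(l, p, r). (web_top D @ l, p, r)) (web_layers E))"

text \<open>The web \<open>X\<close> placed in a box inside a larger web.\<close>

definition in_context :: "web \<Rightarrow> word \<Rightarrow> web \<Rightarrow> word \<Rightarrow> web \<Rightarrow> web" where
  "in_context A l X r B = web_comp A (web_comp (web_tensor (web_tensor (web_id l) X) (web_id r)) B)"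

text \<open>
  The elementary planar isotopies that do not preserve the general position: two pieces next to
  each other exchange their heights; a local minimum and an adjacent local maximum of an edge
  cancel; the rightmost or leftmost edge that leaves a vertex upwards and then turns down is pulled
  straight, and so leaves the vertex downwards.
\<close>

inductive isotopy_move :: "web \<Rightarrow> web \<Rightarrow> bool" where
  exchange: "piece_ok p \<Longrightarrow> piece_ok p' \<Longrightarrow> isotopy_move
     (Web (piece_bot p @ m @ piece_bot p')
        [([], p, m @ piece_bot p'), (piece_top p @ m, p', [])])
     (Web (piece_bot p @ m @ piece_bot p')
        [(piece_bot p @ m, p', []), ([], p, m @ piece_top p')])"
| straighten_right: "isotopy_move (Web [c] [([c], Cup c, []), ([], Cap c, [c])]) (Web [c] [])"
| straighten_left: "isotopy_move (Web [c] [([], Cup c, [c]), ([c], Cap c, [])]) (Web [c] [])"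
| bend_right: "piece_ok (Vertex a (b @ [c])) \<Longrightarrow> isotopy_move
     (Web (a @ [c]) [([], Vertex a (b @ [c]), [c]), (b, Cap c, [])])
     (Web (a @ [c]) [([], Vertex (a @ [c]) b, [])])"
| bend_left: "piece_ok (Vertex a (c # b)) \<Longrightarrow> isotopy_move
     (Web (c # a) [([c], Vertex a (c # b), []), ([], Cap c, b)])
     (Web (c # a) [([], Vertex (c # a) b, [])])"

inductive isotopic :: "web \<Rightarrow> web \<Rightarrow> bool" where
  move: "isotopy_move X Y \<Longrightarrow> X \<in> webs a b \<Longrightarrow> A \<in> webs (l @ b @ r) t \<Longrightarrow> B \<in> webs s (l @ a @ r) \<Longrightarrow>
     isotopic (in_context A l X r B) (in_context A l Y r B)"
| refl: "isotopic D D"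
| sym: "isotopic D E \<Longrightarrow> isotopic E D"
| trans: "isotopic D E \<Longrightarrow> isotopic E F \<Longrightarrow> isotopic D F"


section \<open>Morphism spaces\<close>

type_synonym lin = "web \<Rightarrow>\<^sub>0 scalar"

definition lin_web :: "web \<Rightarrow> lin" where
  "lin_web D = Poly_Mapping.single D 1"

definition lin_scale :: "scalar \<Rightarrow> lin \<Rightarrow> lin" (infixr "*\<^sub>w" 75) where
  "c *\<^sub>w F = Poly_Mapping.map (\<lambda>x. c * x) F"

definition bilinear_ext :: "(web \<Rightarrow> web \<Rightarrow> web) \<Rightarrow> lin \<Rightarrow> lin \<Rightarrow> lin" where
  "bilinear_ext h F G = (\<Sum>D\<in>Poly_Mapping.keys F. \<Sum>E\<in>Poly_Mapping.keys G.
     Poly_Mapping.single (h D E) (Poly_Mapping.lookup F D * Poly_Mapping.lookup G E))"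

definition lin_comp :: "lin \<Rightarrow> lin \<Rightarrow> lin" (infixl "\<circ>\<^sub>w" 70) where
  "F \<circ>\<^sub>w G = bilinear_ext web_comp F G"

definition lin_tensor :: "lin \<Rightarrow> lin \<Rightarrow> lin" (infixl "\<otimes>\<^sub>w" 73) where
  "F \<otimes>\<^sub>w G = bilinear_ext web_tensor F G"

definition ident :: "word \<Rightarrow> lin" where
  "ident s = lin_web (web_id s)"

definition combos :: "word \<Rightarrow> word \<Rightarrow> lin set" where
  "combos s t = {F. Poly_Mapping.keys F \<subseteq> webs s t}"

text \<open>
  \<open>local_relation a b F\<close> says that \<open>F = 0\<close> is one of the defining local relations, drawn in a box
  with bottom word \<open>a\<close> and top word \<open>b\<close>.
\<close>

inductive local_relation :: "word \<Rightarrow> word \<Rightarrow> lin \<Rightarrow> bool" where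
  loop_single: "local_relation [] []
     (lin_web (Web [] [([], Cup Single, []), ([], Cap Single, [])])
        - (- (qint 6 * qint 2 / qint 3)) *\<^sub>w ident [])"
| loop_double: "local_relation [] []
     (lin_web (Web [] [([], Cup Double, []), ([], Cap Double, [])])
        - (qint 6 * qint 5 / (qint 3 * qint 2)) *\<^sub>w ident [])"
| monogon: "local_relation [Double] []
     (lin_web (Web [Double] [([], Vertex [Double] [Single, Single], []), ([], Cap Single, [])]))"
| bigon: "local_relation [Double] [Double]
     (lin_web (Web [Double] [([], Vertex [Double] [Single, Single], []),
                             ([], Vertex [Single, Single] [Double], [])])
        - (- (qint 2 ^ 2)) *\<^sub>w ident [Double])"
| triangle: "local_relation [Double, Double] [Double]
     (lin_web (Web [Double, Double]
        [([], Vertex [Double] [Single, Single], [Double]),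
         ([Single], Vertex [Single, Double] [Single], []),
         ([], Vertex [Single, Single] [Double], [])]))"
| IJUV: "local_relation [Single, Single] [Single, Single]
     ((lin_web (Web [Single, Single]
         [([], Vertex [Single, Single] [Double], []), ([], Vertex [Double] [Single, Single], [])])
       - lin_web (Web [Single, Single]
         [([], Vertex [Single] [Single, Double], [Single]),
          ([Single], Vertex [Double, Single] [Single], [])]))
      - (lin_web (Web [Single, Single] [([], Cap Single, []), ([], Cup Single, [])])
         - ident [Single, Single]))"

text \<open>The subspace of \<open>combos s t\<close> by which one divides to obtain \<open>Hom(s, t)\<close>.\<close>

inductive_set relations :: "word \<Rightarrow> word \<Rightarrow> lin set" for s t :: word where
  isotopy: "D \<in> webs s t \<Longrightarrow> E \<in> webs s t \<Longrightarrow> isotopic D E \<Longrightarrow>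
     lin_web D - lin_web E \<in> relations s t"
| local: "local_relation a b F \<Longrightarrow> A \<in> webs (l @ b @ r) t \<Longrightarrow> B \<in> webs s (l @ a @ r) \<Longrightarrow>
     lin_web A \<circ>\<^sub>w (ident l \<otimes>\<^sub>w F \<otimes>\<^sub>w ident r) \<circ>\<^sub>w lin_web B \<in> relations s t"
| zero: "0 \<in> relations s t"
| add: "F \<in> relations s t \<Longrightarrow> G \<in> relations s t \<Longrightarrow> F + G \<in> relations s t"
| scale: "F \<in> relations s t \<Longrightarrow> c *\<^sub>w F \<in> relations s t"

text \<open>Equality in \<open>Hom(s, t)\<close> of the classes of two formal linear combinations of webs.\<close>

definition hom_eq :: "word \<Rightarrow> word \<Rightarrow> lin \<Rightarrow> lin \<Rightarrow> bool" where
  "hom_eq s t F G \<longleftrightarrow> F \<in> combos s t \<and> G \<in> combos s t \<and> F - G \<in> relations s t"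


section \<open>Clasps\<close>

text \<open>The pair \<open>(a, b)\<close> stands for \<open>a\<lambda>\<^sub>1 + b\<lambda>\<^sub>2\<close>. The order lives on the whole weight lattice:
  a chain of generating steps between two dominant weights may have to leave the dominant
  weights, as in \<open>(1, 1) \<succ> (-1, 2) \<succ> (1, 0)\<close>.\<close>

type_synonym weight = "int \<times> int"

definition word_weight :: "word \<Rightarrow> weight" where
  "word_weight s = (int (count_list s Single), int (count_list s Double))"

inductive weight_less :: "weight \<Rightarrow> weight \<Rightarrow> bool" where
  step1: "weight_less (a - 2, b + 1) (a, b)"
| step2: "weight_less (a + 2, b - 2) (a, b)"
| trans: "weight_less x y \<Longrightarrow> weight_less y z \<Longrightarrow> weight_less x z"

definition is_clasp :: "word \<Rightarrow> lin \<Rightarrow> bool" where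
  "is_clasp s P \<longleftrightarrow>
     P \<in> combos s s \<and> \<not> hom_eq s s P 0 \<and> hom_eq s s (P \<circ>\<^sub>w P) P \<and>
     (\<forall>t. weight_less (word_weight t) (word_weight s) \<longrightarrow>
        (\<forall>W \<in> combos s t. hom_eq s t (W \<circ>\<^sub>w P) 0) \<and>
        (\<forall>W \<in> combos t s. hom_eq t s (P \<circ>\<^sub>w W) 0))"


section \<open>The webs \<open>D\<^sub>i\<^sub>,\<^sub>j\<close>\<close>

definition doubles :: "nat \<Rightarrow> word" where
  "doubles k = replicate k Double"

text \<open>The tetravalent vertex. The four layers are the lower left, lower right, upper left and
  upper right corner of the square.\<close>

definition crossing :: lin where
  "crossing = lin_web (Web [Double, Double]
     [([], Vertex [Double] [Single, Single], [Double]),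
      ([Single], Vertex [Single, Double] [Single], []),
      ([], Vertex [Single] [Double, Single], [Single]),
      ([Double], Vertex [Single, Single] [Double], [])])"

text \<open>The strand with \<open>i\<close> strands to its right, among \<open>n\<close> strands, crosses the next \<open>m\<close> strands
  to its left.\<close>

fun crossings :: "nat \<Rightarrow> nat \<Rightarrow> nat \<Rightarrow> lin" where
  "crossings n i 0 = ident (doubles n)"
| "crossings n i (Suc m) =
     (ident (doubles (n - i - m - 2)) \<otimes>\<^sub>w crossing \<otimes>\<^sub>w ident (doubles (i + m))) \<circ>\<^sub>w crossings n i m"

text \<open>A cap on the two rightmost of \<open>n\<close> strands, and above it a cup whose right end has
  \<open>i - 1\<close> strands to its right, i.e. ends at label \<open>i\<close>.\<close>

definition turnback :: "nat \<Rightarrow> nat \<Rightarrow> lin" where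
  "turnback n i =
     (ident (doubles (n - i - 1)) \<otimes>\<^sub>w lin_web (Web [] [([], Cup Double, [])])
        \<otimes>\<^sub>w ident (doubles (i - 1))) \<circ>\<^sub>w
     (ident (doubles (n - 2)) \<otimes>\<^sub>w lin_web (Web [Double, Double] [([], Cap Double, [])]))"

text \<open>The web \<open>D\<^sub>i\<^sub>,\<^sub>j\<close> for \<open>0 \<le> i < j \<le> n\<close> containing \<open>Q\<close>, an element of
  \<open>Hom(2\<^sup>n\<^sup>-\<^sup>1, 2\<^sup>n\<^sup>-\<^sup>1)\<close>. If \<open>i = 0\<close>, the arc is the strand from the rightmost bottom endpoint, which
  crosses \<open>j - 1\<close> strands. If \<open>i \<ge> 1\<close>, it is the cup, whose left end crosses \<open>j - i - 1\<close> strands.\<close>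

definition D_web :: "nat \<Rightarrow> lin \<Rightarrow> nat \<Rightarrow> nat \<Rightarrow> lin" where
  "D_web n Q i j =
     (if i = 0 then crossings n 0 (j - 1)
      else crossings n i (j - i - 1) \<circ>\<^sub>w turnback n i) \<circ>\<^sub>w (Q \<otimes>\<^sub>w ident [Double])"

end

theory Submission
  imports Defs
begin

text \<open>All morphism spaces sit in one ring \<open>hom\<close>. Call an endomorphism of \<open>2\<^sup>n\<close> lower if it factors
  through the lower half \<open>hdown\<close> of a tetravalent vertex on two adjacent strands, that is, through a
  word with two letters 2 replaced by two letters 1. Opening every double strand into two single strands
  reduces webs to cups, caps and ladders (two vertices joined by a double edge); the relation
  \<open>I - J = U - V\<close> brings these into a normal form which, modulo lower morphisms, is that of a
  Temperley-Lieb algebra. Hence an endomorphism of \<open>2\<^sup>n\<close> is a multiple of the identity plus a lower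
  one, and \<open>g\<^sub>n\<close> is the identity plus a lower one. The right-hand side \<open>Q\<close> of the expansion is killed
  by every \<open>hdown\<close>: sliding \<open>hdown\<close> through the crossings leaves three neighbouring values of \<open>i\<close>,
  and their contributions cancel by recurrences between quantum integers. So \<open>g\<^sub>n Q = Q\<close>. On the
  other hand \<open>g\<^sub>n\<close> kills all crossings and cups, which leaves
  \<open>g\<^sub>n Q = g\<^sub>n (g\<^sub>n\<^sub>-\<^sub>1 \<otimes> id) = g\<^sub>n\<close>.\<close>

subsection \<open>Linear extension\<close>

text \<open>A clasp is defined by what it kills. That it fixes every morphism killed by all
  \<open>hdown\<close> needs an upper bound on \<open>Hom(2^n, 2^n)\<close>, but a presentation by
  relations comes with neither a basis nor a dimension. The bound is obtained by rewriting: opened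
  \<open>2^n\<close> is governed by the product \<open>E\<close> of the ladders at even positions,
  every cap is lower, and without caps the triangle relation leaves
  \<open>L_i L_{i+1} L_i = -\<delta> L_i\<close>. Jones' argument gives \<open>E x E = c E\<close>
  modulo lower terms. The hard point is that a cap stays lower when algebra elements stand below it;
  so caps are first pushed down through ladders (\<open>zigzag\<close>). The coefficients solve a
  recurrence. With crossings divided by \<open>\<alpha> = [2]^2\<close>, \<open>hdown\<close> passes
  one and two crossings with factors \<open>2 - \<alpha> = -(q + 1/q)\<close> and 1. So the numbers
  attached to successive crossings obey the recurrence of quantum integers in steps of two; the
  empty sum starts it at \<open>[0]\<close>, which gives \<open>[2k]\<close>. The dependence on
  \<open>i\<close> obeys the same recurrence, and the terms containing a single cup select its odd
  solution \<open>[2n + 1 - 2i]\<close>.\<close>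

lemma lookup_lin_scale [simp]: "Poly_Mapping.lookup (c *\<^sub>w F) D = c * Poly_Mapping.lookup F D"
  by (simp add: lin_scale_def map.rep_eq when_def)

lemma lin_scale_add: "c *\<^sub>w (F + G) = c *\<^sub>w F + c *\<^sub>w G"
  by (rule poly_mapping_eqI) (simp add: lookup_add distrib_left)

lemma lin_scale_add_left: "(c + d) *\<^sub>w F = c *\<^sub>w F + d *\<^sub>w F"
  by (rule poly_mapping_eqI) (simp add: lookup_add distrib_right)

lemma lin_scale_scale [simp]: "c *\<^sub>w d *\<^sub>w F = (c * d) *\<^sub>w F"
  by (rule poly_mapping_eqI) (simp add: mult.assoc)

lemma lin_scale_0 [simp]: "0 *\<^sub>w F = 0" and lin_scale_zero [simp]: "c *\<^sub>w 0 = 0"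
  and lin_scale_1 [simp]: "1 *\<^sub>w F = F"
  by (auto intro: poly_mapping_eqI)

lemma uminus_lin: "- F = (- 1) *\<^sub>w (F::lin)"
  by (rule poly_mapping_eqI) simp

lemma lin_scale_diff: "c *\<^sub>w (F - G) = c *\<^sub>w F - c *\<^sub>w G"
  by (rule poly_mapping_eqI) (simp add: lookup_minus right_diff_distrib)

lemma single_eq_scale: "Poly_Mapping.single D c = c *\<^sub>w lin_web D"
  by (rule poly_mapping_eqI) (simp add: lin_web_def lookup_single when_def)

lemma lookup_lin_web: "Poly_Mapping.lookup (lin_web D) E = (if D = E then 1 else 0)"
  by (simp add: lin_web_def lookup_single when_def)

lemma keys_lin_web [simp]: "Poly_Mapping.keys (lin_web D) = {D}"
  by (simp add: lin_web_def)

lemma keys_lin_scale: "Poly_Mapping.keys (c *\<^sub>w F) \<subseteq> Poly_Mapping.keys F"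
  by (auto simp: in_keys_iff)

lemma lin_expand: "F = (\<Sum>D\<in>Poly_Mapping.keys F. Poly_Mapping.lookup F D *\<^sub>w lin_web D)"
proof (rule poly_mapping_eqI)
  fix E
  have "(\<Sum>D\<in>Poly_Mapping.keys F. Poly_Mapping.lookup F D * (if D = E then 1 else 0)) =
      (\<Sum>D\<in>Poly_Mapping.keys F. if D = E then Poly_Mapping.lookup F D else 0)"
    by (rule sum.cong) auto
  then show "Poly_Mapping.lookup F E = Poly_Mapping.lookup
      (\<Sum>D\<in>Poly_Mapping.keys F. Poly_Mapping.lookup F D *\<^sub>w lin_web D) E"
    by (simp add: lookup_sum lookup_lin_web in_keys_iff)
qed

lemma combos_induct [consumes 1, case_names web zero add]:
  assumes "F \<in> combos s t"
    and "\<And>c D. D \<in> webs s t \<Longrightarrow> P (c *\<^sub>w lin_web D)"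
    and "P 0"
    and "\<And>F G. P F \<Longrightarrow> P G \<Longrightarrow> P (F + G)"
  shows "P F"
proof -
  have "P (\<Sum>D\<in>K. Poly_Mapping.lookup F D *\<^sub>w lin_web D)"
    if "finite K" "K \<subseteq> Poly_Mapping.keys F" for K
    using that
  proof (induction K rule: finite_induct)
    case (insert D K)
    then show ?case
      using assms by (auto simp: combos_def intro!: assms(4))
  qed (simp add: assms)
  from this[of "Poly_Mapping.keys F"] show ?thesis
    using lin_expand[of F] by simp
qed

lemma lin_induct [case_names web zero add]:
  assumes "\<And>c D. P (c *\<^sub>w lin_web D)" and "P 0" and "\<And>F G. P F \<Longrightarrow> P G \<Longrightarrow> P (F + G)"
  shows "P F"
proof -
  have "P (\<Sum>D\<in>K. Poly_Mapping.lookup F D *\<^sub>w lin_web D)" if "finite K" for K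
    using that by (induction K rule: finite_induct) (auto intro!: assms)
  from this[of "Poly_Mapping.keys F"] show ?thesis
    using lin_expand[of F] by simp
qed

definition lext :: "(web \<Rightarrow> lin) \<Rightarrow> lin \<Rightarrow> lin" where
  "lext \<phi> F = (\<Sum>D\<in>Poly_Mapping.keys F. Poly_Mapping.lookup F D *\<^sub>w \<phi> D)"

lemma lext_superset:
  assumes "finite K" "Poly_Mapping.keys F \<subseteq> K"
  shows "lext \<phi> F = (\<Sum>D\<in>K. Poly_Mapping.lookup F D *\<^sub>w \<phi> D)"
  unfolding lext_def using assms
  by (intro sum.mono_neutral_left) (auto simp: in_keys_iff)

lemma lext_add [simp]: "lext \<phi> (F + G) = lext \<phi> F + lext \<phi> G"
proof -
  let ?K = "Poly_Mapping.keys F \<union> Poly_Mapping.keys G"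
  have "Poly_Mapping.keys (F + G) \<subseteq> ?K"
    by (rule Poly_Mapping.keys_add)
  then show ?thesis
    by (simp add: lext_superset[of ?K] lookup_add lin_scale_add_left sum.distrib)
qed

lemma lin_scale_sum: "c *\<^sub>w (\<Sum>x\<in>A. f x) = (\<Sum>x\<in>A. c *\<^sub>w f x)"
  by (induction A rule: infinite_finite_induct) (auto simp: lin_scale_add)

lemma lext_scale [simp]: "lext \<phi> (c *\<^sub>w F) = c *\<^sub>w lext \<phi> F"
  using lext_superset[of "Poly_Mapping.keys F" "c *\<^sub>w F" \<phi>] keys_lin_scale[of c F]
  by (simp add: lext_def lin_scale_sum)

lemma lext_0 [simp]: "lext \<phi> 0 = 0"
  by (simp add: lext_def)

lemma lext_web [simp]: "lext \<phi> (lin_web D) = \<phi> D"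
  by (simp add: lext_def lookup_lin_web)

lemma lext_uminus [simp]: "lext \<phi> (- F) = - lext \<phi> F"
  by (simp add: uminus_lin)

lemma lext_diff [simp]: "lext \<phi> (F - G) = lext \<phi> F - lext \<phi> G"
  using lext_add[of \<phi> F "- G"] by simp

lemma lext_fun_add: "lext (\<lambda>D. \<phi> D + \<psi> D) F = lext \<phi> F + lext \<psi> F"
  by (simp add: lext_def lin_scale_add sum.distrib)

lemma lext_fun_scale: "lext (\<lambda>D. c *\<^sub>w \<phi> D) F = c *\<^sub>w lext \<phi> F"
  by (simp add: lext_def lin_scale_sum mult.commute)

lemma lext_fun_0 [simp]: "lext (\<lambda>D. 0) F = 0"
  by (simp add: lext_def)

lemma lext_id [simp]: "lext lin_web F = F"
  using lin_expand[of F] by (simp add: lext_def)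

lemma bilinear_ext_lext: "bilinear_ext h F G = lext (\<lambda>D. lext (\<lambda>E. lin_web (h D E)) G) F"
  by (simp add: bilinear_ext_def lext_def lin_scale_sum single_eq_scale)

lemmas lin_comp_lext = lin_comp_def[unfolded bilinear_ext_lext]
lemmas lin_tensor_lext = lin_tensor_def[unfolded bilinear_ext_lext]

lemma lext_in_combos:
  assumes "F \<in> combos s t" "\<And>D. D \<in> webs s t \<Longrightarrow> \<phi> D \<in> combos s' t'"
  shows "lext \<phi> F \<in> combos s' t'"
proof -
  have "Poly_Mapping.keys (lext \<phi> F) \<subseteq> (\<Union>D\<in>Poly_Mapping.keys F.
      Poly_Mapping.keys (Poly_Mapping.lookup F D *\<^sub>w \<phi> D))"
    by (auto simp: lext_def lookup_sum in_keys_iff dest!: sum.not_neutral_contains_not_neutral)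
  also have "\<dots> \<subseteq> webs s' t'"
    using assms keys_lin_scale unfolding combos_def by blast
  finally show ?thesis by (simp add: combos_def)
qed

subsection \<open>Typed webs\<close>

lemma layers_path_append:
  "layers_path s (xs @ ys) t \<longleftrightarrow> (\<exists>u. layers_path s xs u \<and> layers_path u ys t)"
  by (induction xs arbitrary: s) auto

lemma layers_path_top: "layers_path s xs t \<Longrightarrow> fold (\<lambda>x _. layer_top x) xs s = t"
  by (induction xs arbitrary: s) auto

lemma webs_iff: "D \<in> webs s t \<longleftrightarrow> web_bot D = s \<and> layers_path s (web_layers D) t"
  by (auto simp: webs_def)

lemma web_top_webs: "D \<in> webs s t \<Longrightarrow> web_top D = t"
  by (auto simp: webs_iff web_top_def layers_path_top)

lemma webs_unique: "D \<in> webs s t \<Longrightarrow> D \<in> webs s' t' \<Longrightarrow> s = s' \<and> t = t'"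
  using web_top_webs by (auto simp: webs_iff)

definition typed :: "web \<Rightarrow> bool" where
  "typed D \<longleftrightarrow> D \<in> webs (web_bot D) (web_top D)"

lemma webs_typed: "D \<in> webs s t \<longleftrightarrow> typed D \<and> web_bot D = s \<and> web_top D = t"
  unfolding typed_def using web_top_webs[of D s t] by (auto simp: webs_iff)

lemma comp_webs: "D \<in> webs u t \<Longrightarrow> E \<in> webs s u \<Longrightarrow> web_comp D E \<in> webs s t"
  by (auto simp: webs_iff web_comp_def layers_path_append)

lemma id_webs [simp]: "web_id s \<in> webs s s"
  by (simp add: webs_iff web_id_def)

text \<open>Padding on both sides at once, so that nested paddings merge by list append;
  \<open>tensor_id_wpad\<close> identifies it with tensoring by two identities.\<close>

definition wpad :: "word \<Rightarrow> web \<Rightarrow> word \<Rightarrow> web" where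
  "wpad l D r = Web (l @ web_bot D @ r) (map (\<lambda>(l', p, r'). (l @ l', p, r' @ r)) (web_layers D))"

lemma wpad_webs: "D \<in> webs s t \<Longrightarrow> wpad l D r \<in> webs (l @ s @ r) (l @ t @ r)"
proof -
  have "layers_path s xs t \<Longrightarrow>
      layers_path (l @ s @ r) (map (\<lambda>(l', p, r'). (l @ l', p, r' @ r)) xs) (l @ t @ r)" for xs
  proof (induction xs arbitrary: s)
    case (Cons x xs)
    then show ?case
      using Cons.IH[of "layer_top x"] by (cases x) auto
  qed simp
  then show "D \<in> webs s t \<Longrightarrow> ?thesis"
    by (auto simp: webs_iff wpad_def)
qed

lemma tensor_id_wpad: "web_tensor (web_tensor (web_id l) D) (web_id r) = wpad l D r"
  by (simp add: web_tensor_def web_id_def web_top_def wpad_def comp_def case_prod_beta)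

lemma wpad_wpad [simp]: "wpad l (wpad l' D r') r = wpad (l @ l') D (r' @ r)"
  by (simp add: wpad_def case_prod_beta)

lemma wpad_Nil [simp]: "wpad [] D [] = D"
  by (cases D) (simp add: wpad_def)

lemma wpad_id [simp]: "wpad l (web_id s) r = web_id (l @ s @ r)"
  by (simp add: wpad_def web_id_def)

lemma web_comp_assoc: "web_comp (web_comp D E) F = web_comp D (web_comp E F)"
  by (simp add: web_comp_def)

lemma wpad_comp: "wpad l (web_comp D E) r = web_comp (wpad l D r) (wpad l E r)"
  by (simp add: wpad_def web_comp_def)

lemma comp_id: "web_comp D (web_id (web_bot D)) = D" "web_comp (web_id s) D = D"
  by (cases D; simp add: web_comp_def web_id_def)+

definition lpad :: "word \<Rightarrow> lin \<Rightarrow> word \<Rightarrow> lin" where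
  "lpad l F r = lext (\<lambda>D. lin_web (wpad l D r)) F"

lemma lpad_tensor: "ident l \<otimes>\<^sub>w F \<otimes>\<^sub>w ident r = lpad l F r"
  by (induction F rule: lin_induct)
     (simp_all add: lin_tensor_lext ident_def lpad_def tensor_id_wpad lext_fun_add)

subsection \<open>Closure properties of the relations\<close>

lemma in_context_wpad: "in_context A l X r B = web_comp A (web_comp (wpad l X r) B)"
  by (simp add: in_context_def tensor_id_wpad)

lemma isotopy_move_webs: "isotopy_move X Y \<Longrightarrow> X \<in> webs a b \<Longrightarrow> Y \<in> webs a b"
  by (induction rule: isotopy_move.induct) (auto simp: webs_iff)

lemma isotopic_webs: "isotopic D E \<Longrightarrow> D \<in> webs s t \<longleftrightarrow> E \<in> webs s t"
proof (induction arbitrary: s t rule: isotopic.induct)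
  case (move X Y a b A l r t' B s')
  have *: "in_context A l Z r B \<in> webs s' t'" if "Z \<in> webs a b" for Z
    using that move by (auto simp: in_context_wpad intro!: comp_webs wpad_webs)
  show ?case
    using *[OF move(2)] *[OF isotopy_move_webs[OF move(1,2)]] webs_unique by blast
qed auto

text \<open>A generating move already carries a context, whose upper part \<open>A\<close> absorbs
  \<open>C\<close>. The end words in the rule are the given ones because a web determines its end
  words.\<close>

lemma isotopic_comp_left:
  assumes "isotopic D E" "D \<in> webs s t" "C \<in> webs t u"
  shows "isotopic (web_comp C D) (web_comp C E)"
  using assms
proof (induction arbitrary: rule: isotopic.induct)
  case (move X Y a b A l r t' B s')
  have "in_context A l X r B \<in> webs s' t'"
    using move by (auto simp: in_context_wpad intro!: comp_webs wpad_webs)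
  then have "t' = t"
    using move webs_unique by blast
  then show ?case
    using isotopic.move[OF move(1,2), of "web_comp C A" l r u B s'] move
    by (auto simp: in_context_wpad web_comp_assoc intro: comp_webs)
next
  case (sym D E)
  then show ?case
    by (meson isotopic.sym isotopic_webs)
next
  case (trans D E F)
  then show ?case
    by (meson isotopic.trans isotopic_webs)
qed (rule isotopic.refl)

lemma isotopic_comp_right:
  assumes "isotopic D E" "D \<in> webs s t" "C \<in> webs u s"
  shows "isotopic (web_comp D C) (web_comp E C)"
  using assms
proof (induction arbitrary: rule: isotopic.induct)
  case (move X Y a b A l r t' B s')
  have "in_context A l X r B \<in> webs s' t'"
    using move by (auto simp: in_context_wpad intro!: comp_webs wpad_webs)
  then have "s' = s"
    using move webs_unique by blast
  then show ?case
    using isotopic.move[OF move(1,2), of A l r t' "web_comp B C" u] move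
    by (auto simp: in_context_wpad web_comp_assoc intro: comp_webs)
next
  case (sym D E)
  then show ?case
    by (meson isotopic.sym isotopic_webs)
next
  case (trans D E F)
  then show ?case
    by (meson isotopic.trans isotopic_webs)
qed (rule isotopic.refl)

lemma isotopic_wpad: "isotopic D E \<Longrightarrow> isotopic (wpad l D r) (wpad l E r)"
proof (induction rule: isotopic.induct)
  case (move X Y a b A l' r' t' B s')
  show ?case
    using isotopic.move[OF move(1,2), of "wpad l A r" "l @ l'" "r' @ r" "l @ t' @ r" "wpad l B r" "l @ s' @ r"]
      wpad_webs[OF move(3), of l r] wpad_webs[OF move(4), of l r]
    by (simp add: in_context_wpad wpad_comp)
qed (blast intro: isotopic.refl isotopic.sym isotopic.trans)+

lemma relation_context:
  "lin_web A \<circ>\<^sub>w (ident l \<otimes>\<^sub>w F \<otimes>\<^sub>w ident r) \<circ>\<^sub>w lin_web B =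
     lext (\<lambda>D. lin_web (web_comp A (web_comp (wpad l D r) B))) F"
  by (induction F rule: lin_induct)
     (simp_all add: lpad_tensor lpad_def lin_comp_lext web_comp_assoc)

lemma lext_lext_web: "lext \<phi> (lext (\<lambda>D. lin_web (f D)) F) = lext (\<lambda>D. \<phi> (f D)) F"
  by (induction F rule: lin_induct) auto

definition lcompl :: "web \<Rightarrow> lin \<Rightarrow> lin" where
  "lcompl C F = lext (\<lambda>D. lin_web (web_comp C D)) F"

definition lcompr :: "lin \<Rightarrow> web \<Rightarrow> lin" where
  "lcompr F C = lext (\<lambda>D. lin_web (web_comp D C)) F"

lemma relations_lcompl:
  "R \<in> relations s t \<Longrightarrow> C \<in> webs t u \<Longrightarrow> lcompl C R \<in> relations s u"
proof (induction rule: relations.induct)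
  case (isotopy D E)
  then show ?case
    by (auto simp: lcompl_def intro!: relations.isotopy comp_webs isotopic_comp_left)
next
  case (local a b F A l r B)
  then show ?case
    using relations.local[of a b F "web_comp C A" l r u B s] comp_webs
    by (auto simp: lcompl_def relation_context lext_lext_web web_comp_assoc)
qed (auto simp: lcompl_def intro: relations.intros)

lemma relations_lcompr:
  "R \<in> relations s t \<Longrightarrow> C \<in> webs u s \<Longrightarrow> lcompr R C \<in> relations u t"
proof (induction rule: relations.induct)
  case (isotopy D E)
  then show ?case
    by (auto simp: lcompr_def intro!: relations.isotopy comp_webs isotopic_comp_right)
next
  case (local a b F A l r B)
  then show ?case
    using relations.local[of a b F A l r t "web_comp B C" u] comp_webs
    by (auto simp: lcompr_def relation_context lext_lext_web web_comp_assoc)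
qed (auto simp: lcompr_def intro: relations.intros)

lemma relations_lpad: "R \<in> relations s t \<Longrightarrow> lpad l R r \<in> relations (l @ s @ r) (l @ t @ r)"
proof (induction rule: relations.induct)
  case (isotopy D E)
  then show ?case
    by (auto simp: lpad_def intro!: relations.isotopy wpad_webs isotopic_wpad)
next
  case (local a b F A l' r' B)
  then show ?case
    using relations.local[of a b F "wpad l A r" "l @ l'" "r' @ r" "l @ t @ r" "wpad l B r" "l @ s @ r"]
      wpad_webs[OF local(2), of l r] wpad_webs[OF local(3), of l r]
    by (simp add: lpad_def relation_context lext_lext_web wpad_comp)
qed (auto simp: lpad_def intro: relations.intros)

lemma combos_0 [simp]: "0 \<in> combos s t"
  by (simp add: combos_def)

lemma combos_add: "F \<in> combos s t \<Longrightarrow> G \<in> combos s t \<Longrightarrow> F + G \<in> combos s t"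
  unfolding combos_def using Poly_Mapping.keys_add[of F G] by blast

lemma combos_scale: "F \<in> combos s t \<Longrightarrow> c *\<^sub>w F \<in> combos s t"
  unfolding combos_def using keys_lin_scale[of c F] by blast

lemma combos_diff: "F \<in> combos s t \<Longrightarrow> G \<in> combos s t \<Longrightarrow> F - G \<in> combos s t"
  using combos_add[of F s t "- G"] combos_scale[of G s t "-1"] by (simp add: uminus_lin[symmetric])

lemma combos_web [simp]: "lin_web D \<in> combos s t \<longleftrightarrow> D \<in> webs s t"
  by (simp add: combos_def)

lemma combos_sum: "(\<And>x. x \<in> A \<Longrightarrow> f x \<in> combos s t) \<Longrightarrow> (\<Sum>x\<in>A. f x) \<in> combos s t"
  by (induction A rule: infinite_finite_induct) (auto intro: combos_add)

lemma combos_comp: "F \<in> combos u t \<Longrightarrow> G \<in> combos s u \<Longrightarrow> F \<circ>\<^sub>w G \<in> combos s t"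
  by (auto simp: lin_comp_lext intro!: lext_in_combos comp_webs)

lemma combos_lpad: "F \<in> combos s t \<Longrightarrow> lpad l F r \<in> combos (l @ s @ r) (l @ t @ r)"
  unfolding lpad_def by (rule lext_in_combos) (auto intro: wpad_webs)

lemma local_relation_combos: "local_relation a b F \<Longrightarrow> F \<in> combos a b"
  by (induction rule: local_relation.induct)
     (auto simp: ident_def webs_iff web_id_def intro!: combos_diff combos_scale)

lemma relations_combos: "R \<in> relations s t \<Longrightarrow> R \<in> combos s t"
proof (induction rule: relations.induct)
  case (local a b F A l r B)
  have "lpad l F r \<in> combos (l @ a @ r) (l @ b @ r)"
    by (intro combos_lpad local_relation_combos local)
  then show ?case
    unfolding lpad_tensor using local(2,3) combos_comp combos_web by blast
qed (auto intro: combos_diff combos_add combos_scale)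

subsection \<open>The category of webs as a ring\<close>

definition proj :: "word \<Rightarrow> word \<Rightarrow> lin \<Rightarrow> lin" where
  "proj s t F = lext (\<lambda>D. if D \<in> webs s t then lin_web D else 0) F"

lemma proj_id: "F \<in> combos s t \<Longrightarrow> proj s t F = F"
  by (induction rule: combos_induct) (auto simp: proj_def)

lemma proj_other: "F \<in> combos s' t' \<Longrightarrow> (s', t') \<noteq> (s, t) \<Longrightarrow> proj s t F = 0"
  by (induction rule: combos_induct) (auto simp: proj_def dest: webs_unique)

text \<open>A list of layers that do not fit together is identified with \<open>0\<close>, and so is the product of webs
  with different middle words. This makes the quotient by \<open>null\<close> a ring containing all
  \<open>Hom(s, t)\<close>.\<close>

definition null :: "lin set" where
  "null = {F. \<forall>s t. proj s t F \<in> relations s t}"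

lemma null_0 [simp]: "0 \<in> null"
  by (simp add: null_def proj_def relations.zero)

lemma null_add: "F \<in> null \<Longrightarrow> G \<in> null \<Longrightarrow> F + G \<in> null"
  by (auto simp: null_def proj_def relations.add)

lemma null_scale: "F \<in> null \<Longrightarrow> c *\<^sub>w F \<in> null"
  by (auto simp: null_def proj_def relations.scale)

lemma null_uminus: "F \<in> null \<Longrightarrow> - F \<in> null"
  by (simp add: uminus_lin null_scale)

lemma null_diff: "F \<in> null \<Longrightarrow> G \<in> null \<Longrightarrow> F - G \<in> null"
  using null_add[of F "-G"] null_uminus by simp

text \<open>Webs of one type have only one component, so the passage to the big quotient neither
  adds nor loses relations in a single \<open>Hom(s, t)\<close>.\<close>

lemma null_combos: "F \<in> combos s t \<Longrightarrow> F \<in> null \<longleftrightarrow> F \<in> relations s t"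
proof
  assume F: "F \<in> combos s t" "F \<in> relations s t"
  show "F \<in> null"
    unfolding null_def
  proof (intro CollectI allI)
    fix s' t'
    show "proj s' t' F \<in> relations s' t'"
      by (cases "(s, t) = (s', t')")
         (use F proj_id[OF F(1)] proj_other[OF F(1), of s' t'] in \<open>auto intro: relations.zero\<close>)
  qed
qed (metis (mono_tags, lifting) mem_Collect_eq null_def proj_id)

definition wmul :: "web \<Rightarrow> web \<Rightarrow> lin" where
  "wmul D E = (if typed D \<and> typed E \<and> web_bot D = web_top E then lin_web (web_comp D E) else 0)"

definition tmul :: "lin \<Rightarrow> lin \<Rightarrow> lin" where
  "tmul F G = lext (\<lambda>D. lext (wmul D) G) F"

definition tpad :: "word \<Rightarrow> lin \<Rightarrow> word \<Rightarrow> lin" where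
  "tpad l F r = lext (\<lambda>D. if typed D then lin_web (wpad l D r) else 0) F"

lemma tmul_add: "tmul (F + F') G = tmul F G + tmul F' G" "tmul F (G + G') = tmul F G + tmul F G'"
  by (simp_all add: tmul_def lext_fun_add)

lemma tmul_scale: "tmul (c *\<^sub>w F) G = c *\<^sub>w tmul F G" "tmul F (c *\<^sub>w G) = c *\<^sub>w tmul F G"
  by (simp_all add: tmul_def lext_fun_scale)

lemma tmul_0: "tmul 0 G = 0" "tmul F 0 = 0"
  by (simp_all add: tmul_def)

lemma tmul_diff: "tmul (F - F') G = tmul F G - tmul F' G" "tmul F (G - G') = tmul F G - tmul F G'"
  using tmul_add(1)[of "F - F'" F' G] tmul_add(2)[of F "G - G'" G'] by (auto simp: eq_diff_eq)

lemma tmul_web: "tmul (lin_web D) (lin_web E) = wmul D E"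
  by (simp add: tmul_def)

lemma tpad_add: "tpad l (F + G) r = tpad l F r + tpad l G r"
  and tpad_scale: "tpad l (c *\<^sub>w F) r = c *\<^sub>w tpad l F r"
  and tpad_diff: "tpad l (F - G) r = tpad l F r - tpad l G r"
  and tpad_0: "tpad l 0 r = 0"
  by (simp_all add: tpad_def)

lemma comp_typed: "typed D \<Longrightarrow> typed E \<Longrightarrow> web_bot D = web_top E \<Longrightarrow>
   typed (web_comp D E) \<and> web_bot (web_comp D E) = web_bot E \<and> web_top (web_comp D E) = web_top D"
  using comp_webs[of D "web_top E" "web_top D" E "web_bot E"] by (simp add: webs_typed)

lemma wpad_typed: "typed D \<Longrightarrow> typed (wpad l D r) \<and> web_bot (wpad l D r) = l @ web_bot D @ r
   \<and> web_top (wpad l D r) = l @ web_top D @ r"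
  using wpad_webs[of D "web_bot D" "web_top D" l r] by (simp add: webs_typed)

lemma tmul_assoc: "tmul (tmul F G) H = tmul F (tmul G H)"
proof (induction F rule: lin_induct)
  case (web c D)
  then show ?case
  proof (induction G rule: lin_induct)
    case (web b E)
    show ?case
    proof (induction H rule: lin_induct)
      case (web a F)
      show ?case
        by (auto simp: tmul_scale tmul_web wmul_def tmul_0 comp_typed web_comp_assoc mult.assoc)
    qed (simp_all add: tmul_add tmul_0)
  qed (simp_all add: tmul_add tmul_0)
qed (simp_all add: tmul_add tmul_0)

lemma tpad_tmul: "tpad l (tmul F G) r = tmul (tpad l F r) (tpad l G r)"
proof (induction F rule: lin_induct)
  case (web c D)
  then show ?case
  proof (induction G rule: lin_induct)
    case (web b E)
    show ?case
      by (auto simp: tmul_scale tmul_web wmul_def tmul_0 comp_typed tpad_scale tpad_0 tpad_def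
          wpad_comp wpad_typed)
  qed (simp_all add: tmul_add tmul_0 tpad_add tpad_0)
qed (simp_all add: tmul_add tmul_0 tpad_add tpad_0)

lemma tpad_tpad: "tpad l (tpad l' F r') r = tpad (l @ l') F (r' @ r)"
  by (induction F rule: lin_induct)
     (auto simp: tpad_add tpad_0 tpad_scale, auto simp: tpad_def wpad_typed)

text \<open>By bilinearity the other factor is one web \<open>E\<close>. A component of the product
  is then a single component of \<open>F\<close> composed with \<open>E\<close>, or \<open>0\<close>
  if the end words disagree.\<close>

lemma tmul_null:
  assumes "F \<in> null"
  shows "tmul F G \<in> null" "tmul G F \<in> null"
proof -
  show "tmul F G \<in> null"
  proof (induction G rule: lin_induct)
    case (web c E)
    have "proj s t (tmul F (lin_web E)) \<in> relations s t" for s t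
    proof (cases "typed E \<and> web_bot E = s")
      case True
      have "proj s t (tmul F (lin_web E)) = lcompr (proj (web_top E) t F) E" for F
        by (induction F rule: lin_induct)
           (use True in \<open>auto simp: tmul_def proj_def lcompr_def webs_typed wmul_def comp_typed\<close>)
      then show ?thesis
        using assms True relations_lcompr[of _ "web_top E" t E s] by (auto simp: null_def webs_typed)
    next
      case False
      have "proj s t (tmul F (lin_web E)) = 0" for F
        by (induction F rule: lin_induct)
           (use False in \<open>auto simp: tmul_def proj_def webs_typed wmul_def comp_typed\<close>)
      then show ?thesis by (simp add: relations.zero)
    qed
    then show ?case
      unfolding tmul_scale by (intro null_scale) (simp add: null_def)
  qed (auto simp: tmul_0 tmul_add null_add)
  show "tmul G F \<in> null"
  proof (induction G rule: lin_induct)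
    case (web c E)
    have "proj s t (tmul (lin_web E) F) \<in> relations s t" for s t
    proof (cases "typed E \<and> web_top E = t")
      case True
      have "proj s t (tmul (lin_web E) F) = lcompl E (proj s (web_bot E) F)" for F
        by (induction F rule: lin_induct)
           (use True in \<open>auto simp: tmul_def proj_def lcompl_def webs_typed wmul_def comp_typed\<close>)
      then show ?thesis
        using assms True relations_lcompl[of _ s "web_bot E" E t] by (auto simp: null_def webs_typed)
    next
      case False
      have "proj s t (tmul (lin_web E) F) = 0" for F
        by (induction F rule: lin_induct)
           (use False in \<open>auto simp: tmul_def proj_def webs_typed wmul_def comp_typed\<close>)
      then show ?thesis by (simp add: relations.zero)
    qed
    then show ?case
      unfolding tmul_scale by (intro null_scale) (simp add: null_def)
  qed (auto simp: tmul_0 tmul_add null_add)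
qed

lemma tpad_null:
  assumes "F \<in> null"
  shows "tpad l F r \<in> null"
proof -
  have "proj s t (tpad l F r) \<in> relations s t" for s t
  proof (cases "\<exists>s' t'. s = l @ s' @ r \<and> t = l @ t' @ r")
    case True
    then obtain s' t' where st: "s = l @ s' @ r" "t = l @ t' @ r" by blast
    have "proj s t (tpad l F r) = lpad l (proj s' t' F) r" for F
      by (induction F rule: lin_induct)
         (use st in \<open>auto simp: tpad_def proj_def lpad_def webs_typed wpad_typed\<close>)
    then show ?thesis
      using assms st by (auto simp: null_def intro: relations_lpad)
  next
    case False
    have "proj s t (tpad l F r) = 0" for F
      by (induction F rule: lin_induct)
         (use False in \<open>auto simp: tpad_def proj_def webs_typed wpad_typed\<close>)
    then show ?thesis by (simp add: relations.zero)
  qed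
  then show ?thesis by (simp add: null_def)
qed

quotient_type hom = lin / "\<lambda>F G. F - G \<in> null"
proof (rule equivpI)
  show "reflp (\<lambda>F G. F - G \<in> null)"
    by (simp add: reflp_def)
  show "symp (\<lambda>F G. F - G \<in> null)"
    using null_uminus by (fastforce simp: symp_def)
  show "transp (\<lambda>F G. F - G \<in> null)"
    using null_add by (fastforce simp: transp_def)
qed

text \<open>A ring without unit: there is no single identity web, each word \<open>s\<close> has its
  own \<open>idn s\<close>, which acts as identity only on morphisms starting or ending at
  \<open>s\<close>.\<close>

instantiation hom :: ring
begin

lift_definition zero_hom :: hom is 0 .
lift_definition plus_hom :: "hom \<Rightarrow> hom \<Rightarrow> hom" is "(+)"
  using null_add by (fastforce simp: algebra_simps)
lift_definition uminus_hom :: "hom \<Rightarrow> hom" is "uminus"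
  using null_uminus by fastforce
lift_definition minus_hom :: "hom \<Rightarrow> hom \<Rightarrow> hom" is "(-)"
  using null_diff by (fastforce simp: algebra_simps)
lift_definition times_hom :: "hom \<Rightarrow> hom \<Rightarrow> hom" is tmul
proof -
  fix F F' G G'
  assume "F - F' \<in> null" "G - G' \<in> null"
  then have "tmul (F - F') G + tmul F' (G - G') \<in> null"
    by (intro null_add tmul_null)
  then show "tmul F G - tmul F' G' \<in> null"
    by (simp add: tmul_diff)
qed

instance
  by standard (transfer; simp add: tmul_assoc tmul_add algebra_simps del: diff_0_right)+

end

lift_definition sc :: "scalar \<Rightarrow> hom \<Rightarrow> hom" is "(*\<^sub>w)"
  by (simp add: null_scale flip: lin_scale_diff)

lift_definition box :: "word \<Rightarrow> hom \<Rightarrow> word \<Rightarrow> hom" is tpad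
  by (simp flip: tpad_diff add: tpad_null)

abbreviation cls :: "lin \<Rightarrow> hom" where "cls \<equiv> abs_hom"

lemma cls_eq_iff: "cls F = cls G \<longleftrightarrow> F - G \<in> null"
  by (simp add: hom.abs_eq_iff)

lemma cls_add: "cls (F + G) = cls F + cls G"
  and cls_diff: "cls (F - G) = cls F - cls G"
  and cls_scale: "cls (c *\<^sub>w F) = sc c (cls F)"
  and cls_0 [simp]: "cls 0 = 0"
  by (simp_all add: plus_hom.abs_eq minus_hom.abs_eq sc.abs_eq zero_hom_def)

lemma cls_sum: "cls (\<Sum>x\<in>A. f x) = (\<Sum>x\<in>A. cls (f x))"
  by (induction A rule: infinite_finite_induct) (auto simp: cls_add)

lemma sc_add: "sc c (x + y) = sc c x + sc c y"
  and sc_diff: "sc c (x - y) = sc c x - sc c y"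
  and sc_add_left: "sc (c + d) x = sc c x + sc d x"
  and sc_sc [simp]: "sc c (sc d x) = sc (c * d) x"
  and sc_0 [simp]: "sc c 0 = 0" and sc_zero [simp]: "sc 0 x = 0"
  and sc_1 [simp]: "sc 1 x = x"
  and mult_sc [simp]: "sc c x * y = sc c (x * y)" "x * sc c y = sc c (x * y)"
  by (transfer; simp add: lin_scale_add lin_scale_diff lin_scale_add_left tmul_scale)+

lemma sc_uminus_left: "sc (- c) x = - sc c x"
  using sc_add_left[of c "- c" x] by (simp add: eq_neg_iff_add_eq_0 add.commute)

lemma sc_diff_left: "sc (c - d) x = sc c x - sc d x"
  using sc_add_left[of "c - d" d x] by simp

lemma sc_sum: "sc c (\<Sum>x\<in>A. f x) = (\<Sum>x\<in>A. sc c (f x))"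
  by (induction A rule: infinite_finite_induct) (auto simp: sc_add)

lemma sc_cancel: "c \<noteq> 0 \<Longrightarrow> sc c x = sc c y \<longleftrightarrow> x = y"
  by (metis sc_sc sc_1 left_inverse)

lemma sc_eq_iff: "c \<noteq> 0 \<Longrightarrow> sc c x = y \<longleftrightarrow> x = sc (inverse c) y"
  by (auto simp: sc_cancel)

lemma box_add: "box l (x + y) r = box l x r + box l y r"
  and box_diff: "box l (x - y) r = box l x r - box l y r"
  and box_sc: "box l (sc c x) r = sc c (box l x r)"
  and box_0 [simp]: "box l 0 r = 0"
  and box_mult: "box l (x * y) r = box l x r * box l y r"
  and box_box [simp]: "box l (box l' x r') r = box (l @ l') x (r' @ r)"
  by (transfer; simp add: tpad_add tpad_diff tpad_scale tpad_0 tpad_tmul tpad_tpad)+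

lemma cls_untyped: "\<not> typed D \<Longrightarrow> cls (lin_web D) = 0"
  using cls_eq_iff[of "lin_web D" 0] by (simp add: null_def proj_def webs_typed relations.zero)

lemma cls_comp:
  assumes "F \<in> combos u t" "G \<in> combos s u"
  shows "cls (F \<circ>\<^sub>w G) = cls F * cls G"
proof -
  have "F \<circ>\<^sub>w G = tmul F G"
    using assms(1)
  proof (induction rule: combos_induct)
    case (web c D)
    from assms(2) show ?case
      by (induction rule: combos_induct)
         (use web in \<open>auto simp: lin_comp_lext tmul_def wmul_def webs_typed lext_fun_add\<close>)
  qed (auto simp: lin_comp_lext tmul_def)
  then show ?thesis
    by (simp add: times_hom.abs_eq)
qed

lemma cls_lpad: "F \<in> combos s t \<Longrightarrow> cls (lpad l F r) = box l (cls F) r"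
proof -
  assume "F \<in> combos s t"
  then have "lpad l F r = tpad l F r"
    by (induction rule: combos_induct) (auto simp: lpad_def tpad_def webs_typed)
  then show ?thesis
    by (simp add: box.abs_eq)
qed

definition idn :: "word \<Rightarrow> hom" where
  "idn s = cls (ident s)"

definition Hm :: "word \<Rightarrow> word \<Rightarrow> hom set" where
  "Hm s t = cls ` combos s t"

lemma ident_combos [simp]: "ident s \<in> combos s s"
  by (simp add: ident_def)

lemma hom_eq_cls:
  assumes "F \<in> combos s t" "G \<in> combos s t"
  shows "hom_eq s t F G \<longleftrightarrow> cls F = cls G"
  using assms null_combos[OF combos_diff[OF assms]] by (simp add: hom_eq_def cls_eq_iff)

lemma cls_Hm [intro]: "F \<in> combos s t \<Longrightarrow> cls F \<in> Hm s t"
  by (simp add: Hm_def)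

lemma Hm_mult [intro]: "x \<in> Hm u t \<Longrightarrow> y \<in> Hm s u \<Longrightarrow> x * y \<in> Hm s t"
  unfolding Hm_def using cls_comp[symmetric] combos_comp by fastforce

lemma Hm_add [intro]: "x \<in> Hm s t \<Longrightarrow> y \<in> Hm s t \<Longrightarrow> x + y \<in> Hm s t"
  unfolding Hm_def by (auto simp flip: cls_add intro: combos_add)

lemma Hm_sc [intro]: "x \<in> Hm s t \<Longrightarrow> sc c x \<in> Hm s t"
  unfolding Hm_def by (auto simp flip: cls_scale intro: combos_scale)

lemma Hm_0 [simp, intro]: "0 \<in> Hm s t"
  using cls_Hm[OF combos_0, of s t] by simp

lemma Hm_sum: "(\<And>x. x \<in> A \<Longrightarrow> f x \<in> Hm s t) \<Longrightarrow> (\<Sum>x\<in>A. f x) \<in> Hm s t"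
  by (induction A rule: infinite_finite_induct) auto

lemma Hm_box: "x \<in> Hm s t \<Longrightarrow> box l x r \<in> Hm (l @ s @ r) (l @ t @ r)"
  unfolding Hm_def using cls_lpad[symmetric] combos_lpad by fastforce

lemma Hm_box2: "x \<in> Hm s t \<Longrightarrow> s' = l @ s @ r \<Longrightarrow> t' = l @ t @ r \<Longrightarrow> box l x r \<in> Hm s' t'"
  using Hm_box by simp

lemma idn_Hm [simp, intro]: "idn s \<in> Hm s s"
  by (auto simp: idn_def)

lemma ident_comp: "F \<in> combos s t \<Longrightarrow> ident t \<circ>\<^sub>w F = F" "F \<in> combos s t \<Longrightarrow> F \<circ>\<^sub>w ident s = F"
  by (induction rule: combos_induct)
     (auto simp: lin_comp_lext ident_def comp_id webs_typed)

lemma idn_mult: "x \<in> Hm s t \<Longrightarrow> idn t * x = x" "x \<in> Hm s t \<Longrightarrow> x * idn s = x"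
  unfolding Hm_def idn_def
  using cls_comp[OF ident_combos, symmetric] cls_comp[OF _ ident_combos, symmetric] ident_comp by auto

lemma idn_idem [simp]: "idn s * idn s = idn s"
  by (rule idn_mult) auto

lemma box_idn [simp]: "box l (idn s) r = idn (l @ s @ r)"
  unfolding idn_def using cls_lpad[OF ident_combos, of l s r]
  by (simp add: lpad_def ident_def)

text \<open>\<open>tpad\<close> discards webs whose layers do not fit, so this holds only in the
  quotient, where such webs are \<open>0\<close> by \<open>cls_untyped\<close>.\<close>

lemma box_Nil [simp]: "box [] x [] = x"
proof -
  have "cls (tpad [] F []) = cls F" for F
  proof (induction F rule: lin_induct)
    case (web c D)
    then show ?case
      using cls_untyped[of D] by (simp add: tpad_scale cls_scale) (simp add: tpad_def)
  qed (auto simp: tpad_add tpad_0 cls_add)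
  then show ?thesis
    by (induction x rule: hom.abs_induct) (simp add: box.abs_eq)
qed

text \<open>Allows arbitrary ring elements as coefficients, as in \<open>low\<close> below; types
  are restored afterwards by multiplying with identities.\<close>

lemma Hm_sandwich: "idn t * x * idn s \<in> Hm s t"
proof -
  have "cls (tmul (tmul (ident t) F) (ident s)) \<in> Hm s t" for F
  proof (induction F rule: lin_induct)
    case (web c D)
    have "typed (web_id u) \<and> web_bot (web_id u) = u \<and> web_top (web_id u) = u" for u
      using id_webs[of u] unfolding webs_typed by blast
    then show ?case
      by (auto simp: tmul_scale cls_scale ident_def tmul_web wmul_def tmul_0
          comp_typed comp_id webs_typed intro!: Hm_sc cls_Hm)
  qed (auto simp: tmul_add tmul_0 cls_add)
  then show ?thesis
    by (induction x rule: hom.abs_induct) (simp add: idn_def times_hom.abs_eq)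
qed

subsection \<open>Pieces\<close>

definition gen :: "piece \<Rightarrow> hom" where
  "gen p = cls (lin_web (Web (piece_bot p) [([], p, [])]))"

lemma gen_Hm: "piece_ok p \<Longrightarrow> gen p \<in> Hm (piece_bot p) (piece_top p)"
  by (auto simp: gen_def webs_iff intro!: cls_Hm)

lemma cls_web_Cons:
  assumes "layers_path s ((l, p, r) # xs) t"
  shows "cls (lin_web (Web s ((l, p, r) # xs))) =
    cls (lin_web (Web (l @ piece_top p @ r) xs)) * box l (gen p) r"
proof -
  have p: "piece_ok p" "s = l @ piece_bot p @ r" "layers_path (l @ piece_top p @ r) xs t"
    using assms by auto
  have "lin_web (Web (l @ piece_top p @ r) xs) \<in> combos (l @ piece_top p @ r) t"
    "lin_web (Web s [(l, p, r)]) \<in> combos s (l @ piece_top p @ r)"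
    using p by (auto simp: webs_iff)
  from cls_comp[OF this]
  have "cls (lin_web (Web s ((l, p, r) # xs))) =
      cls (lin_web (Web (l @ piece_top p @ r) xs)) * cls (lin_web (Web s [(l, p, r)]))"
    by (simp add: lin_comp_lext web_comp_def)
  also have "cls (lin_web (Web s [(l, p, r)])) = box l (gen p) r"
    using cls_lpad[of "lin_web (Web (piece_bot p) [([], p, [])])" "piece_bot p" "piece_top p" l r] p
    by (simp add: gen_def lpad_def wpad_def webs_iff)
  finally show ?thesis .
qed

lemma cls_web_Nil: "cls (lin_web (Web s [])) = idn s"
  by (simp add: idn_def ident_def web_id_def)

fun layers_hom :: "word \<Rightarrow> layer list \<Rightarrow> hom" where
  "layers_hom s [] = idn s"
| "layers_hom s ((l, p, r) # xs) = layers_hom (l @ piece_top p @ r) xs * box l (gen p) r"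

lemma cls_layers: "layers_path s xs t \<Longrightarrow> cls (lin_web (Web s xs)) = layers_hom s xs"
proof (induction xs arbitrary: s)
  case (Cons x xs)
  obtain l p r where x: "x = (l, p, r)" by (cases x)
  then show ?case
    using Cons cls_web_Cons[of s l p r xs t] by auto
qed (simp add: cls_web_Nil)

text \<open>Webs are taken apart from the bottom. The predicate carries the bottom word, which
  changes with every layer, while the top word stays fixed.\<close>

lemma Hm_induct [consumes 1, case_names layer id zero add sc]:
  assumes "x \<in> Hm s t"
    and layer: "\<And>l p r f. piece_ok p \<Longrightarrow> f \<in> Hm (l @ piece_top p @ r) t \<Longrightarrow> P (l @ piece_top p @ r) f \<Longrightarrow>
       P (l @ piece_bot p @ r) (f * box l (gen p) r)"
    and id: "P t (idn t)"
    and zero: "P s 0" and add: "\<And>f g. f \<in> Hm s t \<Longrightarrow> g \<in> Hm s t \<Longrightarrow> P s f \<Longrightarrow> P s g \<Longrightarrow> P s (f + g)"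
    and sc: "\<And>c f. f \<in> Hm s t \<Longrightarrow> P s f \<Longrightarrow> P s (sc c f)"
  shows "P s x"
proof -
  have path: "layers_hom s xs \<in> Hm s t \<and> P s (layers_hom s xs)" if "layers_path s xs t" for s xs
    using that
  proof (induction xs arbitrary: s)
    case (Cons x xs)
    obtain l p r where x: "x = (l, p, r)" by (cases x)
    then have "s = l @ piece_bot p @ r" "piece_ok p" "layers_path (l @ piece_top p @ r) xs t"
      using Cons.prems by auto
    then show ?case
      using Cons.IH[of "l @ piece_top p @ r"] x layer[where p = p and l = l and r = r] Hm_box[OF gen_Hm, of p l r] Hm_mult
      by auto
  qed (use id in auto)
  obtain F where F: "F \<in> combos s t" "x = cls F"
    using assms(1) by (auto simp: Hm_def)
  have "cls F \<in> Hm s t \<and> P s (cls F)"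
    using F(1)
  proof (induction rule: combos_induct)
    case (web c D)
    then have "cls (lin_web D) = layers_hom s (web_layers D)" "layers_path s (web_layers D) t"
      using cls_layers[of s "web_layers D" t] by (cases D; auto simp: webs_iff)+
    then show ?case
      using path sc by (auto simp: cls_scale)
  qed (use zero add in \<open>auto simp: cls_add\<close>)
  then show ?thesis using F by simp
qed

lemma cls_isotopy_move:
  assumes "isotopy_move X Y" "X \<in> webs a b"
  shows "cls (lin_web X) = cls (lin_web Y)"
proof -
  have "isotopic (in_context (web_id b) [] X [] (web_id a)) (in_context (web_id b) [] Y [] (web_id a))"
    using isotopic.move[OF assms, of "web_id b" "[]" "[]" b "web_id a" a] by simp
  moreover have "in_context (web_id b) [] Z [] (web_id a) = Z" if "Z \<in> webs a b" for Z
    using that by (auto simp: in_context_wpad comp_id webs_typed)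
  ultimately have "isotopic X Y"
    using assms isotopy_move_webs by metis
  then have "lin_web X - lin_web Y \<in> relations a b"
    using assms isotopy_move_webs by (intro relations.isotopy) auto
  then show ?thesis
    using null_combos relations_combos cls_eq_iff by blast
qed

lemma cls_local_relation:
  assumes "local_relation a b F"
  shows "cls F = 0"
proof -
  have F: "F \<in> combos a b"
    using assms local_relation_combos by blast
  have "lin_web (web_id b) \<circ>\<^sub>w (ident [] \<otimes>\<^sub>w F \<otimes>\<^sub>w ident []) \<circ>\<^sub>w lin_web (web_id a) \<in> relations a b"
    using assms by (intro relations.local) auto
  moreover have "ident [] \<otimes>\<^sub>w F \<otimes>\<^sub>w ident [] = F"
    by (simp add: lpad_tensor lpad_def)
  ultimately have "F \<in> relations a b"
    using ident_comp[OF F] by (simp flip: ident_def)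
  then show ?thesis
    using null_combos[OF F] cls_eq_iff[of F 0] by simp
qed

section \<open>The interchange law for arbitrary morphisms\<close>

lemma gen_exchange:
  assumes "piece_ok p" "piece_ok q"
  shows "box [] (gen p) (m @ piece_top q) * box (piece_bot p @ m) (gen q) [] =
    box (piece_top p @ m) (gen q) [] * box [] (gen p) (m @ piece_bot q)"
proof -
  let ?s = "piece_bot p @ m @ piece_bot q"
  let ?X = "Web ?s [([], p, m @ piece_bot q), (piece_top p @ m, q, [])]"
  let ?Y = "Web ?s [(piece_bot p @ m, q, []), ([], p, m @ piece_top q)]"
  have X: "layers_path ?s (web_layers ?X) (piece_top p @ m @ piece_top q)"
    and Y: "layers_path ?s (web_layers ?Y) (piece_top p @ m @ piece_top q)"
    using assms by auto
  have "cls (lin_web ?X) = cls (lin_web ?Y)"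
    using X by (intro cls_isotopy_move[OF isotopy_move.exchange[OF assms]]) (auto simp: webs_iff)
  then have "layers_hom ?s (web_layers ?X) = layers_hom ?s (web_layers ?Y)"
    using cls_layers[OF X] cls_layers[OF Y] by simp
  moreover have "idn (piece_top p @ m @ piece_top q) * box (piece_top p @ m) (gen q) [] =
      box (piece_top p @ m) (gen q) []"
    "idn (piece_top p @ m @ piece_top q) * box [] (gen p) (m @ piece_top q) =
      box [] (gen p) (m @ piece_top q)"
    using Hm_box[OF gen_Hm[OF assms(1)], of "[]" "m @ piece_top q"]
      Hm_box[OF gen_Hm[OF assms(2)], of "piece_top p @ m" "[]"]
    by (auto simp: idn_mult)
  ultimately show ?thesis
    by (simp add: mult.assoc[symmetric])
qed

text \<open>The isotopy move exchanges two single pieces. Induction over the layers of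
  \<open>x\<close> here, and over those of \<open>y\<close> in \<open>exchange0\<close>, extends it
  to morphisms.\<close>

lemma exchange_gen:
  assumes "x \<in> Hm s t" "piece_ok q"
  shows "box [] x (m @ piece_top q) * box (s @ m) (gen q) [] =
    box (t @ m) (gen q) [] * box [] x (m @ piece_bot q)"
  using assms(1)
proof (induction rule: Hm_induct)
  case (layer l p r f)
  have "box l (box [] (gen p) ((r @ m) @ piece_top q) * box (piece_bot p @ (r @ m)) (gen q) []) [] =
     box l (box (piece_top p @ (r @ m)) (gen q) [] * box [] (gen p) ((r @ m) @ piece_bot q)) []"
    using gen_exchange[OF layer(1) assms(2), of "r @ m"] by simp
  then have *: "box l (gen p) (r @ m @ piece_top q) * box (l @ piece_bot p @ r @ m) (gen q) [] =
      box (l @ piece_top p @ r @ m) (gen q) [] * box l (gen p) (r @ m @ piece_bot q)"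
    by (simp only: box_mult box_box append_assoc append_Nil2 append_Nil)
  have "box [] f (m @ piece_top q) * (box l (gen p) (r @ m @ piece_top q) * box (l @ piece_bot p @ r @ m) (gen q) [])
    = (box [] f (m @ piece_top q) * box (l @ piece_top p @ r @ m) (gen q) []) * box l (gen p) (r @ m @ piece_bot q)"
    unfolding * by (simp add: mult.assoc)
  also have "\<dots> = (box (t @ m) (gen q) [] * box [] f (m @ piece_bot q)) * box l (gen p) (r @ m @ piece_bot q)"
    using layer by simp
  finally show ?case
    by (simp add: box_mult mult.assoc)
next
  case id
  then show ?case
    using Hm_box[OF gen_Hm[OF assms(2)], of "t @ m" "[]"] by (simp add: idn_mult)
qed (auto simp: box_add box_sc distrib_left distrib_right)

lemma exchange0:
  assumes "x \<in> Hm s t" "y \<in> Hm s' t'"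
  shows "box [] x (m @ t') * box (s @ m) y [] = box (t @ m) y [] * box [] x (m @ s')"
  using assms(2)
proof (induction rule: Hm_induct)
  case (layer l p r f)
  have "box [] (box [] x ((m @ l) @ piece_top p) * box (s @ (m @ l)) (gen p) []) r =
      box [] (box (t @ (m @ l)) (gen p) [] * box [] x ((m @ l) @ piece_bot p)) r"
    using exchange_gen[OF assms(1) layer(1), of "m @ l"] by simp
  then have *: "box [] x (m @ l @ piece_top p @ r) * box (s @ m @ l) (gen p) r =
      box (t @ m @ l) (gen p) r * box [] x (m @ l @ piece_bot p @ r)"
    by (simp only: box_mult box_box append_assoc append_Nil2 append_Nil)
  have "(box [] x (m @ t') * box (s @ m) f []) * box (s @ m @ l) (gen p) r =
     box (t @ m) f [] * (box (t @ m @ l) (gen p) r * box [] x (m @ l @ piece_bot p @ r))"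
    unfolding layer(3) by (simp add: * mult.assoc)
  then show ?case
    by (simp add: box_mult mult.assoc)
next
  case id
  then show ?case
    using Hm_box[OF assms(1), of "[]" "m @ t'"] by (simp add: idn_mult)
qed (auto simp: box_add box_sc distrib_left distrib_right)

lemma exchange:
  assumes "x \<in> Hm s t" "y \<in> Hm s' t'"
  shows "box l x (m @ t' @ r) * box (l @ s @ m) y r = box (l @ t @ m) y r * box l x (m @ s' @ r)"
proof -
  have "box l (box [] x (m @ t') * box (s @ m) y []) r = box l (box (t @ m) y [] * box [] x (m @ s')) r"
    using exchange0[OF assms] by simp
  then show ?thesis
    by (simp only: box_mult box_box append_assoc append_Nil2 append_Nil)
qed

abbreviation capS :: hom where "capS \<equiv> gen (Cap Single)"
abbreviation cupS :: hom where "cupS \<equiv> gen (Cup Single)"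
abbreviation capD :: hom where "capD \<equiv> gen (Cap Double)"
abbreviation cupD :: hom where "cupD \<equiv> gen (Cup Double)"
abbreviation split :: hom where "split \<equiv> gen (Vertex [Double] [Single, Single])"
abbreviation merge :: hom where "merge \<equiv> gen (Vertex [Single, Single] [Double])"

definition \<delta> :: scalar where "\<delta> = - (qint 2 ^ 2)"
definition \<theta> :: scalar where "\<theta> = - (qint 6 * qint 2 / qint 3)"

lemma gen_typed [simp]:
  "capS \<in> Hm [Single, Single] []" "cupS \<in> Hm [] [Single, Single]"
  "capD \<in> Hm [Double, Double] []" "cupD \<in> Hm [] [Double, Double]"
  "split \<in> Hm [Double] [Single, Single]" "merge \<in> Hm [Single, Single] [Double]"
  using gen_Hm[of "Cap Single"] gen_Hm[of "Cup Single"] gen_Hm[of "Cap Double"] gen_Hm[of "Cup Double"]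
    gen_Hm[of "Vertex [Double] [Single, Single]"] gen_Hm[of "Vertex [Single, Single] [Double]"]
  by simp_all

lemma idn_box_right: "x \<in> Hm s t \<Longrightarrow> u = l @ s @ r \<Longrightarrow> box l x r * idn u = box l x r"
  and idn_box_left: "x \<in> Hm s t \<Longrightarrow> u = l @ t @ r \<Longrightarrow> idn u * box l x r = box l x r"
  using Hm_box[of x s t l r] by (simp_all add: idn_mult)

lemma box_comp: "x * y = z \<Longrightarrow> box l x r * box l y r = box l z r"
  by (metis box_mult)

section \<open>Bending and straightening legs\<close>

lemma bend_right_hom:
  assumes "piece_ok (Vertex a (b @ [c]))"
  shows "box b (gen (Cap c)) [] * box [] (gen (Vertex a (b @ [c]))) [c] = gen (Vertex (a @ [c]) b)"
proof -
  let ?X = "Web (a @ [c]) [([], Vertex a (b @ [c]), [c]), (b, Cap c, [])]"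
  let ?Y = "Web (a @ [c]) [([], Vertex (a @ [c]) b, [])]"
  have X: "layers_path (a @ [c]) (web_layers ?X) b" and Y: "layers_path (a @ [c]) (web_layers ?Y) b"
    using assms by auto
  have "cls (lin_web ?X) = cls (lin_web ?Y)"
    using X by (intro cls_isotopy_move[OF isotopy_move.bend_right[OF assms]]) (auto simp: webs_iff)
  then have "layers_hom (a @ [c]) (web_layers ?X) = layers_hom (a @ [c]) (web_layers ?Y)"
    using cls_layers[OF X] cls_layers[OF Y] by simp
  then show ?thesis
    using Hm_box[OF gen_Hm[of "Cap c"], of b "[]"] gen_Hm[of "Vertex (a @ [c]) b"] assms
    by (simp add: idn_mult)
qed

lemma bend_left_hom:
  assumes "piece_ok (Vertex a (c # b))"
  shows "box [] (gen (Cap c)) b * box [c] (gen (Vertex a (c # b))) [] = gen (Vertex (c # a) b)"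
proof -
  let ?X = "Web (c # a) [([c], Vertex a (c # b), []), ([], Cap c, b)]"
  let ?Y = "Web (c # a) [([], Vertex (c # a) b, [])]"
  have ok: "piece_ok (Vertex (c # a) b)"
    using assms by (cases c) (auto simp: append_eq_Cons_conv Cons_eq_append_conv)
  have X: "layers_path (c # a) (web_layers ?X) b" and Y: "layers_path (c # a) (web_layers ?Y) b"
    using assms ok by auto
  have "cls (lin_web ?X) = cls (lin_web ?Y)"
    using X by (intro cls_isotopy_move[OF isotopy_move.bend_left[OF assms]]) (auto simp: webs_iff)
  then have "layers_hom (c # a) (web_layers ?X) = layers_hom (c # a) (web_layers ?Y)"
    using cls_layers[OF X] cls_layers[OF Y] by simp
  then show ?thesis
    using Hm_box[OF gen_Hm[of "Cap c"], of "[]" b] gen_Hm[of "Vertex (c # a) b"] ok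
    by (simp add: idn_mult)
qed

lemma zigzag_right: "box [] (gen (Cap c)) [c] * box [c] (gen (Cup c)) [] = idn [c]"
proof -
  have "cls (lin_web (Web [c] [([c], Cup c, []), ([], Cap c, [c])])) = cls (lin_web (Web [c] []))"
    by (intro cls_isotopy_move[OF isotopy_move.straighten_right]) (auto simp: webs_iff)
  then show ?thesis
    using cls_layers[of "[c]" "[([c], Cup c, []), ([], Cap c, [c])]" "[c]"]
      Hm_box[OF gen_Hm[of "Cap c"], of "[]" "[c]"]
    by (simp add: cls_web_Nil idn_mult)
qed

lemma zigzag_left: "box [c] (gen (Cap c)) [] * box [] (gen (Cup c)) [c] = idn [c]"
proof -
  have "cls (lin_web (Web [c] [([], Cup c, [c]), ([c], Cap c, [])])) = cls (lin_web (Web [c] []))"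
    by (intro cls_isotopy_move[OF isotopy_move.straighten_left]) (auto simp: webs_iff)
  then show ?thesis
    using cls_layers[of "[c]" "[([], Cup c, [c]), ([c], Cap c, [])]" "[c]"]
      Hm_box[OF gen_Hm[of "Cap c"], of "[c]" "[]"]
    by (simp add: cls_web_Nil idn_mult)
qed

text \<open>The isotopy moves only bend legs downwards. A cup placed beside the vertex forms a
  zigzag with the cap of \<open>bend_right_hom\<close>, and straightening it inverts the
  bend.\<close>

lemma unbend_right:
  assumes "piece_ok (Vertex a (b @ [c]))"
  shows "gen (Vertex a (b @ [c])) = box [] (gen (Vertex (a @ [c]) b)) [c] * box a (gen (Cup c)) []"
proof -
  let ?v = "gen (Vertex a (b @ [c]))"
  have v: "?v \<in> Hm a (b @ [c])" and cup: "gen (Cup c) \<in> Hm [] [c, c]"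
    using gen_Hm[OF assms] gen_Hm[of "Cup c"] by simp_all
  have "box [] (gen (Vertex (a @ [c]) b)) [c] * box a (gen (Cup c)) [] =
      box b (gen (Cap c)) [c] * (box [] ?v [c, c] * box a (gen (Cup c)) [])"
    by (simp add: bend_right_hom[OF assms, symmetric] box_mult mult.assoc)
  also have "box [] ?v [c, c] * box a (gen (Cup c)) [] = box (b @ [c]) (gen (Cup c)) [] * ?v"
    using exchange0[OF v cup, of "[]"] by simp
  also have "box b (gen (Cap c)) [c] * (box (b @ [c]) (gen (Cup c)) [] * ?v) = idn (b @ [c]) * ?v"
    using box_comp[OF zigzag_right[of c], of b "[]"] by (simp add: mult.assoc[symmetric])
  finally show ?thesis
    using v by (simp add: idn_mult)
qed

lemma unbend_left:
  assumes "piece_ok (Vertex a (c # b))"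
  shows "gen (Vertex a (c # b)) = box [c] (gen (Vertex (c # a) b)) [] * box [] (gen (Cup c)) a"
proof -
  let ?v = "gen (Vertex a (c # b))"
  have v: "?v \<in> Hm a (c # b)" and cup: "gen (Cup c) \<in> Hm [] [c, c]"
    using gen_Hm[OF assms] gen_Hm[of "Cup c"] by simp_all
  have "box [c] (gen (Vertex (c # a) b)) [] * box [] (gen (Cup c)) a =
      box [c] (gen (Cap c)) b * (box [c, c] ?v [] * box [] (gen (Cup c)) a)"
    by (simp add: bend_left_hom[OF assms, symmetric] box_mult mult.assoc)
  also have "box [c, c] ?v [] * box [] (gen (Cup c)) a = box [] (gen (Cup c)) (c # b) * ?v"
    using exchange0[OF cup v, of "[]"] by simp
  also have "box [c] (gen (Cap c)) b * (box [] (gen (Cup c)) (c # b) * ?v) = idn (c # b) * ?v"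
    using box_comp[OF zigzag_left[of c], of "[]" b] by (simp add: mult.assoc[symmetric])
  finally show ?thesis
    using v by (simp add: idn_mult)
qed

section \<open>The defining relations inside the ring\<close>

lemma cls_relation:
  assumes "local_relation a b (lin_web (Web a xs) - F)" "layers_path a xs b"
  shows "layers_hom a xs = cls F"
  using cls_local_relation[OF assms(1)] cls_layers[OF assms(2)] by (simp add: cls_diff)

lemma loopS: "capS * cupS = sc \<theta> (idn [])"
  using cls_relation[OF loop_single]
  by (simp add: cls_scale idn_mult(1)[OF gen_typed(1)] \<theta>_def flip: idn_def)

lemma bigonS: "merge * split = sc \<delta> (idn [Double])"
  using cls_relation[OF bigon] by (simp add: cls_scale idn_mult(1)[OF gen_typed(6)] \<delta>_def flip: idn_def)

lemma cap_split: "capS * split = 0"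
  using cls_local_relation[OF monogon] cls_layers[of "[Double]" "[([], Vertex [Double] [Single, Single], []), ([], Cap Single, [])]" "[]"]
  by (simp add: idn_mult(1)[OF gen_typed(1)])

text \<open>The lower half of the tetravalent vertex and its mirror image: \<open>X\<^sup>(\<^sup>2\<^sup>)\<close> is \<open>hup * hdown\<close>.\<close>

definition hdown :: hom where
  "hdown = box [Single] capS [Single] * box [Single, Single] split [] * box [] split [Double]"

definition hup :: hom where
  "hup = box [] merge [Double] * box [Single, Single] merge [] * box [Single] cupS [Single]"

lemma hdown_Hm [simp]: "hdown \<in> Hm [Double, Double] [Single, Single]"
  unfolding hdown_def
  by (rule Hm_mult Hm_box2 gen_typed | simp)+

lemma hup_Hm [simp]: "hup \<in> Hm [Single, Single] [Double, Double]"
  unfolding hup_def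
  by (rule Hm_mult Hm_box2 gen_typed | simp)+

section \<open>Rotated vertices in terms of \<open>split\<close>, \<open>merge\<close>, cups and
  caps\<close>

lemma vertex_DS_S: "gen (Vertex [Double, Single] [Single]) = box [Single] capS [] * box [] split [Single]"
  using bend_right_hom[of "[Double]" "[Single]" Single] by simp
lemma vertex_SD_S: "gen (Vertex [Single, Double] [Single]) = box [] capS [Single] * box [Single] split []"
  using bend_left_hom[of "[Double]" Single "[Single]"] by simp
lemma vertex_DSS: "gen (Vertex [Double, Single, Single] []) =
    capS * box [Single] capS [Single] * box [] split [Single, Single]"
  using bend_right_hom[of "[Double, Single]" "[]" Single] by (simp add: vertex_DS_S box_mult mult.assoc)
lemma vertex_SDS: "gen (Vertex [Single, Double, Single] []) =
    capS * box [] capS [Single, Single] * box [Single] split [Single]"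
  using bend_right_hom[of "[Single, Double]" "[]" Single] by (simp add: vertex_SD_S box_mult mult.assoc)
lemma vertex_SSD: "gen (Vertex [Single, Single, Double] []) =
    capS * box [Single] capS [Single] * box [Single, Single] split []"
  using bend_left_hom[of "[Single, Double]" Single "[]"] by (simp add: vertex_SD_S box_mult mult.assoc)
lemma vertex_SSD': "gen (Vertex [Single, Single, Double] []) = capD * box [] merge [Double]"
  using bend_right_hom[of "[Single, Single]" "[]" Double] by simp
lemma vertex_S_DS: "gen (Vertex [Single] [Double, Single]) = box [] merge [Single] * box [Single] cupS []"
  using unbend_right[of "[Single]" "[Double]" Single] by simp
lemma vertex_S_SD: "gen (Vertex [Single] [Single, Double]) = box [Single] merge [] * box [] cupS [Single]"
  using unbend_left[of "[Single]" Single "[Double]"] by simp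
lemma vertex__DSS: "gen (Vertex [] [Double, Single, Single]) =
    box [] merge [Single, Single] * box [Single] cupS [Single] * cupS"
  using unbend_right[of "[]" "[Double, Single]" Single] by (simp add: vertex_S_DS box_mult mult.assoc)
lemma vertex__SDS: "gen (Vertex [] [Single, Double, Single]) =
    box [Single] merge [Single] * box [] cupS [Single, Single] * cupS"
  using unbend_right[of "[]" "[Single, Double]" Single] by (simp add: vertex_S_SD box_mult mult.assoc)
lemma vertex__SSD: "gen (Vertex [] [Single, Single, Double]) =
    box [Single, Single] merge [] * box [Single] cupS [Single] * cupS"
  using unbend_left[of "[]" Single "[Single, Double]"] by (simp add: vertex_S_SD box_mult mult.assoc)
lemma vertex__SSD': "gen (Vertex [] [Single, Single, Double]) = box [] split [Double] * cupD"
  using unbend_right[of "[]" "[Single, Single]" Double] by simp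

text \<open>The vertex with all legs down is reached by bending either single legs or the double
  leg. Attaching \<open>split\<close> to its two single legs turns the second description into a
  bigon. Up to \<open>\<delta>\<close>, the double cap is therefore made of single strands and
  vertices.\<close>

lemma capD_hdown: "sc \<delta> capD = capS * hdown"
proof -
  have "capS * hdown = gen (Vertex [Single, Single, Double] []) * box [] split [Double]"
    by (simp add: vertex_SSD hdown_def mult.assoc)
  also have "\<dots> = capD * (box [] merge [Double] * box [] split [Double])"
    by (simp add: vertex_SSD' mult.assoc)
  also have "\<dots> = sc \<delta> capD"
    using box_comp[OF bigonS, of "[]" "[Double]"] by (simp add: box_sc idn_mult(2)[OF gen_typed(3)])
  finally show ?thesis by simp
qed

lemma cupD_hup: "sc \<delta> cupD = hup * cupS"
proof -
  have "hup * cupS = box [] merge [Double] * gen (Vertex [] [Single, Single, Double])"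
    by (simp add: vertex__SSD hup_def mult.assoc)
  also have "\<dots> = (box [] merge [Double] * box [] split [Double]) * cupD"
    by (simp add: vertex__SSD' mult.assoc)
  also have "\<dots> = sc \<delta> cupD"
    using box_comp[OF bigonS, of "[]" "[Double]"] by (simp add: box_sc idn_mult(1)[OF gen_typed(4)])
  finally show ?thesis by simp
qed

text \<open>Only the monogon with its double leg at the bottom is imposed. Bending the leg of its
  mirror image down turns it into \<open>cap_split\<close>.\<close>

lemma merge_cup: "merge * cupS = 0"
proof -
  let ?f = "merge * cupS"
  have f: "?f \<in> Hm [] [Double]"
    using Hm_mult gen_typed by blast
  have "capD * box [] ?f [Double] = capS * box [Single] capS [Single] *
      (box [Single, Single] split [] * box [] cupS [Double])"
    using vertex_SSD' vertex_SSD by (simp add: box_mult mult.assoc[symmetric])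
  also have "box [Single, Single] split [] * box [] cupS [Double] = box [] cupS [Single, Single] * split"
    using exchange0[of cupS "[]" "[Single, Single]" split "[Double]" "[Single, Single]" "[]"] by simp
  also have "capS * box [Single] capS [Single] * (box [] cupS [Single, Single] * split) =
      capS * ((box [Single] capS [Single] * box [] cupS [Single, Single]) * split)"
    by (simp add: mult.assoc)
  also have "\<dots> = 0"
    using box_comp[OF zigzag_left[of Single], of "[]" "[Single]"]
    by (simp add: idn_mult(1)[OF gen_typed(5)] cap_split)
  finally have 0: "capD * box [] ?f [Double] = 0" .
  \<comment> \<open>The double leg is bent down and up again by a zigzag, so that the vanishing bent
    form can be inserted.\<close>
  have "?f = box [] capD [Double] * (box [Double] cupD [] * box [] ?f [])"
    using zigzag_right[of Double] idn_mult(1)[OF f] by (simp add: mult.assoc[symmetric])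
  also have "box [Double] cupD [] * box [] ?f [] = box [] ?f [Double, Double] * cupD"
    using exchange0[OF f gen_typed(4), of "[]"] by simp
  also have "box [] capD [Double] * (box [] ?f [Double, Double] * cupD) =
      box [] (capD * box [] ?f [Double]) [Double] * cupD"
    by (simp add: box_mult mult.assoc)
  finally show ?thesis
    by (simp add: 0)
qed

lemma split_split: "box [] split [Single, Single] * box [Double] split [] =
    box [Single, Single] split [] * box [] split [Double]"
  using exchange0[OF gen_typed(5,5), of "[]"] by simp

lemma merge_merge: "box [Double] merge [] * box [] merge [Single, Single] =
    box [] merge [Double] * box [Single, Single] merge []"
  using exchange0[OF gen_typed(6,6), of "[]"] by simp

lemma merge_hdown: "merge * hdown = 0"
proof -
  have "layers_hom [Double, Double] [([], Vertex [Double] [Single, Single], [Double]),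
         ([Single], Vertex [Single, Double] [Single], []),
         ([], Vertex [Single, Single] [Double], [])] = 0"
    using cls_local_relation[OF triangle] by (subst cls_layers[symmetric]) auto
  then show ?thesis
    by (simp add: idn_mult(1)[OF gen_typed(6)] vertex_SD_S hdown_def box_mult mult.assoc)
qed

lemma crossing_hom: "cls crossing = hup * hdown"
proof -
  have "cls crossing = idn [Double, Double] * box [Double] merge [] *
      box [] (gen (Vertex [Single] [Double, Single])) [Single] *
      box [Single] (gen (Vertex [Single, Double] [Single])) [] * box [] split [Double]"
    unfolding crossing_def by (subst cls_layers) auto
  also have "\<dots> = (box [Double] merge [] * box [] merge [Single, Single]) * box [Single] cupS [Single] *
     (box [Single] capS [Single] * box [Single, Single] split [] * box [] split [Double])"
    by (simp add: idn_box_left[OF gen_typed(6)] vertex_S_DS vertex_SD_S box_mult mult.assoc)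
  also have "\<dots> = hup * hdown"
    unfolding merge_merge by (simp add: hup_def hdown_def)
  finally show ?thesis .
qed

text \<open>The web \<open>J\<close> appears as a ladder on the middle two of four strands, turned
  by a quarter with one cup and one cap. The relation thus compares a ladder with its own
  rotation.\<close>

lemma IJUV_hom:
  "split * merge - box [Single, Single] capS [] * box [Single] (split * merge) [Single] * box [] cupS [Single, Single]
     = cupS * capS - idn [Single, Single]"
proof -
  let ?I = "Web [Single, Single]
         [([], Vertex [Single, Single] [Double], []), ([], Vertex [Double] [Single, Single], [])]"
  let ?J = "Web [Single, Single]
         [([], Vertex [Single] [Single, Double], [Single]),
          ([Single], Vertex [Double, Single] [Single], [])]"
  let ?U = "Web [Single, Single] [([], Cap Single, []), ([], Cup Single, [])]"
  have "cls (lin_web ?I) - cls (lin_web ?J) = cls (lin_web ?U) - idn [Single, Single]"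
    using cls_local_relation[OF IJUV] by (simp add: cls_diff idn_def)
  also have "cls (lin_web ?I) = split * merge"
    by (subst cls_layers) (auto simp: idn_mult(1)[OF gen_typed(5)] mult.assoc[symmetric])
  also have "cls (lin_web ?U) = cupS * capS"
    by (subst cls_layers) (auto simp: idn_mult(1)[OF gen_typed(2)] mult.assoc[symmetric])
  also have "cls (lin_web ?J) = idn [Single, Single] * box [Single, Single] capS [] *
      box [Single] split [Single] * box [Single] merge [Single] * box [] cupS [Single, Single]"
    by (subst cls_layers) (auto simp: vertex_S_SD vertex_DS_S box_mult mult.assoc)
  also have "idn [Single, Single] * box [Single, Single] capS [] = box [Single, Single] capS []"
    using idn_box_left[OF gen_typed(1), of _ "[Single, Single]" "[]"] by simp
  finally show ?thesis
    by (simp add: box_mult mult.assoc)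
qed

subsection \<open>Cups, caps and ladders on single strands\<close>

definition ones :: "nat \<Rightarrow> word" where
  "ones k = replicate k Single"

lemma ones_add: "ones (i + j) = ones i @ ones j"
  by (simp add: ones_def replicate_add)

lemma ones_0 [simp]: "ones 0 = []" and length_ones [simp]: "length (ones k) = k"
  and ones_Suc: "ones (Suc k) = Single # ones k"
  by (simp_all add: ones_def)

text \<open>In \<open>cap\<close> and \<open>cup\<close> the number \<open>k\<close> counts the
  strands on the shorter side, in \<open>lad\<close> all strands; hence the different right
  paddings. \<open>i\<close> counts the strands to the left.\<close>

definition cap :: "nat \<Rightarrow> nat \<Rightarrow> hom" where
  "cap k i = box (ones i) capS (ones (k - i))"
definition cup :: "nat \<Rightarrow> nat \<Rightarrow> hom" where
  "cup k i = box (ones i) cupS (ones (k - i))"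
definition lad :: "nat \<Rightarrow> nat \<Rightarrow> hom" where
  "lad k i = box (ones i) (split * merge) (ones (k - i - 2))"
abbreviation one :: "nat \<Rightarrow> hom" where "one k \<equiv> idn (ones k)"

lemma lad_gen [simp]: "split * merge \<in> Hm [Single, Single] [Single, Single]"
  using Hm_mult gen_typed by blast

lemma ones_mid: "i + n + j = k \<Longrightarrow> ones k = ones i @ ones n @ ones j"
  by (auto simp: ones_add)

lemma cap_Hm [simp]: "i \<le> k \<Longrightarrow> cap k i \<in> Hm (ones (k + 2)) (ones k)"
  unfolding cap_def using ones_mid[of i 2 "k - i" "k + 2"] ones_mid[of i 0 "k - i" k]
  by (intro Hm_box2[OF gen_typed(1)]) (auto simp: numeral_2_eq_2 ones_Suc)

lemma cup_Hm [simp]: "i \<le> k \<Longrightarrow> cup k i \<in> Hm (ones k) (ones (k + 2))"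
  unfolding cup_def using ones_mid[of i 2 "k - i" "k + 2"] ones_mid[of i 0 "k - i" k]
  by (intro Hm_box2[OF gen_typed(2)]) (auto simp: numeral_2_eq_2 ones_Suc)

lemma lad_Hm [simp]: "i + 2 \<le> k \<Longrightarrow> lad k i \<in> Hm (ones k) (ones k)"
  unfolding lad_def using ones_mid[of i 2 "k - i - 2" k]
  by (intro Hm_box2[OF lad_gen]) (auto simp: numeral_2_eq_2 ones_Suc)

lemma box_cap: "i \<le> k \<Longrightarrow> box (ones a) (cap k i) (ones b) = cap (a + k + b) (a + i)"
  and box_cup: "i \<le> k \<Longrightarrow> box (ones a) (cup k i) (ones b) = cup (a + k + b) (a + i)"
  and box_lad: "i + 2 \<le> k \<Longrightarrow> box (ones a) (lad k i) (ones b) = lad (a + k + b) (a + i)"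
  by (simp_all add: cap_def cup_def lad_def flip: ones_add)

lemma box_one: "box (ones a) (one k) (ones b) = one (a + k + b)"
  by (simp flip: ones_add add: add.assoc)

lemma exchange_ones:
  assumes "x \<in> Hm (ones a) (ones a')" "y \<in> Hm (ones b) (ones b')"
  shows "box (ones i) x (ones (m + b' + r)) * box (ones (i + a + m)) y (ones r) =
    box (ones (i + a' + m)) y (ones r) * box (ones i) x (ones (m + b + r))"
  using exchange[OF assms, of "ones i" "ones m" "ones r"] by (simp add: ones_add)

lemma S2: "capS \<in> Hm (ones 2) (ones 0)" "cupS \<in> Hm (ones 0) (ones 2)"
  "split * merge \<in> Hm (ones 2) (ones 2)"
  by (simp_all add: numeral_2_eq_2 ones_Suc)

lemma cap_cap: "i \<le> j \<Longrightarrow> j \<le> k \<Longrightarrow> cap k i * cap (k + 2) (j + 2) = cap k j * cap (k + 2) i"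
proof -
  assume "i \<le> j" "j \<le> k"
  then obtain m r where "j = i + m" "k = j + r"
    by (auto simp: le_iff_add)
  then show ?thesis
    using exchange_ones[OF S2(1) S2(1), of i m r] by (simp add: cap_def ac_simps)
qed

lemma cup_cup: "i \<le> j \<Longrightarrow> j \<le> k \<Longrightarrow> cup (k + 2) i * cup k j = cup (k + 2) (j + 2) * cup k i"
proof -
  assume "i \<le> j" "j \<le> k"
  then obtain m r where "j = i + m" "k = j + r"
    by (auto simp: le_iff_add)
  then show ?thesis
    using exchange_ones[OF S2(2) S2(2), of i m r] by (simp add: cup_def ac_simps)
qed

lemma cap_cup: "i \<le> j \<Longrightarrow> j \<le> k \<Longrightarrow> cap (k + 2) i * cup (k + 2) (j + 2) = cup k j * cap k i"
proof -
  assume "i \<le> j" "j \<le> k"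
  then obtain m r where "j = i + m" "k = j + r"
    by (auto simp: le_iff_add)
  then show ?thesis
    using exchange_ones[OF S2(1) S2(2), of i m r] by (simp add: cup_def cap_def ac_simps)
qed

lemma cup_cap: "i \<le> j \<Longrightarrow> j \<le> k \<Longrightarrow> cup k i * cap k j = cap (k + 2) (j + 2) * cup (k + 2) i"
proof -
  assume "i \<le> j" "j \<le> k"
  then obtain m r where "j = i + m" "k = j + r"
    by (auto simp: le_iff_add)
  then show ?thesis
    using exchange_ones[OF S2(2) S2(1), of i m r] by (simp add: cup_def cap_def ac_simps)
qed

lemma lad_lad: "i + 2 \<le> j \<Longrightarrow> j + 2 \<le> k \<Longrightarrow> lad k i * lad k j = lad k j * lad k i"
proof -
  assume "i + 2 \<le> j" "j + 2 \<le> k"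
  then obtain m r where "j = i + 2 + m" "k = j + 2 + r"
    by (auto simp: le_iff_add)
  then show ?thesis
    using exchange_ones[OF S2(3) S2(3), of i m r] by (simp add: lad_def ac_simps)
qed

lemma lad_cap: "i + 2 \<le> j \<Longrightarrow> j \<le> k \<Longrightarrow> lad k i * cap k j = cap k j * lad (k + 2) i"
proof -
  assume "i + 2 \<le> j" "j \<le> k"
  then obtain m r where "j = i + 2 + m" "k = j + r"
    by (auto simp: le_iff_add)
  then show ?thesis
    using exchange_ones[OF S2(3) S2(1), of i m r] by (simp add: lad_def cap_def ac_simps)
qed

lemma cap_lad: "i \<le> j \<Longrightarrow> j + 2 \<le> k \<Longrightarrow> cap k i * lad (k + 2) (j + 2) = lad k j * cap k i"
proof -
  assume "i \<le> j" "j + 2 \<le> k"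
  then obtain m r where "j = i + m" "k = j + 2 + r"
    by (auto simp: le_iff_add)
  then show ?thesis
    using exchange_ones[OF S2(1) S2(3), of i m r] by (simp add: lad_def cap_def ac_simps)
qed

lemma lad_cup: "i + 2 \<le> j \<Longrightarrow> j \<le> k \<Longrightarrow> lad (k + 2) i * cup k j = cup k j * lad k i"
proof -
  assume "i + 2 \<le> j" "j \<le> k"
  then obtain m r where "j = i + 2 + m" "k = j + r"
    by (auto simp: le_iff_add)
  then show ?thesis
    using exchange_ones[OF S2(3) S2(2), of i m r] by (simp add: lad_def cup_def ac_simps)
qed

lemma cup_lad: "i \<le> j \<Longrightarrow> j + 2 \<le> k \<Longrightarrow> cup k i * lad k j = lad (k + 2) (j + 2) * cup k i"
proof -
  assume "i \<le> j" "j + 2 \<le> k"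
  then obtain m r where "j = i + m" "k = j + 2 + r"
    by (auto simp: le_iff_add)
  then show ?thesis
    using exchange_ones[OF S2(2) S2(3), of i m r] by (simp add: lad_def cup_def ac_simps)
qed

lemma cap_cup_same: "i \<le> k \<Longrightarrow> cap k i * cup k i = sc \<theta> (one k)"
  using box_comp[OF loopS, of "ones i" "ones (k - i)"]
  by (simp add: cap_def cup_def box_sc flip: ones_add)

lemma cap_cup_right: "i < k \<Longrightarrow> cap k i * cup k (Suc i) = one k"
proof -
  assume "i < k"
  then obtain m where k: "k = Suc (i + m)"
    by (auto simp: less_iff_Suc_add)
  have *: "[Single] = ones 1"
    by (simp add: ones_Suc)
  show ?thesis
    using box_comp[OF zigzag_right[of Single], of "ones i" "ones m"]
    by (simp add: k cap_def cup_def * ac_simps flip: ones_add)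
qed

lemma cap_cup_left: "i < k \<Longrightarrow> cap k (Suc i) * cup k i = one k"
proof -
  assume "i < k"
  then obtain m where k: "k = Suc (i + m)"
    by (auto simp: less_iff_Suc_add)
  have *: "[Single] = ones 1"
    by (simp add: ones_Suc)
  show ?thesis
    using box_comp[OF zigzag_left[of Single], of "ones i" "ones m"]
    by (simp add: k cap_def cup_def * ac_simps flip: ones_add)
qed

subsection \<open>Quantum integers\<close>

lemma qhalf_nonzero: "qhalf \<noteq> 0"
  by (simp add: qhalf_def Zero_fract_def eq_fract)

lemma qhalf_power: "qhalf ^ k = Fraction_Field.Fract (monom 1 k) 1"
  by (induction k) (auto simp: qhalf_def One_fract_def monom_0 monom_Suc one_pCons)

lemma qhalf_power_neq_1: "k > 0 \<Longrightarrow> qhalf ^ k \<noteq> 1"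
proof
  assume k: "k > 0" "qhalf ^ k = 1"
  then have "monom (1::complex) k = 1"
    by (simp add: qhalf_power One_fract_def eq_fract)
  then have "degree (monom (1::complex) k) = degree (1::complex poly)"
    by simp
  with k show False
    by (simp add: degree_monom_eq)
qed

lemma qhalf_powi_neq_1: "k \<noteq> 0 \<Longrightarrow> qhalf powi k \<noteq> 1"
  using qhalf_power_neq_1[of "nat \<bar>k\<bar>"]
  by (auto simp: power_int_def power_inverse)

lemma qhalf_diff: "qhalf - inverse qhalf \<noteq> 0"
  using qhalf_power_neq_1[of 2] qhalf_nonzero
  by (auto simp: field_simps power2_eq_square)

text \<open>A zero would make a nontrivial power of the indeterminate \<open>qhalf\<close> equal to
  1, which is excluded by degrees.\<close>

lemma qint_nonzero: "k \<noteq> 0 \<Longrightarrow> qint k \<noteq> 0"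
proof -
  assume "k \<noteq> 0"
  have "qhalf powi k - qhalf powi (- k) \<noteq> 0"
  proof
    assume "qhalf powi k - qhalf powi (- k) = 0"
    then have "qhalf powi (k + k) = 1"
      using qhalf_nonzero power_int_add[of qhalf k k] by (auto simp: power_int_minus field_simps)
    then show False
      using \<open>k \<noteq> 0\<close> qhalf_powi_neq_1[of "k + k"] by simp
  qed
  then show ?thesis
    using qhalf_diff by (simp add: qint_def)
qed

lemma delta_nonzero [simp]: "\<delta> \<noteq> 0"
  using qint_nonzero[of 2] by (simp add: \<delta>_def)

subsection \<open>Relations between cups, caps and ladders\<close>

lemma lad_lad_same: "i + 2 \<le> k \<Longrightarrow> lad k i * lad k i = sc \<delta> (lad k i)"
proof -
  have "(split * merge) * (split * merge) = split * (merge * split) * merge"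
    by (simp add: mult.assoc)
  then have "(split * merge) * (split * merge) = sc \<delta> (split * merge)"
    by (simp add: bigonS idn_mult(2)[OF gen_typed(5)])
  from box_comp[OF this] show ?thesis
    by (simp add: lad_def box_sc)
qed

lemma cap_lad_same [simp]: "i \<le> k \<Longrightarrow> cap k i * lad (k + 2) i = 0"
proof -
  have "capS * (split * merge) = 0"
    by (simp add: mult.assoc[symmetric] cap_split)
  from box_comp[OF this] show ?thesis
    by (simp add: lad_def cap_def)
qed

lemma lad_cup_same [simp]: "i \<le> k \<Longrightarrow> lad (k + 2) i * cup k i = 0"
proof -
  have "(split * merge) * cupS = 0"
    by (simp add: mult.assoc merge_cup)
  from box_comp[OF this] show ?thesis
    by (simp add: lad_def cup_def)
qed

lemma mult_assoc_rule: "x * y = z \<Longrightarrow> x * (y * u) = z * (u::hom)"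
  by (simp add: mult.assoc[symmetric])

text \<open>This is \<open>IJUV_hom\<close> solved for the unrotated ladder and padded to position
  \<open>i\<close>.\<close>

lemma ladder_rotation:
  assumes "i \<le> k"
  shows "lad (k + 2) i = cap (k + 2) (i + 2) * lad (k + 2 + 2) (i + 1) * cup (k + 2) i +
    cup k i * cap k i - one (k + 2)"
proof -
  have base: "lad 2 0 - cap 2 2 * lad 4 1 * cup 2 0 = cup 0 0 * cap 0 0 - one 2"
    using IJUV_hom by (simp add: lad_def cap_def cup_def eval_nat_numeral ones_Suc)
  obtain r where r: "k = i + r"
    using assms by (auto simp: le_iff_add)
  have "box (ones i) (lad 2 0 - cap 2 2 * lad 4 1 * cup 2 0) (ones r) =
      box (ones i) (cup 0 0 * cap 0 0 - one 2) (ones r)"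
    by (simp only: base)
  then have "lad (k + 2) i - cap (k + 2) (i + 2) * lad (k + 2 + 2) (i + 1) * cup (k + 2) i =
      cup k i * cap k i - one (k + 2)"
    by (simp only: box_diff box_mult) (simp add: box_cap box_cup box_lad box_one r eval_nat_numeral del: box_idn)
  then show ?thesis
    by (simp add: algebra_simps)
qed

text \<open>The ladder at \<open>i + 1\<close> is replaced by its rotation. The cap at
  \<open>i\<close> then straightens the cup of the rotated ladder, and the ladder reappears at
  \<open>i\<close>. This rule moves a cap sideways across a ladder at the price of terms without
  that ladder.\<close>

lemma cap_lad_next:
  assumes "i < k"
  shows "cap k i * lad (k + 2) (Suc i) = cap k (Suc i) * lad (k + 2) i + cap k (Suc i) - cap k i"
proof -
  have "cap k i * lad (k + 2) (Suc i) =
      cap k i * cap (k + 2) (Suc i + 2) * lad (k + 2 + 2) (i + 2) * cup (k + 2) (Suc i) +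
      cap k i * cup k (Suc i) * cap k (Suc i) - cap k i * one (k + 2)"
    using assms by (subst ladder_rotation)
      (simp_all add: distrib_left distrib_right right_diff_distrib left_diff_distrib mult.assoc)
  also have "cap k i * cap (k + 2) (Suc i + 2) = cap k (Suc i) * cap (k + 2) i"
    using assms by (intro cap_cap) auto
  also have "cap k (Suc i) * cap (k + 2) i * lad (k + 2 + 2) (i + 2) * cup (k + 2) (Suc i) =
      cap k (Suc i) * lad (k + 2) i * (cap (k + 2) i * cup (k + 2) (Suc i))"
    using assms mult_assoc_rule[OF cap_lad[of i i "k + 2"]] by (simp add: mult.assoc)
  finally show ?thesis
    using assms idn_mult(1)[OF cap_Hm, of "Suc i" k] idn_mult(2)[OF cap_Hm, of i k] idn_mult(2)[OF lad_Hm, of i "k + 2"]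
    by (simp add: cap_cup_right mult.assoc)
qed

lemma lad_next_cup:
  assumes "i < k"
  shows "lad (k + 2) (Suc i) * cup k i = lad (k + 2) i * cup k (Suc i) + cup k (Suc i) - cup k i"
proof -
  have "lad (k + 2) i * cup k (Suc i) =
      cap (k + 2) (i + 2) * lad (k + 2 + 2) (i + 1) * (cup (k + 2) i * cup k (Suc i)) +
      cup k i * (cap k i * cup k (Suc i)) - one (k + 2) * cup k (Suc i)"
    using assms by (subst ladder_rotation)
      (simp_all add: distrib_left distrib_right right_diff_distrib left_diff_distrib mult.assoc)
  also have "cup (k + 2) i * cup k (Suc i) = cup (k + 2) (Suc i + 2) * cup k i"
    using assms by (intro cup_cup) auto
  also have "cap (k + 2) (i + 2) * lad (k + 2 + 2) (i + 1) * (cup (k + 2) (Suc i + 2) * cup k i) =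
      (cap (k + 2) (i + 2) * cup (k + 2) (Suc (i + 2))) * lad (k + 2) (Suc i) * cup k i"
    using assms mult_assoc_rule[OF lad_cup[of "i + 1" "Suc i + 2" "k + 2"]] by (simp add: mult.assoc)
  finally show ?thesis
    using assms idn_mult(1)[OF cup_Hm, of "Suc i" k] idn_mult(2)[OF cup_Hm, of i k] mult_assoc_rule[OF idn_mult(1)[OF lad_Hm, of "Suc i" "k + 2"]]
    by (simp add: cap_cup_right mult.assoc algebra_simps)
qed

text \<open>Rotate the middle ladder: between the outer ladders the rotated term contains a triangle
  and vanishes, the cup-cap survives, and the identity term leaves a bigon, hence
  \<open>\<delta>\<close>.\<close>

lemma lad_lad_lad:
  assumes "i < k"
  shows "lad (k + 2) i * lad (k + 2) (Suc i) * lad (k + 2) i =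
    lad (k + 2) i * cup k (Suc i) * cap k (Suc i) * lad (k + 2) i - sc \<delta> (lad (k + 2) i)"
proof -
  let ?m = "box [] merge [Single]" and ?s = "box [] split [Single]"
  let ?Z = "cap 3 1 * lad 5 2 * cup 3 3"
  \<comment> \<open>The rotation in the direction opposite to \<open>ladder_rotation\<close>, with
    the cap on the left; it is the one that puts \<open>merge * hdown\<close> next to the left
    ladder.\<close>
  have rot: "lad 3 1 = ?Z + cup 1 1 * cap 1 1 - one 3"
  proof -
    have "?Z = (cap 3 2 * lad 5 1 + cap 3 2 - cap 3 1) * cup 3 3"
      using cap_lad_next[of 1 3] by (simp add: eval_nat_numeral)
    also have "\<dots> = (cap 3 2 * cup 3 3) * lad 3 1 + cap 3 2 * cup 3 3 - cap 3 1 * cup 3 3"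
      using lad_cup[of 1 3 3] by (simp add: algebra_simps)
    also have "cap 3 2 * cup 3 3 = one 3"
      using cap_cup_right[of 2 3] by simp
    also have "cap 3 1 * cup 3 3 = cup 1 1 * cap 1 1"
      using cap_cup[of 1 1 1] by (simp add: eval_nat_numeral)
    finally show ?thesis
      using idn_mult(1)[OF lad_Hm, of 1 3] by simp
  qed
  have "?m * ?Z * ?s = box [] (merge * hdown) [Single] * (box [Double] merge [Single] * box [Double, Single] cupS [])"
  proof -
    have 1: "box [Single, Single, Single] cupS [] * ?s = box [] split [Single, Single, Single] * box [Double, Single] cupS []"
      using exchange0[OF gen_typed(5) gen_typed(2), of "[Single]"] by simp
    have 2: "box [Single, Single] merge [Single] * box [] split [Single, Single, Single] =
        box [] split [Double, Single] * box [Double] merge [Single]"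
      using exchange[OF gen_typed(5) gen_typed(6), of "[]" "[]" "[Single]"] by simp
    have "?m * ?Z * ?s = ?m * box [Single] capS [Single, Single] * box [Single, Single] split [Single] *
        (box [Single, Single] merge [Single] * (box [Single, Single, Single] cupS [] * ?s))"
      by (simp add: cap_def lad_def cup_def eval_nat_numeral ones_Suc box_mult mult.assoc)
    also have "\<dots> = ?m * box [Single] capS [Single, Single] * box [Single, Single] split [Single] *
        (box [Single, Single] merge [Single] * box [] split [Single, Single, Single]) * box [Double, Single] cupS []"
      unfolding 1 by (simp add: mult.assoc)
    finally show ?thesis
      unfolding 2 by (simp add: hdown_def box_mult mult.assoc)
  qed
  then have "?m * ?Z * ?s = 0"
    by (simp add: merge_hdown)
  then have "?s * (?m * ?Z * ?s) * ?m = 0"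
    by simp
  then have Z: "lad 3 0 * ?Z * lad 3 0 = 0"
    by (simp add: lad_def eval_nat_numeral ones_Suc box_mult mult.assoc)
  have base: "lad 3 0 * lad 3 1 * lad 3 0 = lad 3 0 * cup 1 1 * cap 1 1 * lad 3 0 - sc \<delta> (lad 3 0)"
  proof -
    have "lad 3 0 * lad 3 1 * lad 3 0 = lad 3 0 * ?Z * lad 3 0 + lad 3 0 * cup 1 1 * cap 1 1 * lad 3 0 -
        lad 3 0 * one 3 * lad 3 0"
      by (subst rot) (simp add: algebra_simps)
    then show ?thesis
      using mult_assoc_rule[OF idn_mult(2)[OF lad_Hm, of 0 3]] lad_lad_same[of 0 3] Z by (simp add: mult.assoc)
  qed
  obtain r where r: "k = Suc (i + r)"
    using assms by (auto simp: less_iff_Suc_add)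
  have "box (ones i) (lad 3 0 * lad 3 1 * lad 3 0) (ones r) =
      box (ones i) (lad 3 0 * cup 1 1 * cap 1 1 * lad 3 0 - sc \<delta> (lad 3 0)) (ones r)"
    by (simp only: base)
  then show ?thesis
    by (simp only: box_diff box_mult box_sc) (simp add: box_cap box_cup box_lad r eval_nat_numeral)
qed

lemma lad_lad_lad':
  assumes "i < k"
  shows "lad (k + 2) (Suc i) * lad (k + 2) i * lad (k + 2) (Suc i) =
    lad (k + 2) (Suc i) * cup k i * cap k i * lad (k + 2) (Suc i) - sc \<delta> (lad (k + 2) (Suc i))"
proof -
  let ?m = "box [Single] merge []" and ?s = "box [Single] split []"
  let ?Z = "cap 3 2 * lad 5 1 * cup 3 0"
  have rot: "lad 3 0 = ?Z + cup 1 0 * cap 1 0 - one 3"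
    using ladder_rotation[of 0 1] by (simp add: eval_nat_numeral)
  have "?m * ?Z * ?s = box [Single] (merge * hdown) [] * (box [Single] merge [Double] * box [] cupS [Single, Double])"
  proof -
    have 1: "box [] cupS [Single, Single, Single] * ?s = box [Single, Single, Single] split [] * box [] cupS [Single, Double]"
      using exchange0[OF gen_typed(2) gen_typed(5), of "[Single]"] by simp
    have 2: "box [Single] merge [Single, Single] * box [Single, Single, Single] split [] =
        box [Single, Double] split [] * box [Single] merge [Double]"
      using exchange[OF gen_typed(6) gen_typed(5), of "[Single]" "[]" "[]"] by simp
    have "?m * ?Z * ?s = ?m * box [Single, Single] capS [Single] * box [Single] split [Single, Single] *
        (box [Single] merge [Single, Single] * (box [] cupS [Single, Single, Single] * ?s))"
      by (simp add: cap_def lad_def cup_def eval_nat_numeral ones_Suc box_mult mult.assoc)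
    also have "\<dots> = ?m * box [Single, Single] capS [Single] * box [Single] split [Single, Single] *
        (box [Single] merge [Single, Single] * box [Single, Single, Single] split []) * box [] cupS [Single, Double]"
      unfolding 1 by (simp add: mult.assoc)
    also have "\<dots> = box [Single] (merge * box [Single] capS [Single] *
        (box [] split [Single, Single] * box [Double] split [])) [] * (box [Single] merge [Double] * box [] cupS [Single, Double])"
      unfolding 2 by (simp add: box_mult mult.assoc)
    finally show ?thesis
      unfolding split_split by (simp add: hdown_def mult.assoc)
  qed
  then have "?m * ?Z * ?s = 0"
    by (simp add: merge_hdown)
  then have "?s * (?m * ?Z * ?s) * ?m = 0"
    by simp
  then have Z: "lad 3 1 * ?Z * lad 3 1 = 0"
    by (simp add: lad_def eval_nat_numeral ones_Suc box_mult mult.assoc)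
  have base: "lad 3 1 * lad 3 0 * lad 3 1 = lad 3 1 * cup 1 0 * cap 1 0 * lad 3 1 - sc \<delta> (lad 3 1)"
  proof -
    have "lad 3 1 * lad 3 0 * lad 3 1 = lad 3 1 * ?Z * lad 3 1 + lad 3 1 * cup 1 0 * cap 1 0 * lad 3 1 -
        lad 3 1 * one 3 * lad 3 1"
      by (subst rot) (simp add: algebra_simps)
    then show ?thesis
      using mult_assoc_rule[OF idn_mult(2)[OF lad_Hm, of 1 3]] lad_lad_same[of 1 3] Z by (simp add: mult.assoc)
  qed
  obtain r where r: "k = Suc (i + r)"
    using assms by (auto simp: less_iff_Suc_add)
  have "box (ones i) (lad 3 1 * lad 3 0 * lad 3 1) (ones r) =
      box (ones i) (lad 3 1 * cup 1 0 * cap 1 0 * lad 3 1 - sc \<delta> (lad 3 1)) (ones r)"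
    by (simp only: base)
  then show ?thesis
    by (simp only: box_diff box_mult box_sc) (simp add: box_cap box_cup box_lad r eval_nat_numeral)
qed

subsection \<open>Reduction to single strands\<close>

text \<open>Since \<open>merge * split\<close> is an invertible scalar, a morphism \<open>x\<close> is determined by its opened form
  \<open>splits t * x * merges s\<close>.\<close>

fun width :: "word \<Rightarrow> nat" where
  "width [] = 0"
| "width (Single # w) = Suc (width w)"
| "width (Double # w) = Suc (Suc (width w))"

fun splits :: "word \<Rightarrow> hom" where
  "splits [] = idn []"
| "splits (Single # w) = box [Single] (splits w) []"
| "splits (Double # w) = box [] split (ones (width w)) * box [Double] (splits w) []"

fun merges :: "word \<Rightarrow> hom" where
  "merges [] = idn []"
| "merges (Single # w) = box [Single] (merges w) []"
| "merges (Double # w) = box [Double] (merges w) [] * box [] merge (ones (width w))"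

lemma width_append [simp]: "width (u @ v) = width u + width v"
  by (induction u rule: width.induct) auto

lemma splits_Hm [simp]: "splits w \<in> Hm w (ones (width w))"
proof (induction w rule: splits.induct)
  case (3 w)
  then show ?case
    by (auto intro!: Hm_mult[of _ "Double # ones (width w)"] Hm_box2[OF gen_typed(5)] Hm_box2[OF 3] simp: ones_Suc)
qed (auto intro!: Hm_box2 simp: ones_Suc)

lemma merges_Hm [simp]: "merges w \<in> Hm (ones (width w)) w"
proof (induction w rule: splits.induct)
  case (3 w)
  then show ?case
    by (auto intro!: Hm_mult[of _ "Double # ones (width w)"] Hm_box2[OF gen_typed(6)] Hm_box2[OF 3] simp: ones_Suc)
qed (auto intro!: Hm_box2 simp: ones_Suc)

lemma splits_append: "splits (u @ v) = box [] (splits u) (ones (width v)) * box u (splits v) []"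
proof (induction u rule: splits.induct)
  case 1
  then show ?case
    by (simp add: idn_mult(1)[OF splits_Hm])
next
  case (2 w)
  then show ?case by (simp add: box_mult)
next
  case (3 w)
  then show ?case by (simp add: box_mult mult.assoc ones_add)
qed

lemma merges_append: "merges (u @ v) = box u (merges v) [] * box [] (merges u) (ones (width v))"
proof (induction u rule: splits.induct)
  case 1
  then show ?case
    by (simp add: idn_mult(2)[OF merges_Hm])
next
  case (2 w)
  then show ?case by (simp add: box_mult)
next
  case (3 w)
  then show ?case by (simp add: box_mult mult.assoc ones_add)
qed

lemma merges_splits: "merges w * splits w = sc (\<delta> ^ count_list w Double) (idn w)"
proof (induction w rule: splits.induct)
  case (2 w)
  then show ?case
    using box_comp[OF 2] by (simp add: box_sc)
next
  case (3 w)
  have "merges (Double # w) * splits (Double # w) = box [Double] (merges w) [] *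
     (box [] merge (ones (width w)) * box [] split (ones (width w))) * box [Double] (splits w) []"
    by (simp add: mult.assoc)
  also have "\<dots> = sc \<delta> (box [Double] (merges w) [] * box [Double] (splits w) [])"
    unfolding box_comp[OF bigonS] using idn_box_right[OF merges_Hm, of "Double # ones (width w)" "[Double]" w "[]"]
    by (simp add: box_sc)
  also have "\<dots> = sc (\<delta> ^ Suc (count_list w Double)) (idn (Double # w))"
    unfolding box_comp[OF 3] by (simp add: box_sc)
  finally show ?case by simp
qed simp

inductive ladder_web :: "nat \<Rightarrow> nat \<Rightarrow> hom \<Rightarrow> bool" for a :: nat where
  one: "ladder_web a a (one a)"
| lad: "ladder_web a b x \<Longrightarrow> i + 2 \<le> b \<Longrightarrow> ladder_web a b (lad b i * x)"
| cup: "ladder_web a b x \<Longrightarrow> i \<le> b \<Longrightarrow> ladder_web a (b + 2) (cup b i * x)"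
| cap: "ladder_web a (b + 2) (x) \<Longrightarrow> i \<le> b \<Longrightarrow> ladder_web a b (cap b i * x)"
| add: "ladder_web a b x \<Longrightarrow> ladder_web a b y \<Longrightarrow> ladder_web a b (x + y)"
| sc: "ladder_web a b x \<Longrightarrow> ladder_web a b (sc c x)"
| zero: "ladder_web a b 0"

lemma ladder_web_Hm: "ladder_web a b x \<Longrightarrow> x \<in> Hm (ones a) (ones b)"
  by (induction rule: ladder_web.induct) (auto intro: Hm_mult[OF lad_Hm] Hm_mult[OF cup_Hm] Hm_mult[OF cap_Hm] simp del: add_2_eq_Suc add_2_eq_Suc')

lemma ladder_web_mult: "ladder_web b c (x) \<Longrightarrow> ladder_web a b y \<Longrightarrow> ladder_web a c (x * y)"
  by (induction rule: ladder_web.induct)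
     (auto simp: idn_mult(1)[OF ladder_web_Hm] mult.assoc distrib_right intro: ladder_web.intros simp del: add_2_eq_Suc add_2_eq_Suc')

lemma ladder_web_gens: "i \<le> k \<Longrightarrow> ladder_web (k + 2) k (cap k i)" "i \<le> k \<Longrightarrow> ladder_web k (k + 2) (cup k i)"
    "i + 2 \<le> k \<Longrightarrow> ladder_web k k (lad k i)"
  using ladder_web.cap[OF ladder_web.one, of i k] ladder_web.cup[OF ladder_web.one, of i k] ladder_web.lad[OF ladder_web.one, of i k]
    idn_mult(2)[OF cap_Hm, of i k] idn_mult(2)[OF cup_Hm, of i k] idn_mult(2)[OF lad_Hm, of i k]
  by auto

lemma ladder_web_box: "ladder_web a b x \<Longrightarrow> ladder_web (l + a + r) (l + b + r) (box (ones l) x (ones r))"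
proof (induction rule: ladder_web.induct)
  case one
  then show ?case
    using ladder_web.one by (simp add: box_one del: box_idn)
next
  case (lad b x i)
  then show ?case
    using ladder_web.lad[OF lad(3), of "l + i"] by (simp add: box_mult box_lad)
next
  case (cup b x i)
  then show ?case
    using ladder_web.cup[OF cup(3), of "l + i"] by (simp add: box_mult box_cup ac_simps)
next
  case (cap b x i)
  then show ?case
    using ladder_web.cap[where x = "box (ones l) x (ones r)" and a = "l + a + r" and b = "l + b + r" and i = "l + i"] by (simp add: box_mult box_cap ac_simps)
qed (auto simp: box_add box_sc intro: ladder_web.intros)

definition good :: "word \<Rightarrow> word \<Rightarrow> hom \<Rightarrow> bool" where
  "good s t x \<longleftrightarrow> x \<in> Hm s t \<and> ladder_web (width s) (width t) (splits t * x * merges s)"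

text \<open>Between the two opened forms stands \<open>merges u * splits u\<close>, an invertible
  scalar that is divided out.\<close>

lemma good_mult: "good u t x \<Longrightarrow> good s u y \<Longrightarrow> good s t (x * y)"
proof -
  assume xy: "good u t x" "good s u y"
  then have H: "x \<in> Hm u t" "y \<in> Hm s u"
    by (auto simp: good_def)
  have "ladder_web (width s) (width t) ((splits t * x * merges u) * (splits u * y * merges s))"
    using xy ladder_web_mult by (auto simp: good_def)
  also have "(splits t * x * merges u) * (splits u * y * merges s) =
      splits t * x * (merges u * splits u) * y * merges s"
    by (simp add: mult.assoc)
  also have "\<dots> = sc (\<delta> ^ count_list u Double) (splits t * (x * y) * merges s)"
    using idn_mult(2)[OF H(1)] by (simp add: merges_splits mult.assoc)
  finally have "ladder_web (width s) (width t) (sc (inverse (\<delta> ^ count_list u Double)) (sc (\<delta> ^ count_list u Double) (splits t * (x * y) * merges s)))"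
    by (rule ladder_web.sc)
  then show ?thesis
    using H by (auto simp: good_def)
qed

lemma good_add: "good s t x \<Longrightarrow> good s t y \<Longrightarrow> good s t (x + y)"
  and good_sc: "good s t x \<Longrightarrow> good s t (sc c x)"
  and good_zero: "good s t 0"
  by (auto simp: good_def distrib_left distrib_right intro: ladder_web.intros)

text \<open>Opening the padding gives \<open>splits l * merges l\<close>, a nontrivial web rather
  than the identity; this is why goodness of \<open>idn l\<close> is assumed, and
  \<open>good_idn\<close> is built letter by letter from this very lemma.\<close>

lemma good_box_left:
  assumes "good s t x" "good l l (idn l)"
  shows "good (l @ s) (l @ t) (box l x [])"
proof -
  have H: "x \<in> Hm s t"
    using assms by (simp add: good_def)
  have hat: "splits t * x * merges s \<in> Hm (ones (width s)) (ones (width t))"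
    using H by (intro Hm_mult[OF _ merges_Hm] Hm_mult[OF splits_Hm])
  have "splits (l @ t) * box l x [] * merges (l @ s) = box [] (splits l) (ones (width t)) *
      (box l (splits t * x * merges s) [] * box [] (merges l) (ones (width s)))"
    by (simp add: splits_append merges_append box_mult mult.assoc)
  also have "box l (splits t * x * merges s) [] * box [] (merges l) (ones (width s)) =
      box [] (merges l) (ones (width t)) * box (ones (width l)) (splits t * x * merges s) []"
    using exchange0[OF merges_Hm hat, of l "[]"] by simp
  finally have "splits (l @ t) * box l x [] * merges (l @ s) =
      box (ones 0) (splits l * merges l) (ones (width t)) * box (ones (width l)) (splits t * x * merges s) (ones 0)"
    by (simp add: box_mult mult.assoc)
  moreover have "ladder_web (width l) (width l) (splits l * merges l)"
    using assms(2) idn_mult(2)[OF splits_Hm[of l]] by (simp add: good_def)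
  ultimately show ?thesis
    using assms ladder_web_box[where x = "splits l * merges l" and a = "width l" and b = "width l" and l = 0 and r = "width t"]
      ladder_web_box[where x = "splits t * x * merges s" and a = "width s" and b = "width t" and l = "width l" and r = 0] Hm_box[OF H, of l "[]"]
    by (auto simp: good_def intro: ladder_web_mult)
qed

lemma good_box_right:
  assumes "good s t x" "good r r (idn r)"
  shows "good (s @ r) (t @ r) (box [] x r)"
proof -
  have H: "x \<in> Hm s t"
    using assms by (simp add: good_def)
  have hat: "splits r * merges r \<in> Hm (ones (width r)) (ones (width r))"
    by (intro Hm_mult[OF _ merges_Hm] splits_Hm)
  have "splits (t @ r) * box [] x r * merges (s @ r) = box [] (splits t) (ones (width r)) *
      (box t (splits r) [] * box [] x r) * box s (merges r) [] * box [] (merges s) (ones (width r))"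
    by (simp add: splits_append merges_append mult.assoc)
  also have "box t (splits r) [] * box [] x r = box [] x (ones (width r)) * box s (splits r) []"
    using exchange0[OF H splits_Hm, of "[]" r] by simp
  also have "box [] (splits t) (ones (width r)) * (box [] x (ones (width r)) * box s (splits r) []) *
      box s (merges r) [] * box [] (merges s) (ones (width r)) =
      box [] (splits t) (ones (width r)) * box [] x (ones (width r)) *
      (box s (splits r * merges r) [] * box [] (merges s) (ones (width r)))"
    by (simp add: box_mult mult.assoc)
  also have "box s (splits r * merges r) [] * box [] (merges s) (ones (width r)) =
      box [] (merges s) (ones (width r)) * box (ones (width s)) (splits r * merges r) []"
    using exchange0[OF merges_Hm hat, of s "[]"] by simp
  finally have "splits (t @ r) * box [] x r * merges (s @ r) =
      box (ones 0) (splits t * x * merges s) (ones (width r)) * box (ones (width s)) (splits r * merges r) (ones 0)"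
    by (simp add: box_mult mult.assoc)
  moreover have "ladder_web (width r) (width r) (splits r * merges r)"
    using assms(2) idn_mult(2)[OF splits_Hm[of r]] by (simp add: good_def)
  ultimately show ?thesis
    using assms ladder_web_box[where x = "splits t * x * merges s" and a = "width s" and b = "width t" and l = 0 and r = "width r"]
      ladder_web_box[where x = "splits r * merges r" and a = "width r" and b = "width r" and l = "width s" and r = 0] Hm_box[OF H, of "[]" r]
    by (auto simp: good_def intro: ladder_web_mult)
qed

lemma good_idn: "good w w (idn w)"
proof (induction w)
  case Nil
  then show ?case
    using ladder_web.one[of 0] by (simp add: good_def)
next
  case (Cons c w)
  have "good [c] [c] (idn [c])"
  proof (cases c)
    case Single
    then show ?thesis
      using ladder_web.one[of 1] by (simp add: good_def ones_Suc)
  next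
    case Double
    then show ?thesis
      using ladder_web_gens(3)[of 0 2] idn_mult(2)[OF gen_typed(5)]
      by (simp add: good_def lad_def numeral_2_eq_2 idn_mult(1)[OF gen_typed(6)] idn_mult(2)[OF gen_typed(5)])
  qed
  from good_box_left[OF Cons this] show ?case
    by simp
qed

lemma good_box: "good s t x \<Longrightarrow> s' = l @ s @ r \<Longrightarrow> t' = l @ t @ r \<Longrightarrow> good s' t' (box l x r)"
  using good_box_left[OF good_box_right[OF _ good_idn, of s t x r] good_idn, of l] by simp

lemma good_gens:
  "good [] [Single, Single] cupS" "good [Single, Single] [] capS"
  "good [Double] [Single, Single] split" "good [Single, Single] [Double] merge"
  using ladder_web_gens(1)[of 0 0] ladder_web_gens(2)[of 0 0] ladder_web_gens(3)[of 0 2]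
    idn_mult[OF gen_typed(1)] idn_mult[OF gen_typed(2)] idn_mult[OF gen_typed(5)] idn_mult[OF gen_typed(6)]
  by (auto simp: good_def cap_def cup_def lad_def numeral_2_eq_2 mult.assoc)

lemma good_hdown: "good [Double, Double] [Single, Single] hdown"
  and good_hup: "good [Single, Single] [Double, Double] hup"
  unfolding hdown_def hup_def
  by (rule good_mult good_box[OF good_gens(1)] good_box[OF good_gens(2)] good_box[OF good_gens(3)] good_box[OF good_gens(4)] | simp)+

lemma good_cupD: "good [] [Double, Double] cupD"
proof -
  have "good [] [Double, Double] (sc (inverse \<delta>) (sc \<delta> cupD))"
    unfolding cupD_hup by (intro good_sc good_mult[OF good_hup good_gens(1)])
  then show ?thesis by simp
qed

lemma good_capD: "good [Double, Double] [] capD"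
proof -
  have "good [Double, Double] [] (sc (inverse \<delta>) (sc \<delta> capD))"
    unfolding capD_hdown by (intro good_sc good_mult[OF good_gens(2) good_hdown])
  then show ?thesis by simp
qed

lemma good_vertex:
  "good [Double, Single] [Single] (gen (Vertex [Double, Single] [Single]))"
  "good [Single, Double] [Single] (gen (Vertex [Single, Double] [Single]))"
  "good [Double, Single, Single] [] (gen (Vertex [Double, Single, Single] []))"
  "good [Single, Double, Single] [] (gen (Vertex [Single, Double, Single] []))"
  "good [Single, Single, Double] [] (gen (Vertex [Single, Single, Double] []))"
  "good [Single] [Double, Single] (gen (Vertex [Single] [Double, Single]))"
  "good [Single] [Single, Double] (gen (Vertex [Single] [Single, Double]))"
  "good [] [Double, Single, Single] (gen (Vertex [] [Double, Single, Single]))"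
  "good [] [Single, Double, Single] (gen (Vertex [] [Single, Double, Single]))"
  "good [] [Single, Single, Double] (gen (Vertex [] [Single, Single, Double]))"
  unfolding vertex_DS_S vertex_SD_S vertex_DSS vertex_SDS vertex_SSD vertex_S_DS vertex_S_SD
    vertex__DSS vertex__SDS vertex__SSD
  by (rule good_mult good_gens good_box[OF good_gens(1)] good_box[OF good_gens(2)]
      good_box[OF good_gens(3)] good_box[OF good_gens(4)] | (simp; fail))+

lemma good_piece: "piece_ok p \<Longrightarrow> good (piece_bot p) (piece_top p) (gen p)"
proof (cases p)
  case (Cup c)
  then show ?thesis
    using good_gens good_cupD by (cases c) auto
next
  case (Cap c)
  then show ?thesis
    using good_gens good_capD by (cases c) auto
next
  case (Vertex a b)
  assume "piece_ok p"
  then have "(a, b) \<in> {([Single, Single, Double], []), ([Single, Single], [Double]), ([Single], [Double, Single]),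
     ([], [Double, Single, Single]), ([Single, Double, Single], []), ([Single, Double], [Single]),
     ([Single], [Single, Double]), ([], [Single, Double, Single]), ([Double, Single, Single], []),
     ([Double, Single], [Single]), ([Double], [Single, Single]), ([], [Single, Single, Double])}"
    using Vertex by (auto simp: append_eq_Cons_conv rev_eq_Cons_iff)
  then show ?thesis
    unfolding Vertex piece_bot.simps piece_top.simps
    using good_gens(3,4) good_vertex by auto
qed

lemma good_Hm: "x \<in> Hm s t \<Longrightarrow> good s t x"
proof (induction rule: Hm_induct)
  case (layer l p r f)
  then show ?case
    by (intro good_mult[of "l @ piece_top p @ r"] good_box[OF good_piece]) auto
qed (auto intro: good_idn good_zero good_add good_sc)

text \<open>The same rules with \<open>Suc (Suc k)\<close> for \<open>k + 2\<close>, the form needed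
  when the number of strands comes from an induction.\<close>

lemmas cap_cup2 = cap_cup[unfolded add_2_eq_Suc']
  and cup_cap2 = cup_cap[unfolded add_2_eq_Suc'] and lad_lad2 = lad_lad[unfolded add_2_eq_Suc']
  and lad_cap2 = lad_cap[unfolded add_2_eq_Suc'] and cap_lad2 = cap_lad[unfolded add_2_eq_Suc']
  and lad_cup2 = lad_cup[unfolded add_2_eq_Suc'] and cup_lad2 = cup_lad[unfolded add_2_eq_Suc']
  and cap_Hm2 = cap_Hm[unfolded add_2_eq_Suc'] and cup_Hm2 = cup_Hm[unfolded add_2_eq_Suc']
  and lad_Hm2 = lad_Hm[unfolded add_2_eq_Suc'] and lad_sq2 = lad_lad_same[unfolded add_2_eq_Suc']
  and cap_lad_same2 = cap_lad_same[unfolded add_2_eq_Suc'] and lad_cup_same2 = lad_cup_same[unfolded add_2_eq_Suc']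
  and cap_lad_next2 = cap_lad_next[unfolded add_2_eq_Suc'] and lad_next_cup2 = lad_next_cup[unfolded add_2_eq_Suc']
  and lad_lad_lad2 = lad_lad_lad[unfolded add_2_eq_Suc'] and lad_lad_lad2' = lad_lad_lad'[unfolded add_2_eq_Suc']

text \<open>The relative positions of two pieces on two strands each: equal, overlapping in one
  strand on either side, disjoint on either side.\<close>

lemma nat_distance_cases:
  fixes p i :: nat
  obtains "p = i" | "p = Suc i" | q where "p = Suc (Suc q)" "i \<le> q" | "i = Suc p" |
    q where "i = Suc (Suc q)" "p \<le> q"
proof -
  have "p = i \<or> p = Suc i \<or> (\<exists>q. p = Suc (Suc q) \<and> i \<le> q) \<or> i = Suc p \<or>
      (\<exists>q. i = Suc (Suc q) \<and> p \<le> q)"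
    by presburger
  then show ?thesis using that by blast
qed

lemma Suc_Suc_le_ex: "Suc (Suc q) \<le> k \<Longrightarrow> \<exists>k'. k = Suc (Suc k')"
  by presburger

subsection \<open>The algebra generated by ladders and cup-caps\<close>

inductive lad_alg :: "nat \<Rightarrow> hom \<Rightarrow> bool" where
  one: "lad_alg k (one k)"
| lad: "lad_alg k x \<Longrightarrow> Suc (Suc i) \<le> k \<Longrightarrow> lad_alg k (lad k i * x)"
| cupcap: "lad_alg (Suc (Suc k)) x \<Longrightarrow> i \<le> k \<Longrightarrow> lad_alg (Suc (Suc k)) (cup k i * (cap k i * x))"
| add: "lad_alg k x \<Longrightarrow> lad_alg k y \<Longrightarrow> lad_alg k (x + y)"
| sc: "lad_alg k x \<Longrightarrow> lad_alg k (sc c x)"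
| zero: "lad_alg k 0"

lemma lad_alg_Hm: "lad_alg k x \<Longrightarrow> x \<in> Hm (ones k) (ones k)"
  by (induction rule: lad_alg.induct)
     (auto intro: Hm_mult[OF lad_Hm2] Hm_mult[OF cup_Hm2] Hm_mult[OF cap_Hm2])

lemma lad_alg_mult: "lad_alg k x \<Longrightarrow> lad_alg k y \<Longrightarrow> lad_alg k (x * y)"
  by (induction rule: lad_alg.induct)
     (auto simp: idn_mult(1)[OF lad_alg_Hm] mult.assoc distrib_right intro: lad_alg.intros)

lemma lad_alg_lad: "Suc (Suc i) \<le> k \<Longrightarrow> lad_alg k (lad k i)"
  using lad_alg.lad[OF lad_alg.one, of i k] idn_mult(2)[OF lad_Hm2, of i k] by simp

lemma lad_alg_uminus: "lad_alg k x \<Longrightarrow> lad_alg k (- x)"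
  using lad_alg.sc[of k x "-1"] by (simp add: sc_uminus_left)

lemma lad_alg_diff: "lad_alg k x \<Longrightarrow> lad_alg k y \<Longrightarrow> lad_alg k (x - y)"
  using lad_alg.add[of k x "- y"] lad_alg_uminus by simp

text \<open>As in the Temperley-Lieb algebra: a product of neighbouring equal-position pairs
  straightens one cap against the next cup, which moves the remaining cap or cup by one
  place.\<close>

lemma lad_alg_cup_cap: "i \<le> k \<Longrightarrow> j \<le> k \<Longrightarrow> lad_alg (Suc (Suc k)) (cup k i * cap k j)"
proof -
  have same: "lad_alg (Suc (Suc k)) (cup k i * cap k i)" if "i \<le> k" for i
    using lad_alg.cupcap[OF lad_alg.one that] idn_mult(2)[OF cap_Hm2[OF that]] by simp
  have up: "lad_alg (Suc (Suc k)) (cup k i * cap k (i + m))" if "i + m \<le> k" for i m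
    using that
  proof (induction m arbitrary: i)
    case (Suc m)
    have "lad_alg (Suc (Suc k)) ((cup k i * cap k i) * (cup k (Suc i) * cap k (Suc i + m)))"
      using Suc by (intro lad_alg_mult same Suc.IH) auto
    then show ?case
      using Suc.prems mult_assoc_rule[OF cap_cup_right[of i k]] idn_mult(1)[OF cap_Hm2, of "Suc i + m" k]
      by (simp add: mult.assoc)
  qed (use same in simp)
  have down: "lad_alg (Suc (Suc k)) (cup k (i + m) * cap k i)" if "i + m \<le> k" for i m
    using that
  proof (induction m)
    case (Suc m)
    have "lad_alg (Suc (Suc k)) ((cup k (Suc (i + m)) * cap k (Suc (i + m))) * (cup k (i + m) * cap k i))"
      using Suc by (intro lad_alg_mult same Suc.IH) auto
    then show ?case
      using Suc.prems mult_assoc_rule[OF cap_cup_left[of "i + m" k]] idn_mult(1)[OF cap_Hm2, of i k]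
      by (simp add: mult.assoc)
  qed (use same in simp)
  show "i \<le> k \<Longrightarrow> j \<le> k \<Longrightarrow> ?thesis"
    using up[of i "j - i"] down[of j "i - j"] by (cases "i \<le> j") auto
qed

lemma lad_alg_pad: "lad_alg k x \<Longrightarrow> lad_alg (Suc (Suc k)) (box [] x (ones 2))"
proof (induction rule: lad_alg.induct)
  case (one k)
  then show ?case
    using lad_alg.one[of "Suc (Suc k)"] box_one[of 0 k 2] by simp
next
  case (lad k x i)
  then show ?case
    using lad_alg.lad[OF lad(3), of i] box_lad[of i k 0 2] by (simp add: box_mult)
next
  case (cupcap k x i)
  then show ?case
    using lad_alg.cupcap[OF cupcap(3), of i] box_cup[of i k 0 2] box_cap[of i k 0 2] by (simp add: box_mult)
qed (auto simp: box_add box_sc intro: lad_alg.intros)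

lemma cup_last_mult: "lad_alg k x \<Longrightarrow> cup k k * x = box [] x (ones 2) * cup k k"
  using exchange0[OF lad_alg_Hm gen_typed(2), of k x "[]"] by (simp add: cup_def numeral_2_eq_2 ones_Suc)

text \<open>For \<open>k > 0\<close> the straightened zigzag \<open>cap k (k - 1) * cup k k\<close>
  is inserted below the cup: the cup is created at the far right and an algebra element moves it
  into place.\<close>

lemma cup_last: "i \<le> k \<Longrightarrow> \<exists>y. lad_alg (Suc (Suc k)) y \<and> cup k i = y * cup k k"
proof (cases k)
  case 0
  then show "i \<le> k \<Longrightarrow> ?thesis"
    using lad_alg.one[of 2] idn_mult(1)[OF cup_Hm, of 0 0] by (auto simp: numeral_2_eq_2)
next
  case (Suc k')
  assume "i \<le> k"
  have "cup k i = (cup k i * cap k k') * cup k k"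
    using cap_cup_right[of k' k] Suc idn_mult(2)[OF cup_Hm[OF \<open>i \<le> k\<close>]] by (simp add: mult.assoc)
  then show ?thesis
    using lad_alg_cup_cap[of i k k'] \<open>i \<le> k\<close> Suc by auto
qed

text \<open>A cap followed downwards by ladders at consecutive positions
  \<open>i + 1, ..., i + m\<close>. These are the normal forms of a cap pushed into the algebra:
  every other ladder can be brought above the cap.\<close>

fun zigzag :: "nat \<Rightarrow> nat \<Rightarrow> nat \<Rightarrow> hom" where
  "zigzag k i 0 = cap k i"
| "zigzag k i (Suc m) = zigzag k i m * lad (Suc (Suc k)) (Suc (i + m))"

lemma zigzag_Hm: "i + m \<le> k \<Longrightarrow> zigzag k i m \<in> Hm (ones (Suc (Suc k))) (ones k)"
  by (induction m) (auto intro: cap_Hm2 Hm_mult[OF _ lad_Hm2])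

lemma zigzag_lad_right: "i + m \<le> p \<Longrightarrow> Suc (Suc p) \<le> k \<Longrightarrow>
    zigzag k i m * lad (Suc (Suc k)) (Suc (Suc p)) = lad k p * zigzag k i m"
proof (induction m)
  case (Suc m)
  have "lad (Suc (Suc k)) (Suc (i + m)) * lad (Suc (Suc k)) (Suc (Suc p)) =
      lad (Suc (Suc k)) (Suc (Suc p)) * lad (Suc (Suc k)) (Suc (i + m))"
    using Suc.prems by (intro lad_lad2) auto
  then show ?case
    using Suc mult_assoc_rule[OF Suc.IH] by (simp add: mult.assoc)
qed (simp add: cap_lad2)

lemma zigzag_cup_right: "i + m \<le> p \<Longrightarrow> p \<le> k \<Longrightarrow>
    zigzag (Suc (Suc k)) i m * cup (Suc (Suc k)) (Suc (Suc p)) = cup k p * zigzag k i m"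
proof (induction m)
  case (Suc m)
  have "lad (Suc (Suc (Suc (Suc k)))) (Suc (i + m)) * cup (Suc (Suc k)) (Suc (Suc p)) =
      cup (Suc (Suc k)) (Suc (Suc p)) * lad (Suc (Suc k)) (Suc (i + m))"
    using Suc.prems by (intro lad_cup2) auto
  then show ?case
    using Suc mult_assoc_rule[OF Suc.IH] by (simp add: mult.assoc)
qed (simp add: cap_cup2)

lemma lad_alg_cup_zigzag: "i + m \<le> k \<Longrightarrow> p \<le> k \<Longrightarrow> lad_alg (Suc (Suc k)) (cup k p * zigzag k i m)"
proof (induction m)
  case (Suc m)
  then show ?case
    using lad_alg_mult[OF Suc.IH lad_alg_lad[of "Suc (i + m)" "Suc (Suc k)"]] by (simp add: mult.assoc)
qed (simp add: lad_alg_cup_cap)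

text \<open>Here the number of strands drops: a zigzag closed by a cup from below becomes an element
  of the algebra on \<open>k\<close> strands. The induction lets the lowest ladder meet the
  cup.\<close>

lemma zigzag_cup: "i + m \<le> k \<Longrightarrow> p \<le> k \<Longrightarrow> lad_alg k (zigzag k i m * cup k p)"
proof (induction m arbitrary: p)
  case 0
  show ?case
  proof (cases rule: nat_distance_cases[of p i])
    case 1
    then show ?thesis
      using 0 by (auto simp: cap_cup_same intro!: lad_alg.sc lad_alg.one)
  next
    case 2
    then show ?thesis
      using 0 by (auto simp: cap_cup_right intro!: lad_alg.one)
  next
    case (3 q)
    then obtain k' where "k = Suc (Suc k')"
      using 0 Suc_Suc_le_ex[of q k] by auto
    then show ?thesis
      using 0 3 lad_alg_cup_cap[of q k' i] by (auto simp: cap_cup2)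
  next
    case 4
    then show ?thesis
      using 0 cap_cup_left[of p k] by (auto intro!: lad_alg.one)
  next
    case (5 j)
    then obtain k' where "k = Suc (Suc k')"
      using 0 Suc_Suc_le_ex[of j k] by auto
    then show ?thesis
      using 0 5 lad_alg_cup_cap[of p k' j] by (auto simp: cup_cap2)
  qed
next
  case (Suc m)
  define j where "j = Suc (i + m)"
  have j: "j \<le> k" "i + m = j - 1" "j > 0"
    using Suc.prems by (auto simp: j_def)
  have Y: "zigzag k i (Suc m) = zigzag k i m * lad (Suc (Suc k)) j"
    by (simp add: j_def)
  show ?case
  proof (cases rule: nat_distance_cases[of p j])
    case 1
    then show ?thesis
      using j by (simp add: Y mult.assoc lad_cup_same2 lad_alg.zero)
  next
    case 2
    \<comment> \<open>The ladder passes to the other side of the cup. At \<open>Suc j\<close> it is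
      disjoint from the shorter zigzag and slides up through it, shifted by the two strands of the
      cap.\<close>
    have "lad (Suc (Suc k)) j * cup k p = lad (Suc (Suc k)) (Suc j) * cup k j - cup k p + cup k j"
      using 2 lad_next_cup2[of j k] Suc.prems by simp
    moreover have "zigzag k i m * (lad (Suc (Suc k)) (Suc j) * cup k j) = lad k (i + m) * (zigzag k i m * cup k j)"
      using mult_assoc_rule[OF zigzag_lad_right[of i m "i + m" k]] 2 Suc.prems by (simp add: j_def mult.assoc)
    ultimately have "zigzag k i (Suc m) * cup k p = lad k (i + m) * (zigzag k i m * cup k j) -
        zigzag k i m * cup k p + zigzag k i m * cup k j"
      by (simp add: Y distrib_left right_diff_distrib mult.assoc del: zigzag.simps)
    moreover have "lad_alg k (lad k (i + m) * (zigzag k i m * cup k j))"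
      using 2 Suc by (intro lad_alg.lad Suc.IH) (auto simp: j_def)
    ultimately show ?thesis
      using Suc j by (simp add: lad_alg.add lad_alg_diff)
  next
    case (3 q)
    then obtain k' where k': "k = Suc (Suc k')"
      using Suc Suc_Suc_le_ex[of q k] by auto
    then have "zigzag k i (Suc m) * cup k p = cup k' q * zigzag k' i (Suc m)"
      using zigzag_cup_right[of i "Suc m" q k'] 3 Suc.prems by (simp add: j_def)
    then show ?thesis
      using lad_alg_cup_zigzag[of i "Suc m" k' q] k' 3 Suc.prems by (simp add: j_def)
  next
    case 4
    have e: "lad (Suc (Suc k)) j * cup k p = lad (Suc (Suc k)) p * cup k j + cup k j - cup k p"
      using 4 lad_next_cup2[of p k] Suc.prems j by simp
    have "lad_alg k (zigzag k i m * (lad (Suc (Suc k)) p * cup k j))"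
    proof (cases m)
      case 0
      then show ?thesis
        using 4 j mult_assoc_rule[OF cap_lad_same2[of i k]] Suc.prems by (simp add: j_def lad_alg.zero)
    next
      case (Suc m')
      have "zigzag k i m * lad (Suc (Suc k)) p = sc \<delta> (zigzag k i m)"
        using 4 Suc lad_sq2[of p "Suc (Suc k)"] j by (simp add: j_def mult.assoc)
      then have "zigzag k i m * (lad (Suc (Suc k)) p * cup k j) = sc \<delta> (zigzag k i m * cup k j)"
        by (simp add: mult.assoc[symmetric])
      then show ?thesis
        using Suc.IH Suc.prems j by (simp add: lad_alg.sc)
    qed
    then show ?thesis
      using Suc.IH Suc.prems j 4 unfolding Y mult.assoc e distrib_left right_diff_distrib
      by (intro lad_alg.add lad_alg_diff) auto
  next
    case (5 q)
    have "lad (Suc (Suc k)) j * cup k p = cup k p * lad k q"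
      using cup_lad2[of p q k] 5 j by simp
    then have "zigzag k i (Suc m) * cup k p = (zigzag k i m * cup k p) * lad k q"
      by (simp add: Y mult.assoc del: zigzag.simps)
    then show ?thesis
      using lad_alg_mult[OF Suc.IH[of p] lad_alg_lad[of q k]] Suc.prems 5 j by auto
  qed
qed

text \<open>A left module over \<open>lad_alg k\<close>. The bound \<open>J\<close> on the lowest
  ladder drives the induction in \<open>zz_span_zigzag_lad\<close>: a product known to stay below a
  ladder may afterwards be multiplied by that ladder with \<open>zz_span_lad_next\<close>.\<close>

inductive zz_span :: "nat \<Rightarrow> nat \<Rightarrow> hom \<Rightarrow> bool" for k J :: nat where
  gen: "lad_alg k z \<Longrightarrow> i + m \<le> J \<Longrightarrow> zz_span k J (z * zigzag k i m)"
| add: "zz_span k J x \<Longrightarrow> zz_span k J y \<Longrightarrow> zz_span k J (x + y)"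
| zero: "zz_span k J 0"

lemma zz_span_left: "zz_span k J x \<Longrightarrow> lad_alg k z \<Longrightarrow> zz_span k J (z * x)"
proof (induction rule: zz_span.induct)
  case (gen y i m)
  then show ?case
    using zz_span.gen[OF lad_alg_mult[of k z y]] by (simp add: mult.assoc)
qed (auto simp: distrib_left intro: zz_span.intros)

lemma zz_span_sc: "zz_span k J x \<Longrightarrow> zz_span k J (sc c x)"
proof (induction rule: zz_span.induct)
  case (gen y i m)
  then show ?case
    using zz_span.gen[OF lad_alg.sc[of k y c]] by simp
qed (auto simp: sc_add intro: zz_span.intros)

lemma zz_span_uminus: "zz_span k J x \<Longrightarrow> zz_span k J (- x)"
  using zz_span_sc[of k J x "-1"] by (simp add: sc_uminus_left)

lemma zz_span_diff: "zz_span k J x \<Longrightarrow> zz_span k J y \<Longrightarrow> zz_span k J (x - y)"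
  using zz_span.add[of k J x "- y"] zz_span_uminus by simp

lemma zz_span_mono: "zz_span k J x \<Longrightarrow> J \<le> J' \<Longrightarrow> zz_span k J' x"
  by (induction rule: zz_span.induct) (auto intro: zz_span.intros)

lemma zz_span_zigzag: "i + m \<le> J \<Longrightarrow> J \<le> k \<Longrightarrow> zz_span k J (zigzag k i m)"
  using zz_span.gen[OF lad_alg.one, of i m J k] idn_mult(1)[OF zigzag_Hm, of i m k] by simp

lemma zz_span_lad_zigzag: "i + m \<le> J \<Longrightarrow> Suc (Suc p) \<le> k \<Longrightarrow> zz_span k J (lad k p * zigzag k i m)"
  by (intro zz_span.gen lad_alg_lad)

lemma zz_span_lad_next: "zz_span k J x \<Longrightarrow> J < k \<Longrightarrow> zz_span k (Suc J) (x * lad (Suc (Suc k)) (Suc J))"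
proof (induction rule: zz_span.induct)
  case (gen z i m)
  show ?case
  proof (cases "i + m = J")
    case True
    then show ?thesis
      using zz_span.gen[OF gen(1), of i "Suc m" "Suc J"] by (simp add: mult.assoc)
  next
    case False
    then obtain J' where J': "J = Suc J'" "i + m \<le> J'"
      using gen by (cases J) auto
    then have "zigzag k i m * lad (Suc (Suc k)) (Suc J) = lad k J' * zigzag k i m"
      using gen by (simp add: zigzag_lad_right)
    then show ?thesis
      using zz_span_left[OF zz_span_lad_zigzag[of i m "Suc J" J' k] gen(1)] gen J' by (simp add: mult.assoc)
  qed
qed (auto simp: distrib_right intro: zz_span.intros)

lemma zz_span_cap_lad:
  assumes "i \<le> J" "q \<le> J" "J \<le> k"
  shows "zz_span k J (cap k i * lad (Suc (Suc k)) q)"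
proof -
  show ?thesis
  proof (cases rule: nat_distance_cases[of q i])
    case 1
    then show ?thesis using assms by (simp add: cap_lad_same2 zz_span.zero)
  next
    case 2
    then show ?thesis using zz_span_zigzag[of i 1 J k] assms by simp
  next
    case (3 p)
    then show ?thesis
      using zz_span_lad_zigzag[of i 0 J p k] assms cap_lad2[of i p k] by simp
  next
    case 4
    have "cap k i * lad (Suc (Suc k)) q = zigzag k q 1 - zigzag k i 0 + zigzag k q 0"
      using cap_lad_next2[of q k] 4 assms by simp
    then show ?thesis
      using assms 4 by (auto intro!: zz_span.add zz_span_diff zz_span_zigzag simp del: zigzag.simps)
  next
    case (5 q')
    then show ?thesis
      using zz_span_lad_zigzag[of i 0 J q k] assms lad_cap2[of q i k] by simp
  qed
qed

lemma zz_span_zigzag_lad: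
  assumes "i + m \<le> J" "q \<le> J" "J \<le> k"
  shows "zz_span k J (zigzag k i m * lad (Suc (Suc k)) q)"
  using assms
proof (induction m arbitrary: q J)
  case 0
  then show ?case using zz_span_cap_lad by simp
next
  case (Suc m)
  define j where "j = Suc (i + m)"
  have j: "j \<le> J" "j \<le> k" "j > 0"
    using Suc.prems by (auto simp: j_def)
  have Y: "zigzag k i (Suc m) = zigzag k i m * lad (Suc (Suc k)) j"
    by (simp add: j_def)
  show ?case
  proof (cases rule: nat_distance_cases[of q j])
    case 1
    have "zigzag k i (Suc m) * lad (Suc (Suc k)) q = sc \<delta> (zigzag k i (Suc m))"
      using 1 j lad_sq2[of j "Suc (Suc k)"] by (simp add: Y mult.assoc del: zigzag.simps)
    then show ?thesis
      using Suc.prems by (simp add: zz_span_sc zz_span_zigzag del: zigzag.simps)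
  next
    case 2
    then show ?thesis
      using zz_span_zigzag[of i "Suc (Suc m)" J k] Suc.prems by (simp add: j_def)
  next
    case (3 p)
    then show ?thesis
      using zigzag_lad_right[of i "Suc m" p k] zz_span_lad_zigzag[of i "Suc m" J p k] Suc.prems
      by (simp add: j_def del: zigzag.simps)
  next
    case 4
    show ?thesis
    proof (cases m)
      case 0
      \<comment> \<open>Only one ladder stands under the cap, so there is no triple of ladders to
        rewrite; instead the cap itself moves sideways. Here \<open>q = i\<close>.\<close>
      have "zigzag k i (Suc m) * lad (Suc (Suc k)) q = sc (\<delta> + 1) (cap k j * lad (Suc (Suc k)) i)"
        using 0 4 cap_lad_next2[of i k] j lad_sq2[of i "Suc (Suc k)"] cap_lad_same2[of i k]
        by (simp add: Y j_def distrib_right left_diff_distrib mult.assoc sc_add_left)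
      then show ?thesis
        using zz_span_cap_lad[of j J i k] j Suc.prems 0 by (simp add: zz_span_sc)
    next
      case (Suc m')
      have q: "q = Suc (i + m')"
        using 4 Suc by (simp add: j_def)
      \<comment> \<open>The triple relation produces a cup directly below the shorter zigzag; by
        \<open>zigzag_cup\<close> that part lies in the algebra, and a cap with one ladder remains
        below it.\<close>
      have "zigzag k i (Suc m) * lad (Suc (Suc k)) q =
          zigzag k i m' * (lad (Suc (Suc k)) q * lad (Suc (Suc k)) (Suc q) * lad (Suc (Suc k)) q)"
        using 4 Suc q by (simp add: mult.assoc)
      also have "\<dots> = (zigzag k i m * cup k j) * (cap k j * lad (Suc (Suc k)) q) - sc \<delta> (zigzag k i m)"
        using 4 Suc q lad_lad_lad2[of q k] j by (simp add: mult.assoc right_diff_distrib)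
      finally show ?thesis
        using zz_span_left[OF zz_span_cap_lad[of j J q k] zigzag_cup[of i m k j]] zz_span_sc[OF zz_span_zigzag[of i m J k]] j Suc.prems 4
        by (simp add: zz_span_diff del: zigzag.simps)
    qed
  next
    case (5 q')
    \<comment> \<open>The new ladder commutes past the lowest one. The induction hypothesis is used
      with bound \<open>i + m\<close>, exactly one below \<open>j\<close>, so that multiplication by
      the ladder at \<open>j\<close> is admissible.\<close>
    have "zigzag k i (Suc m) * lad (Suc (Suc k)) q = (zigzag k i m * lad (Suc (Suc k)) q) * lad (Suc (Suc k)) j"
      using lad_lad2[of q j "Suc (Suc k)"] 5 j by (simp add: Y mult.assoc del: zigzag.simps)
    moreover have "zz_span k (i + m) (zigzag k i m * lad (Suc (Suc k)) q)"
      using 5 Suc.prems by (intro Suc.IH) (auto simp: j_def)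
    ultimately show ?thesis
      using zz_span_mono[OF zz_span_lad_next[of k "i + m"], of _ J] j by (simp add: j_def)
  qed
qed

lemma zz_span_cup: "zz_span k k x \<Longrightarrow> p \<le> k \<Longrightarrow> lad_alg k (x * cup k p)"
  by (induction rule: zz_span.induct)
     (auto simp: mult.assoc distrib_right intro: lad_alg.intros lad_alg_mult zigzag_cup)

lemma zz_span_lad:
  assumes "zz_span k k x" "q \<le> k"
  shows "zz_span k k (x * lad (Suc (Suc k)) q)"
  using assms(1)
proof (induction rule: zz_span.induct)
  case (gen z i m)
  then show ?case
    using zz_span_left[OF zz_span_zigzag_lad[of i m k q k] gen(1)] assms by (simp add: mult.assoc)
qed (auto simp: distrib_right intro: zz_span.intros)

text \<open>A cup-cap pair cuts the product in two: everything above its cap, including the cup,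
  falls into the algebra by \<open>zz_span_cup\<close>, and the cap starts a new zigzag without
  ladders.\<close>

lemma zz_span_lad_alg:
  assumes "lad_alg (Suc (Suc k)) y" "zz_span k k x"
  shows "zz_span k k (x * y)"
  using assms
proof (induction "Suc (Suc k)" y arbitrary: x rule: lad_alg.induct)
  case one
  have "x \<in> Hm (ones (Suc (Suc k))) (ones k)"
    using one by (induction rule: zz_span.induct) (auto intro!: Hm_mult[OF lad_alg_Hm zigzag_Hm])
  then show ?case
    using one idn_mult(2) by metis
next
  case (lad y i)
  then show ?case
    by (simp add: mult.assoc[symmetric] zz_span_lad)
next
  case (cupcap y i)
  have "zz_span k k ((x * cup k i) * zigzag k i 0)"
    using cupcap by (intro zz_span.gen zz_span_cup) auto
  then show ?case
    using cupcap(2)[of "x * cup k i * cap k i"] by (simp add: mult.assoc)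
qed (auto simp: distrib_left intro: zz_span.intros zz_span_sc)

lemma zz_span_cap_lad_alg: "lad_alg (Suc (Suc k)) y \<Longrightarrow> i \<le> k \<Longrightarrow> zz_span k k (cap k i * y)"
  using zz_span_lad_alg[OF _ zz_span_zigzag[of i 0 k k]] by simp

subsection \<open>Morphisms that factor through lower weights\<close>

definition hdown_at :: "nat \<Rightarrow> nat \<Rightarrow> hom" where
  "hdown_at n p = box (doubles p) hdown (doubles (n - p - 2))"

text \<open>The coefficients \<open>A\<close> are arbitrary ring elements, so a left ideal results
  without any bookkeeping of words.\<close>

inductive low :: "nat \<Rightarrow> hom \<Rightarrow> bool" for n :: nat where
  zero: "low n 0"
| add: "low n x \<Longrightarrow> p + 2 \<le> n \<Longrightarrow> low n (x + A * hdown_at n p)"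

lemma low_gen: "p + 2 \<le> n \<Longrightarrow> low n (A * hdown_at n p)"
  using low.add[OF low.zero, of p n A] by simp

lemma low_add: "low n y \<Longrightarrow> low n x \<Longrightarrow> low n (x + y)"
  by (induction rule: low.induct) (auto simp: add.assoc[symmetric] intro: low.intros)

lemma low_left: "low n x \<Longrightarrow> low n (A * x)"
  by (induction rule: low.induct) (auto simp: distrib_left mult.assoc[symmetric] intro: low.intros)

lemma low_sc: "low n x \<Longrightarrow> low n (sc c x)"
proof (induction rule: low.induct)
  case (add x p A)
  then show ?case
    using low.add[of n "sc c x" p "sc c A"] by (simp add: sc_add)
qed (simp add: low.zero)

lemma low_uminus: "low n x \<Longrightarrow> low n (- x)"
  using low_sc[of n x "-1"] by (simp add: sc_uminus_left)

lemma low_diff: "low n x \<Longrightarrow> low n y \<Longrightarrow> low n (x - y)"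
  using low_add[of n "- y" x] low_uminus by simp

lemma low_sc_iff: "c \<noteq> 0 \<Longrightarrow> low n (sc c x) \<longleftrightarrow> low n x"
  using low_sc[of n "sc c x" "inverse c"] low_sc[of n x c] by auto

lemma doubles_add: "doubles (i + j) = doubles i @ doubles j"
  by (simp add: doubles_def replicate_add)

lemma doubles_0 [simp]: "doubles 0 = []"
  and doubles_Suc: "doubles (Suc k) = Double # doubles k"
  and count_doubles [simp]: "count_list (doubles k) Double = k" "count_list (doubles k) Single = 0"
  and length_doubles [simp]: "length (doubles k) = k"
  by (induction k) (auto simp: doubles_def)

lemma width_doubles [simp]: "width (doubles k) = 2 * k"
  by (induction k) (auto simp: doubles_Suc)

text \<open>Opens all double strands beside the middle word \<open>w\<close> and leaves
  \<open>w\<close> itself closed, so that a morphism on \<open>w\<close> can be moved through the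
  opening.\<close>

definition rest :: "word \<Rightarrow> word \<Rightarrow> word \<Rightarrow> hom" where
  "rest u w v = box [] (splits u) (w @ ones (width v)) * box (u @ w) (splits v) []"

lemma splits_mid: "splits (u @ w @ v) = box (ones (width u)) (splits w) (ones (width v)) * rest u w v"
proof -
  have "splits (u @ w @ v) = (box [] (splits u) (ones (width w) @ ones (width v)) * box u (splits w) (ones (width v)))
      * box (u @ w) (splits v) []"
    by (simp add: splits_append box_mult ones_add mult.assoc)
  also have "box [] (splits u) (ones (width w) @ ones (width v)) * box u (splits w) (ones (width v)) =
      box (ones (width u)) (splits w) (ones (width v)) * box [] (splits u) (w @ ones (width v))"
    using exchange[OF splits_Hm[of u] splits_Hm[of w], of "[]" "[]" "ones (width v)"] by simp
  finally show ?thesis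
    by (simp add: rest_def mult.assoc)
qed

lemma rest_exchange:
  assumes "y \<in> Hm w w'"
  shows "box (ones (width u)) y (ones (width v)) * rest u w v = rest u w' v * box u y v"
proof -
  have "box (ones (width u)) y (ones (width v)) * box [] (splits u) (w @ ones (width v)) =
      box [] (splits u) (w' @ ones (width v)) * box u y (ones (width v))"
    using exchange[OF splits_Hm[of u] assms, of "[]" "[]" "ones (width v)"] by simp
  moreover have "box u y (ones (width v)) * box (u @ w) (splits v) [] = box (u @ w') (splits v) [] * box u y v"
    using exchange[OF assms splits_Hm[of v], of u "[]" "[]"] by simp
  ultimately show ?thesis
    unfolding rest_def by (metis mult.assoc)
qed

abbreviation split_all :: "nat \<Rightarrow> hom" where "split_all n \<equiv> splits (doubles n)"
abbreviation merge_all :: "nat \<Rightarrow> hom" where "merge_all n \<equiv> merges (doubles n)"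

lemma split_all_mid: "i < n \<Longrightarrow> split_all n = box (ones (2 * i)) split (ones (2 * (n - Suc i))) *
    rest (doubles i) [Double] (doubles (n - Suc i))"
  using splits_mid[of "doubles i" "[Double]" "doubles (n - Suc i)"] doubles_add[of i "Suc (n - Suc i)"]
    idn_mult(2)[OF gen_typed(5)]
  by (simp add: doubles_Suc)

text \<open>An even position lies on the two halves of one opened double strand, where a ladder
  closes a bigon and, in the next lemma, a cap closes a monogon.\<close>

lemma lad_split_all: assumes "i < n" shows "lad (2 * n) (2 * i) * split_all n = sc \<delta> (split_all n)"
proof -
  have "(split * merge) * split = sc \<delta> split"
    using bigonS idn_mult(2)[OF gen_typed(5)] by (simp add: mult.assoc)
  from box_comp[OF this, of "ones (2 * i)" "ones (2 * (n - Suc i))"] show ?thesis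
    using assms by (simp add: split_all_mid lad_def mult.assoc[symmetric] box_sc diff_mult_distrib2 numeral_2_eq_2)
qed

lemma cap_split_all: assumes "i < n" "2 * n = Suc (Suc k)" shows "cap k (2 * i) * split_all n = 0"
proof -
  have "k - 2 * i = 2 * (n - Suc i)"
    using assms by auto
  then show ?thesis
    using assms box_comp[OF cap_split, of "ones (2 * i)" "ones (2 * (n - Suc i))"]
    by (simp add: split_all_mid cap_def mult.assoc[symmetric])
qed

text \<open>A cap at an odd position joins halves of two neighbouring double strands, which is
  precisely \<open>hdown\<close>; the remaining opening moves above it by
  \<open>rest_exchange\<close>.\<close>

lemma cap_odd_split_all: assumes "Suc i < n" "2 * n = Suc (Suc k)" shows "low n (cap k (Suc (2 * i)) * split_all n)"
proof -
  let ?u = "doubles i" and ?v = "doubles (n - i - 2)"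
  have "doubles n = doubles (i + Suc (Suc (n - i - 2)))"
    using assms by (intro arg_cong[of _ _ doubles]) auto
  then have d: "doubles n = ?u @ [Double, Double] @ ?v"
    by (simp only: doubles_add doubles_Suc append.simps)
  have s: "splits [Double, Double] = box [Single, Single] split [] * box [] split [Double]"
    using split_split idn_box_right[OF gen_typed(5), of "[Double, Double]" "[Double]" "[]"]
    by (simp add: box_mult numeral_2_eq_2 ones_Suc)
  have "cap k (Suc (2 * i)) = box (ones (2 * i)) (box [Single] capS [Single]) (ones (2 * (n - i - 2)))"
  proof -
    have "ones (Suc (2 * i)) = ones (2 * i) @ [Single]"
      using ones_add[of "2 * i" 1] by (simp add: ones_Suc)
    moreover have "k - Suc (2 * i) = Suc (2 * (n - i - 2))"
      using assms by auto
    ultimately show ?thesis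
      by (simp add: cap_def ones_Suc)
  qed
  then have "cap k (Suc (2 * i)) * split_all n = box (ones (2 * i)) hdown (ones (2 * (n - i - 2))) *
      rest ?u [Double, Double] ?v"
    unfolding d splits_mid s by (simp add: hdown_def box_mult mult.assoc)
  also have "\<dots> = rest ?u [Single, Single] ?v * hdown_at n i"
    using rest_exchange[OF hdown_Hm, of ?u ?v] by (simp add: hdown_at_def)
  finally show ?thesis
    using assms by (auto intro: low_gen)
qed

lemma merges_mid: "merges (u @ w @ v) = (box (u @ w) (merges v) [] * box [] (merges u) (w @ ones (width v))) *
    box (ones (width u)) (merges w) (ones (width v))"
proof -
  have "merges (u @ w @ v) = box (u @ w) (merges v) [] *
    (box u (merges w) (ones (width v)) * box [] (merges u) (ones (width w) @ ones (width v)))"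
    by (simp add: merges_append box_mult ones_add mult.assoc)
  also have "box u (merges w) (ones (width v)) * box [] (merges u) (ones (width w) @ ones (width v)) =
      box [] (merges u) (w @ ones (width v)) * box (ones (width u)) (merges w) (ones (width v))"
    using exchange[OF merges_Hm[of u] merges_Hm[of w], of "[]" "[]" "ones (width v)"] by simp
  finally show ?thesis
    by (simp add: mult.assoc)
qed

lemma merge_all_lad: assumes "i < n" shows "merge_all n * lad (2 * n) (2 * i) = sc \<delta> (merge_all n)"
proof -
  have d: "doubles n = doubles i @ [Double] @ doubles (n - Suc i)"
    using doubles_add[of i "Suc (n - Suc i)"] assms by (simp add: doubles_Suc)
  have m: "merges [Double] = merge"
    using idn_mult(1)[OF gen_typed(6)] by simp
  have "merge * (split * merge) = sc \<delta> merge"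
    using bigonS idn_mult(1)[OF gen_typed(6)] by (simp add: mult.assoc[symmetric])
  from box_comp[OF this, of "ones (2 * i)" "ones (2 * (n - Suc i))"]
  have "box (ones (2 * i)) merge (ones (2 * (n - Suc i))) * lad (2 * n) (2 * i) =
      sc \<delta> (box (ones (2 * i)) merge (ones (2 * (n - Suc i))))"
    using assms by (simp add: lad_def box_sc diff_mult_distrib2 numeral_2_eq_2)
  then show ?thesis
    unfolding d merges_mid m by (simp add: mult.assoc)
qed

text \<open>The ladders of a zigzag with the recursion at the top: the next lemmas need access to
  the ladders just below the cap, whereas \<open>zigzag\<close> recurses at its lowest
  ladder.\<close>

fun chain :: "nat \<Rightarrow> nat \<Rightarrow> nat \<Rightarrow> hom" where
  "chain k i 0 = one k"
| "chain k i (Suc m) = lad k i * chain k (Suc i) m"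

lemma chain_snoc: "Suc (i + m) < k \<Longrightarrow> chain k i (Suc m) = chain k i m * lad k (i + m)"
proof (induction m arbitrary: i)
  case 0
  then show ?case
    using idn_mult[OF lad_Hm2, of i k] by simp
next
  case (Suc m)
  have "chain k i (Suc (Suc m)) = lad k i * chain k (Suc i) (Suc m)"
    by (simp only: chain.simps)
  also have "\<dots> = lad k i * (chain k (Suc i) m * lad k (Suc i + m))"
    using Suc.prems by (subst Suc.IH) auto
  finally show ?case
    by (simp add: mult.assoc)
qed

lemma zigzag_chain: "i + m \<le> k \<Longrightarrow> zigzag k i m = cap k i * chain (Suc (Suc k)) (Suc i) m"
proof (induction m)
  case 0
  then show ?case
    using idn_mult(2)[OF cap_Hm2, of i k] by simp
next
  case (Suc m)
  then show ?case
    using chain_snoc[of "Suc i" m "Suc (Suc k)"] by (simp add: mult.assoc del: chain.simps)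
qed

lemma lad_chain: "Suc (Suc q) \<le> i \<Longrightarrow> i + m < k \<or> m = 0 \<Longrightarrow> Suc (Suc q) \<le> k \<Longrightarrow>
    lad k q * chain k i m = chain k i m * lad k q"
proof (induction m arbitrary: i)
  case 0
  then show ?case
    using idn_mult[OF lad_Hm2, of q k] by simp
next
  case (Suc m)
  then show ?case
    using mult_assoc_rule[OF lad_lad2[of q i k]] Suc.IH[of "Suc i"] by (simp add: mult.assoc)
qed

lemma cap_chain: "i \<le> p \<Longrightarrow> p + m < k \<or> m = 0 \<Longrightarrow> i \<le> k \<Longrightarrow>
    cap k i * chain (Suc (Suc k)) (Suc (Suc p)) m = chain k p m * cap k i"
proof (induction m arbitrary: p)
  case 0
  then show ?case
    using idn_mult[OF cap_Hm2, of i k] by simp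
next
  case (Suc m)
  then show ?case
    using mult_assoc_rule[OF cap_lad2[of i p k]] Suc.IH[of "Suc p"] by (simp add: mult.assoc)
qed

text \<open>Ladders at even positions become scalars on \<open>split_all n\<close>. In each parity
  case the zigzag is rewritten until such a ladder reaches the bottom and a shorter zigzag
  remains.\<close>

lemma low_zigzag_split_all:
  assumes k: "2 * n = Suc (Suc k)"
  shows "i + m \<le> k \<Longrightarrow> low n (zigzag k i m * split_all n)"
proof (induction m arbitrary: i rule: less_induct)
  case (less m)
  note lads = lad_split_all[of _ n, unfolded k]
  have capev: "low n (cap k (2 * i) * split_all n)" if "2 * i \<le> k" for i
    using cap_split_all[OF _ k, of i] that k by (simp add: low.zero)
  have ev: "even k"
    using k by presburger
  show ?case
  proof (cases m)
    case 0
    show ?thesis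
    proof (cases "even i")
      case True
      then show ?thesis
        using capev[of "i div 2"] less.prems 0 by auto
    next
      case False
      then obtain i' where i': "i = Suc (2 * i')"
        by (metis oddE add.commute plus_1_eq_Suc)
      then have "Suc i' < n"
        using less.prems k by (auto simp: 0)
      then show ?thesis
        using cap_odd_split_all[of i' n k] k i' 0 by simp
    qed
  next
    case (Suc m1)
    define j where "j = Suc (i + m1)"
    have j: "j \<le> k"
      using less.prems Suc by (simp add: j_def)
    show ?thesis
    proof (cases "even j")
      case True
      then have "lad (Suc (Suc k)) j * split_all n = sc \<delta> (split_all n)"
        using lads[of "j div 2"] j k by simp
      then have "zigzag k i m * split_all n = sc \<delta> (zigzag k i m1 * split_all n)"
        by (simp add: Suc j_def mult.assoc)
      then show ?thesis
        using less.IH[of m1 i] less.prems Suc by (simp add: low_sc)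
    next
      case odd_j: False
      show ?thesis
      proof (cases "even i")
        case True
        let ?W = "chain (Suc (Suc k)) (Suc (Suc i)) m1"
        have i: "i < k" "Suc i + m1 \<le> k"
          using less.prems Suc by auto
        \<comment> \<open>\<open>i\<close> is even. After \<open>cap_lad_next2\<close> the ladder at
          \<open>i\<close> is disjoint from \<open>?W\<close>, sinks to the bottom and becomes
          \<open>\<delta>\<close>.\<close>
        have W: "lad (Suc (Suc k)) i * ?W = ?W * lad (Suc (Suc k)) i"
          using i by (intro lad_chain) auto
        have lS: "lad (Suc (Suc k)) i * split_all n = sc \<delta> (split_all n)"
          using lads[of "i div 2"] True i k by auto
        have "zigzag k i m * split_all n = cap k i * lad (Suc (Suc k)) (Suc i) * ?W * split_all n"
          using zigzag_chain[of i m k] less.prems Suc by (simp add: mult.assoc)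
        also have "\<dots> = cap k (Suc i) * (lad (Suc (Suc k)) i * ?W) * split_all n + cap k (Suc i) * ?W * split_all n - cap k i * ?W * split_all n"
          using i by (simp add: cap_lad_next2 distrib_right left_diff_distrib mult.assoc)
        also have "cap k (Suc i) * (lad (Suc (Suc k)) i * ?W) * split_all n = sc \<delta> (zigzag k (Suc i) m1 * split_all n)"
          unfolding W using i lS zigzag_chain[of "Suc i" m1 k] by (simp add: mult.assoc)
        also have "cap k (Suc i) * ?W * split_all n = zigzag k (Suc i) m1 * split_all n"
          using i zigzag_chain[of "Suc i" m1 k] by simp
        also have "cap k i * ?W * split_all n = chain k i m1 * (cap k i * split_all n)"
          using cap_chain[of i i m1 k] i by (simp add: mult.assoc)
        finally show ?thesis
          using less.IH[of m1 "Suc i"] i Suc capev[of "i div 2"] True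
          by (simp add: low_diff low_add low_sc low_left)
      next
        case False
        \<comment> \<open>\<open>i\<close> and \<open>j = i + m\<close> are both odd, so the zigzag
          contains at least two ladders.\<close>
        then obtain m2 where m2: "m1 = Suc m2"
          using odd_j by (cases m1) (auto simp: j_def)
        let ?W = "chain (Suc (Suc k)) (Suc (Suc (Suc i))) m2"
        let ?l = "lad (Suc (Suc k)) (Suc i)"
        have i: "Suc i < k" "Suc (Suc i) + m2 \<le> k"
          using less.prems Suc m2 by auto
        have W: "?l * ?W = ?W * ?l"
          using i by (intro lad_chain) auto
        have lS: "?l * split_all n = sc \<delta> (split_all n)"
          using lads[of "Suc i div 2"] False i k by auto
        have WS: "?l * (?W * split_all n) = sc \<delta> (?W * split_all n)"
          using mult_assoc_rule[OF W] lS by (simp add: mult.assoc)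
        \<comment> \<open>The factor \<open>\<delta>\<close> pays for a second copy of the ladder at
          the even position \<open>Suc i\<close>. It commutes up through \<open>?W\<close>, and the
          triple of ladders so formed can be rewritten by \<open>lad_lad_lad2\<close>.\<close>
        have "sc \<delta> (zigzag k i m * split_all n) = cap k i * ?l * lad (Suc (Suc k)) (Suc (Suc i)) * (?l * (?W * split_all n))"
          unfolding WS using zigzag_chain[of i m k] less.prems Suc m2 by (simp add: mult.assoc)
        also have "\<dots> = cap k i * (?l * lad (Suc (Suc k)) (Suc (Suc i)) * ?l) * (?W * split_all n)"
          by (simp add: mult.assoc)
        also have "\<dots> = cap k i * ?l * cup k (Suc (Suc i)) * (cap k (Suc (Suc i)) * (?l * (?W * split_all n)))
            - sc \<delta> (cap k i * (?l * (?W * split_all n)))"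
          unfolding lad_lad_lad2[OF i(1)] by (simp add: right_diff_distrib left_diff_distrib mult.assoc)
        also have "cap k (Suc (Suc i)) * (?l * (?W * split_all n)) = sc \<delta> (zigzag k (Suc (Suc i)) m2 * split_all n)"
          unfolding WS using i zigzag_chain[of "Suc (Suc i)" m2 k] by (simp add: mult.assoc)
        also have "cap k i * (?l * (?W * split_all n)) = sc \<delta> (chain k (Suc i) m2 * (zigzag k i 0 * split_all n))"
          unfolding WS using cap_chain[of i "Suc i" m2 k] i by (simp add: mult.assoc[symmetric])
        finally have "low n (sc \<delta> (zigzag k i m * split_all n))"
          using less.IH[of m2 "Suc (Suc i)"] less.IH[of 0 i] i Suc m2
          by (simp add: low_diff low_sc low_left del: zigzag.simps)
        then show ?thesis
          by (simp add: low_sc_iff)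
      qed
    qed
  qed
qed

lemma low_zz_span_split_all:
  assumes "2 * n = Suc (Suc k)" "zz_span k k x"
  shows "low n (x * split_all n)"
  using assms(2)
  by (induction rule: zz_span.induct)
     (auto simp: mult.assoc distrib_right intro: low.zero low_add low_left low_zigzag_split_all[OF assms(1)])

subsection \<open>Morphisms out of a word of double strands\<close>

fun cups :: "nat \<Rightarrow> nat \<Rightarrow> hom" where
  "cups n 0 = split_all n"
| "cups n (Suc k) = cup (2 * n + 2 * k) (2 * n + 2 * k) * cups n k"

text \<open>For \<open>w < 2 * n\<close> only the first alternative is possible: a morphism that
  loses strands is lower.\<close>

definition cups_form :: "nat \<Rightarrow> nat \<Rightarrow> hom \<Rightarrow> bool" where
  "cups_form n w x \<longleftrightarrow> low n x \<or> (\<exists>k y l. w = 2 * n + 2 * k \<and> lad_alg w y \<and> low n l \<and> x = y * cups n k + l)"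

lemma cups_form_low: "low n x \<Longrightarrow> cups_form n w x"
  by (simp add: cups_form_def)

lemma cups_form_I: "w = 2 * n + 2 * k \<Longrightarrow> lad_alg w y \<Longrightarrow> low n l \<Longrightarrow> cups_form n w (y * cups n k + l)"
  by (auto simp: cups_form_def)

lemma cups_form_add: "cups_form n w x \<Longrightarrow> cups_form n w y \<Longrightarrow> cups_form n w (x + y)"
proof -
  have 1: "cups_form n w (x + l)" if "cups_form n w x" "low n l" for x l
    using that unfolding cups_form_def by (metis add.assoc low_add)
  have 2: "cups_form n w (y * cups n k + l + (y' * cups n k + l'))"
    if "w = 2 * n + 2 * k" "lad_alg w y" "low n l" "lad_alg w y'" "low n l'" for y k l y' l'
    using cups_form_I[of w n k "y + y'" "l + l'"] that by (simp add: lad_alg.add low_add distrib_right add_ac)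
  show "cups_form n w x \<Longrightarrow> cups_form n w y \<Longrightarrow> ?thesis"
    using 1[of x y] 1[of y x] 2 unfolding cups_form_def[of n w x] cups_form_def[of n w y]
    by (auto simp: add.commute)
qed

lemma cups_form_sc: "cups_form n w x \<Longrightarrow> cups_form n w (sc c x)"
  unfolding cups_form_def
proof (elim disjE exE conjE)
  fix k y l
  assume *: "w = 2 * n + 2 * k" "lad_alg w y" "low n l" "x = y * cups n k + l"
  have "sc c x = sc c y * cups n k + sc c l"
    by (simp add: * sc_add)
  then show "low n (sc c x) \<or> (\<exists>k y l. w = 2 * n + 2 * k \<and> lad_alg w y \<and> low n l \<and> sc c x = y * cups n k + l)"
    using * lad_alg.sc low_sc by blast
qed (use low_sc in blast)

lemma cups_form_lad: "cups_form n w x \<Longrightarrow> Suc (Suc i) \<le> w \<Longrightarrow> cups_form n w (lad w i * x)"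
proof -
  assume i: "Suc (Suc i) \<le> w"
  have "cups_form n w (lad w i * (y * cups n k + l))" if "w = 2 * n + 2 * k" "lad_alg w y" "low n l" for k y l
    using cups_form_I[OF that(1) lad_alg.lad[OF that(2) i] low_left[OF that(3)]] by (simp add: distrib_left mult.assoc)
  then show "cups_form n w x \<Longrightarrow> ?thesis"
    by (auto simp: cups_form_def[of n w x] intro: cups_form_low low_left)
qed

lemma cups_form_cup: "cups_form n w x \<Longrightarrow> i \<le> w \<Longrightarrow> cups_form n (Suc (Suc w)) (cup w i * x)"
proof -
  assume i: "i \<le> w"
  obtain z where z: "lad_alg (Suc (Suc w)) z" "cup w i = z * cup w w"
    using cup_last[OF i] by blast
  have "cups_form n (Suc (Suc w)) (cup w i * (y * cups n k + l))" if "w = 2 * n + 2 * k" "lad_alg w y" "low n l" for k y l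
  proof -
    have "cup w i * (y * cups n k) = z * box [] y (ones 2) * cups n (Suc k)"
      using that z mult_assoc_rule[OF cup_last_mult[OF that(2)]] by (simp add: mult.assoc)
    then show ?thesis
      using cups_form_I[of "Suc (Suc w)" n "Suc k" "z * box [] y (ones 2)" "cup w i * l"] that z
      by (simp add: distrib_left lad_alg_mult lad_alg_pad low_left)
  qed
  then show "cups_form n w x \<Longrightarrow> ?thesis"
    by (auto simp: cups_form_def[of n w x] intro: cups_form_low low_left)
qed

text \<open>Without cups the cap reaches \<open>split_all n\<close> and the result is lower.
  Otherwise the cap, the algebra element and the last cup combine to an element of the algebra on
  two strands fewer.\<close>

lemma cups_form_cap: "cups_form n (Suc (Suc w)) x \<Longrightarrow> i \<le> w \<Longrightarrow> cups_form n w (cap w i * x)"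
proof -
  assume i: "i \<le> w"
  have "cups_form n w (cap w i * (y * cups n k + l))"
    if *: "Suc (Suc w) = 2 * n + 2 * k" "lad_alg (Suc (Suc w)) y" "low n l" for k y l
  proof (cases k)
    case 0
    then have "low n (cap w i * y * split_all n)"
      using * i by (intro low_zz_span_split_all[of n w] zz_span_cap_lad_alg) auto
    then show ?thesis
      using 0 * by (auto simp: distrib_left mult.assoc intro!: cups_form_low low_add low_left)
  next
    case (Suc k')
    then have w: "w = 2 * n + 2 * k'"
      using * by simp
    have "lad_alg w (cap w i * y * cup w w)"
      using * i by (intro zz_span_cup zz_span_cap_lad_alg) auto
    from cups_form_I[OF w this low_left[OF *(3)], of "cap w i"] show ?thesis
      using w Suc by (simp add: distrib_left mult.assoc)
  qed
  then show "cups_form n (Suc (Suc w)) x \<Longrightarrow> ?thesis"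
    by (auto simp: cups_form_def[of n "Suc (Suc w)" x] intro: cups_form_low low_left)
qed

lemma cups_form_ladder_web: "ladder_web (2 * n) b f \<Longrightarrow> cups_form n b (f * split_all n)"
proof (induction rule: ladder_web.induct)
  case one
  then show ?case
    using cups_form_I[of "2 * n" n 0 "one (2 * n)" 0] by (simp add: lad_alg.one low.zero)
next
  case (lad b x i)
  then show ?case
    using cups_form_lad[of n b "x * split_all n" i] by (simp add: mult.assoc)
next
  case (cup b x i)
  then show ?case
    using cups_form_cup[of n b "x * split_all n" i] by (simp add: mult.assoc)
next
  case (cap b x i)
  then show ?case
    using cups_form_cap[of n b "x * split_all n" i] by (simp add: mult.assoc)
qed (auto simp: distrib_right intro: cups_form_add cups_form_sc cups_form_low low.zero)

lemma splits_hom_decompose: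
  assumes "f \<in> Hm (doubles n) (doubles n)"
  shows "\<exists>y l. lad_alg (2 * n) y \<and> low n l \<and> split_all n * f = y * split_all n + l"
proof -
  have "ladder_web (2 * n) (2 * n) (split_all n * f * merge_all n)"
    using good_Hm[OF assms] by (simp add: good_def)
  then have "cups_form n (2 * n) (split_all n * f * (merge_all n * split_all n))"
    using cups_form_ladder_web[of n "2 * n" "split_all n * f * merge_all n"] by (simp add: mult.assoc)
  then have "cups_form n (2 * n) (sc (\<delta> ^ n) (split_all n * f))"
    using idn_mult(2)[OF assms] by (simp add: merges_splits mult.assoc)
  from cups_form_sc[OF this, of "inverse (\<delta> ^ n)"] have "cups_form n (2 * n) (split_all n * f)"
    by simp
  then show ?thesis
    unfolding cups_form_def
  proof (elim disjE exE conjE)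
    assume "low n (split_all n * f)"
    then show ?thesis
      by (intro exI[of _ 0] exI[of _ "split_all n * f"]) (simp add: lad_alg.zero)
  qed auto
qed

subsection \<open>The Temperley-Lieb quotient\<close>

text \<open>The elements that become lower on \<open>2\<^sup>n\<close> even after composition with the algebra; they form a
  two-sided ideal of it.\<close>

definition lower :: "nat \<Rightarrow> hom \<Rightarrow> bool" where
  "lower n x \<longleftrightarrow> (\<forall>b. lad_alg (2 * n) b \<longrightarrow> low n (x * b * split_all n))"

lemma lower_add: "lower n x \<Longrightarrow> lower n y \<Longrightarrow> lower n (x + y)"
  and lower_zero: "lower n 0"
  and lower_sc: "lower n x \<Longrightarrow> lower n (sc c x)"
  and lower_left: "lower n x \<Longrightarrow> lower n (A * x)"
  by (auto simp: lower_def distrib_right low_add low.zero low_sc low_left mult.assoc)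

lemma lower_right: "lower n x \<Longrightarrow> lad_alg (2 * n) b \<Longrightarrow> lower n (x * b)"
  unfolding lower_def using lad_alg_mult by (metis mult.assoc)

lemma lower_trans: "lower n (x - y) \<Longrightarrow> lower n (y - z) \<Longrightarrow> lower n (x - z)"
  using lower_add[of n "x - y" "y - z"] by simp

lemma lower_cap: "2 * n = Suc (Suc k) \<Longrightarrow> i \<le> k \<Longrightarrow> lower n (cap k i)"
  unfolding lower_def using low_zz_span_split_all[OF _ zz_span_cap_lad_alg] by simp

text \<open>On \<open>2 * n\<close> strands every cap is lower, so the cup-cap term of
  \<open>lad_lad_lad2'\<close> drops out and a Temperley-Lieb relation with scalar
  \<open>- \<delta>\<close> is left.\<close>

lemma lower_braid:
  assumes "Suc (Suc (Suc i)) \<le> 2 * n"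
  shows "lower n (lad (2 * n) (Suc i) * lad (2 * n) i * lad (2 * n) (Suc i) + sc \<delta> (lad (2 * n) (Suc i)))"
proof -
  obtain k where k: "2 * n = Suc (Suc k)"
    using assms Suc_Suc_le_ex by blast
  have "lower n (lad (2 * n) (Suc i) * cup k i * (cap k i * lad (2 * n) (Suc i)))"
    using assms k by (intro lower_left lower_right lower_cap lad_alg_lad) auto
  then show ?thesis
    using lad_lad_lad2'[of i k] assms k by (simp add: mult.assoc)
qed

text \<open>\<open>k\<close> counts strands, not ladders. Hence \<open>lads n (Suc t)\<close>
  contains all ladders before the one at \<open>t\<close>, while those in \<open>lads n t\<close>
  are disjoint from it and commute with it.\<close>

inductive lads :: "nat \<Rightarrow> nat \<Rightarrow> hom \<Rightarrow> bool" for n k :: nat where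
  one: "lads n k (one (2 * n))"
| lad: "lads n k x \<Longrightarrow> Suc (Suc i) \<le> k \<Longrightarrow> lads n k (lad (2 * n) i * x)"
| add: "lads n k x \<Longrightarrow> lads n k y \<Longrightarrow> lads n k (x + y)"
| sc: "lads n k x \<Longrightarrow> lads n k (sc c x)"
| zero: "lads n k 0"

lemma lads_lad_alg: "lads n k x \<Longrightarrow> k \<le> 2 * n \<Longrightarrow> lad_alg (2 * n) x"
  by (induction rule: lads.induct) (auto intro: lad_alg.intros)

lemma lads_Hm: "lads n k x \<Longrightarrow> k \<le> 2 * n \<Longrightarrow> x \<in> Hm (ones (2 * n)) (ones (2 * n))"
  using lads_lad_alg lad_alg_Hm by blast

lemma lads_mult: "lads n k x \<Longrightarrow> lads n k y \<Longrightarrow> k \<le> 2 * n \<Longrightarrow> lads n k (x * y)"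
  by (induction rule: lads.induct)
     (auto simp: mult.assoc distrib_right idn_mult(1)[OF lads_Hm] intro: lads.intros)

lemma lads_mono: "lads n k x \<Longrightarrow> k \<le> k' \<Longrightarrow> lads n k' x"
  by (induction rule: lads.induct) (auto intro: lads.intros)

lemma lads_lad: "Suc (Suc i) \<le> k \<Longrightarrow> k \<le> 2 * n \<Longrightarrow> lads n k (lad (2 * n) i)"
  using lads.lad[OF lads.one, of i k n] idn_mult(2)[OF lad_Hm2, of i "2 * n"] by simp

lemma lads_commute: "lads n k a \<Longrightarrow> k \<le> t \<Longrightarrow> Suc (Suc t) \<le> 2 * n \<Longrightarrow> lad (2 * n) t * a = a * lad (2 * n) t"
proof (induction rule: lads.induct)
  case (lad x i)
  then show ?case
    using mult_assoc_rule[OF lad_lad2[of i t "2 * n", symmetric]] by (simp add: mult.assoc)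
qed (auto simp: idn_mult[OF lad_Hm2] distrib_left distrib_right)

lemma lads_scalar: "lads n k a \<Longrightarrow> k \<le> 1 \<Longrightarrow> \<exists>c. a = sc c (one (2 * n))"
proof (induction rule: lads.induct)
  case one
  show ?case by (rule exI[of _ 1]) simp
next
  case (add x y)
  then show ?case by (metis sc_add_left)
next
  case (sc x c)
  then show ?case by (metis sc_sc)
next
  case zero
  show ?case by (rule exI[of _ 0]) simp
qed auto

text \<open>Jones' normal form: modulo \<open>lower\<close>, the ladders satisfy the Temperley-Lieb relations up to
  scalars, so the last one is needed at most once.\<close>

inductive jones :: "nat \<Rightarrow> nat \<Rightarrow> hom \<Rightarrow> bool" for n t :: nat where
  low: "lads n (Suc t) a \<Longrightarrow> jones n t a"
| top: "lads n (Suc t) a \<Longrightarrow> lads n (Suc t) b \<Longrightarrow> jones n t (a * lad (2 * n) t * b)"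
| add: "jones n t x \<Longrightarrow> jones n t y \<Longrightarrow> jones n t (x + y)"

lemma jones_left: "jones n t x \<Longrightarrow> lads n (Suc t) a \<Longrightarrow> Suc t \<le> 2 * n \<Longrightarrow> jones n t (a * x)"
proof (induction rule: jones.induct)
  case (top b c)
  then show ?case
    using jones.top[OF lads_mult[of n "Suc t" a b] top(2)] by (simp add: mult.assoc)
qed (auto simp: distrib_left intro: jones.intros lads_mult)

lemma jones_zero: "jones n t 0"
  by (rule jones.low[OF lads.zero])

lemma jones_sc: "jones n t x \<Longrightarrow> jones n t (sc c x)"
proof (induction rule: jones.induct)
  case (top a b)
  then show ?case
    using jones.top[OF lads.sc[OF top(1), of c] top(2)] by simp
qed (auto simp: sc_add intro: jones.intros lads.sc)

lemma jones_top_left: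
  assumes t: "Suc (Suc t) \<le> 2 * n"
    and sand: "\<And>a. lads n (Suc t) a \<Longrightarrow> \<exists>z. lads n t z \<and>
       lower n (lad (2 * n) t * a * lad (2 * n) t - z * lad (2 * n) t)"
    and "jones n t y"
  shows "\<exists>y'. jones n t y' \<and> lower n (lad (2 * n) t * y - y')"
  using assms(3)
proof (induction rule: jones.induct)
  case (low a)
  then show ?case
    using jones.top[OF lads.one low] idn_mult(1)[OF lad_Hm2[OF t]]
    by (intro exI[of _ "lad (2 * n) t * a"]) (simp add: lower_zero)
next
  case (top a b)
  obtain z where z: "lads n t z" "lower n (lad (2 * n) t * a * lad (2 * n) t - z * lad (2 * n) t)"
    using sand[OF top(1)] by blast
  have "lower n ((lad (2 * n) t * a * lad (2 * n) t - z * lad (2 * n) t) * b)"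
    using z top t by (intro lower_right lads_lad_alg[of n "Suc t" b]) auto
  then show ?case
    using jones.top[OF lads_mono[OF z(1)] top(2)]
    by (intro exI[of _ "z * lad (2 * n) t * b"]) (simp add: left_diff_distrib mult.assoc)
next
  case (add x y)
  then obtain x' y' where "jones n t x'" "jones n t y'" "lower n (lad (2 * n) t * x - x')" "lower n (lad (2 * n) t * y - y')"
    by blast
  then show ?case
    using lower_add[of n "lad (2 * n) t * x - x'" "lad (2 * n) t * y - y'"]
    by (intro exI[of _ "x' + y'"]) (auto simp: distrib_left algebra_simps intro: jones.add)
qed

text \<open>The normal form at \<open>t\<close> uses the sandwich property at \<open>t\<close>, and
  the sandwich property at \<open>Suc t\<close> uses the normal form at \<open>t\<close>; keeping
  the former as a hypothesis lets \<open>Jones\<close> run a single induction.\<close>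

lemma jones_exists:
  assumes t: "Suc (Suc t) \<le> 2 * n"
    and sand: "\<And>a. lads n (Suc t) a \<Longrightarrow> \<exists>z. lads n t z \<and>
       lower n (lad (2 * n) t * a * lad (2 * n) t - z * lad (2 * n) t)"
    and "lads n (Suc (Suc t)) x"
  shows "\<exists>y. jones n t y \<and> lower n (x - y)"
  using assms(3)
proof (induction rule: lads.induct)
  case one
  then show ?case
    by (intro exI[of _ "one (2 * n)"]) (simp add: jones.low lads.one lower_zero)
next
  case (lad x i)
  then obtain y where y: "jones n t y" "lower n (x - y)"
    by blast
  have d: "lower n (lad (2 * n) i * x - lad (2 * n) i * y)"
    using lower_left[OF y(2), of "lad (2 * n) i"] by (simp add: right_diff_distrib)
  show ?case
  proof (cases "i = t")
    case True
    then show ?thesis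
      using jones_top_left[OF t sand y(1)] lower_trans[OF d] by auto
  next
    case False
    then have "jones n t (lad (2 * n) i * y)"
      using lad t by (intro jones_left[OF y(1)] lads_lad) auto
    then show ?thesis
      using d by blast
  qed
next
  case (add x y)
  then obtain x' y' where "jones n t x'" "jones n t y'" "lower n (x - x')" "lower n (y - y')"
    by blast
  then show ?case
    using lower_add[of n "x - x'" "y - y'"]
    by (intro exI[of _ "x' + y'"]) (auto simp: algebra_simps intro: jones.add)
next
  case (sc x c)
  then obtain x' where "jones n t x'" "lower n (x - x')"
    by blast
  then show ?case
    using lower_sc[of n "x - x'" c] by (intro exI[of _ "sc c x'"]) (auto simp: sc_diff intro: jones_sc)
next
  case zero
  then show ?case
    using jones_zero lower_zero by (intro exI[of _ 0]) simp
qed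

lemma sandwich_0:
  assumes t: "Suc (Suc 0) \<le> 2 * n" and a: "lads n (Suc 0) a"
  shows "\<exists>z. lads n 0 z \<and> lower n (lad (2 * n) 0 * a * lad (2 * n) 0 - z * lad (2 * n) 0)"
proof -
  obtain c where "a = sc c (one (2 * n))"
    using lads_scalar[OF a] by auto
  then have "lad (2 * n) 0 * a * lad (2 * n) 0 = sc (c * \<delta>) (one (2 * n)) * lad (2 * n) 0"
    using idn_mult[OF lad_Hm2[OF t]] lad_sq2[OF t] by simp
  then show ?thesis
    using lads.sc[OF lads.one, of n 0 "c * \<delta>"] lower_zero by (metis diff_self)
qed

text \<open>The outer ladder commutes with \<open>a\<close> and \<open>b\<close>, which live on the
  strands before it, so only three adjacent ladders meet and \<open>lower_braid\<close>
  applies.\<close>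

lemma sandwich_Suc:
  assumes t: "Suc (Suc (Suc t)) \<le> 2 * n" and "jones n t y"
  shows "\<exists>z. lads n (Suc t) z \<and> lower n (lad (2 * n) (Suc t) * y * lad (2 * n) (Suc t) - z * lad (2 * n) (Suc t))"
  using assms(2)
proof (induction rule: jones.induct)
  case (low a)
  let ?L = "lad (2 * n) (Suc t)"
  have "?L * a * ?L = sc \<delta> a * ?L"
    using lads_commute[OF low, of "Suc t"] lad_sq2[OF t] t by (simp add: mult.assoc)
  then show ?case
    using lads.sc[OF low, of \<delta>] lower_zero by (metis diff_self)
next
  case (top a b)
  let ?L = "lad (2 * n) (Suc t)" and ?l = "lad (2 * n) t"
  have ca: "?L * a = a * ?L" and cb: "?L * b = b * ?L"
    using top t by (auto intro: lads_commute)
  have 1: "lower n (a * (?L * ?l * ?L + sc \<delta> ?L) * b)"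
    using top t by (intro lower_right lower_left lower_braid lads_lad_alg[of n "Suc t" b]) auto
  have 2: "?L * (a * ?l * b) * ?L = a * (?L * ?l * ?L) * b"
    using ca cb by (metis mult.assoc)
  have 3: "sc (- \<delta>) (a * b) * ?L = - (a * sc \<delta> ?L * b)"
    using cb by (simp add: sc_uminus_left mult.assoc)
  have "?L * (a * ?l * b) * ?L - sc (- \<delta>) (a * b) * ?L = a * (?L * ?l * ?L + sc \<delta> ?L) * b"
    unfolding 2 3 by (simp add: distrib_left distrib_right)
  with 1 have "lower n (?L * (a * ?l * b) * ?L - sc (- \<delta>) (a * b) * ?L)"
    by simp
  then show ?case
    using lads.sc[OF lads_mult[OF top], of "- \<delta>"] t by (intro exI[of _ "sc (- \<delta>) (a * b)"]) auto
next
  case (add x y)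
  let ?L = "lad (2 * n) (Suc t)"
  obtain x' y' where *: "lads n (Suc t) x'" "lads n (Suc t) y'" "lower n (?L * x * ?L - x' * ?L)" "lower n (?L * y * ?L - y' * ?L)"
    using add by blast
  have "(?L * x * ?L - x' * ?L) + (?L * y * ?L - y' * ?L) = ?L * (x + y) * ?L - (x' + y') * ?L"
    by (simp add: algebra_simps)
  then show ?case
    using lower_add[OF *(3,4)] lads.add[OF *(1,2)] by auto
qed

lemma Jones:
  "Suc (Suc t) \<le> 2 * n \<Longrightarrow> lads n (Suc t) a \<Longrightarrow> \<exists>z. lads n t z \<and>
       lower n (lad (2 * n) t * a * lad (2 * n) t - z * lad (2 * n) t)"
proof (induction t arbitrary: a)
  case 0
  then show ?case by (rule sandwich_0)
next
  case (Suc t)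
  let ?L = "lad (2 * n) (Suc t)"
  obtain y where y: "jones n t y" "lower n (a - y)"
    using jones_exists[of t n a] Suc by auto
  obtain z where z: "lads n (Suc t) z" "lower n (?L * y * ?L - z * ?L)"
    using sandwich_Suc[OF Suc.prems(1) y(1)] by blast
  have "lower n (?L * (a - y) * ?L)"
    using y Suc.prems by (intro lower_right lower_left lad_alg_lad) auto
  then have "lower n (?L * a * ?L - ?L * y * ?L)"
    by (simp add: right_diff_distrib left_diff_distrib)
  then show ?case
    using lower_trans z by blast
qed

text \<open>Extends \<open>Jones\<close> to elements that contain the ladder at \<open>t\<close>
  themselves, as needed in \<open>evens_sandwich\<close>.\<close>

lemma sandwich_jones:
  assumes t: "Suc (Suc t) \<le> 2 * n" and "jones n t y"
  shows "\<exists>z. lads n t z \<and> lower n (lad (2 * n) t * y * lad (2 * n) t - z * lad (2 * n) t)"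
  using assms(2)
proof (induction rule: jones.induct)
  case (low a)
  then show ?case using Jones[OF t] by blast
next
  case (top a b)
  let ?l = "lad (2 * n) t"
  obtain z1 where z1: "lads n t z1" "lower n (?l * a * ?l - z1 * ?l)"
    using Jones[OF t top(1)] by blast
  obtain z2 where z2: "lads n t z2" "lower n (?l * b * ?l - z2 * ?l)"
    using Jones[OF t top(2)] by blast
  have "lower n ((?l * a * ?l - z1 * ?l) * (b * ?l))"
    using top t z1 by (intro lower_right lad_alg_mult lad_alg_lad lads_lad_alg[of n "Suc t" b]) auto
  moreover have "lower n (z1 * (?l * b * ?l - z2 * ?l))"
    using z2 by (rule_tac lower_left)
  ultimately have "lower n ((?l * a * ?l - z1 * ?l) * (b * ?l) + z1 * (?l * b * ?l - z2 * ?l))"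
    by (rule lower_add)
  also have "(?l * a * ?l - z1 * ?l) * (b * ?l) + z1 * (?l * b * ?l - z2 * ?l) =
      ?l * (a * ?l * b) * ?l - (z1 * z2) * ?l"
    by (simp add: left_diff_distrib right_diff_distrib mult.assoc)
  finally show ?case
    using lads_mult[OF z1(1) z2(1)] t by (intro exI[of _ "z1 * z2"]) auto
next
  case (add x y)
  let ?L = "lad (2 * n) t"
  obtain x' y' where *: "lads n t x'" "lads n t y'" "lower n (?L * x * ?L - x' * ?L)" "lower n (?L * y * ?L - y' * ?L)"
    using add by blast
  have "(?L * x * ?L - x' * ?L) + (?L * y * ?L - y' * ?L) = ?L * (x + y) * ?L - (x' + y') * ?L"
    by (simp add: algebra_simps)
  then show ?case
    using lower_add[OF *(3,4)] lads.add[OF *(1,2)] by auto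
qed

text \<open>Up to a power of \<open>\<delta>\<close>, the idempotent that pairs the single strands
  into opened double strands.\<close>

fun evens :: "nat \<Rightarrow> nat \<Rightarrow> hom" where
  "evens n 0 = one (2 * n)"
| "evens n (Suc j) = evens n j * lad (2 * n) (2 * j)"

lemma lads_evens: "j \<le> n \<Longrightarrow> lads n (2 * j) (evens n j)"
proof (induction j)
  case (Suc j)
  then have "lads n (2 * Suc j) (evens n j)"
    using lads_mono[of n "2 * j" "evens n j"] by simp
  then show ?case
    using Suc.prems by (auto intro!: lads_mult lads_lad)
qed (auto intro: lads.one)

text \<open>Two strands are removed at a time: normal form and sandwich by the ladder at
  \<open>2 * j\<close> replace \<open>x\<close> by an element of \<open>lads n (2 * j)\<close>, free
  of the last two ladders, to which the induction hypothesis applies.\<close>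

lemma evens_sandwich:
  "j \<le> n \<Longrightarrow> lads n (2 * j) x \<Longrightarrow> \<exists>c. lower n (evens n j * x * evens n j - sc c (evens n j))"
proof (induction j arbitrary: x)
  case 0
  obtain c where "x = sc c (one (2 * n))"
    using lads_scalar[OF 0(2)] by auto
  then have "evens n 0 * x * evens n 0 = sc c (evens n 0)"
    by simp
  then show ?case
    using lower_zero by (metis diff_self)
next
  case (Suc j)
  let ?l = "lad (2 * n) (2 * j)" and ?e = "evens n j"
  have t: "Suc (Suc (2 * j)) \<le> 2 * n"
    using Suc.prems by simp
  have e: "lads n (2 * j) ?e"
    using Suc.prems by (intro lads_evens) auto
  have c: "?l * ?e = ?e * ?l"
    using t by (intro lads_commute[OF e]) auto
  obtain y where y: "jones n (2 * j) y" "lower n (x - y)"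
    using jones_exists[OF t Jones[OF t], of x] Suc.prems by auto
  obtain z where z: "lads n (2 * j) z" "lower n (?l * y * ?l - z * ?l)"
    using sandwich_jones[OF t y(1)] by blast
  obtain d where d: "lower n (?e * z * ?e - sc d ?e)"
    using Suc.IH[OF _ z(1)] Suc.prems by auto
  have "lower n (?e * ?l * (x - y) * (?e * ?l))"
    using y t lads_lad_alg[OF e] Suc.prems by (intro lower_right lower_left lad_alg_mult lad_alg_lad) auto
  moreover have "lower n (?e * (?l * y * ?l - z * ?l) * ?e)"
    using z lads_lad_alg[OF e] Suc.prems by (intro lower_right lower_left) auto
  moreover have "lower n ((?e * z * ?e - sc d ?e) * ?l)"
    using d t by (intro lower_right lad_alg_lad) auto
  ultimately have N: "lower n (?e * ?l * (x - y) * (?e * ?l) + ?e * (?l * y * ?l - z * ?l) * ?e + (?e * z * ?e - sc d ?e) * ?l)"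
    by (intro lower_add)
  have "?e * ?l * y * (?e * ?l) = ?e * (?l * y * ?l) * ?e" "?e * (z * ?l) * ?e = ?e * z * ?e * ?l"
    using c by (metis mult.assoc)+
  then have "?e * ?l * (x - y) * (?e * ?l) + ?e * (?l * y * ?l - z * ?l) * ?e + (?e * z * ?e - sc d ?e) * ?l =
      evens n (Suc j) * x * evens n (Suc j) - sc d (evens n (Suc j))"
    by (simp add: left_diff_distrib right_diff_distrib)
  with N show ?case
    by (intro exI[of _ d]) simp
qed

lemma evens_split_all: "j \<le> n \<Longrightarrow> evens n j * split_all n = sc (\<delta> ^ j) (split_all n)"
proof (induction j)
  case 0
  then show ?case
    using idn_mult(1)[OF splits_Hm[of "doubles n"]] by simp
next
  case (Suc j)
  then show ?case
    using lad_split_all[of j n] by (simp add: mult.assoc mult.commute)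
qed

lemma merge_all_evens: "j \<le> n \<Longrightarrow> merge_all n * evens n j = sc (\<delta> ^ j) (merge_all n)"
proof (induction j)
  case 0
  then show ?case
    using idn_mult(2)[OF merges_Hm[of "doubles n"]] by simp
next
  case (Suc j)
  then have "merge_all n * evens n j = sc (\<delta> ^ j) (merge_all n)"
    by simp
  then have "merge_all n * evens n (Suc j) = sc (\<delta> ^ j) (merge_all n * lad (2 * n) (2 * j))"
    by (metis evens.simps(2) mult.assoc mult_sc(1))
  also have "\<dots> = sc (\<delta> ^ Suc j) (merge_all n)"
    using Suc.prems merge_all_lad[of j n] by (simp add: mult.commute)
  finally show ?case .
qed

text \<open>A cap with any algebra element between it and \<open>split_all n\<close> is lower, so
  the cup-cap generators can be discarded.\<close>

lemma lad_alg_split_all_ladders: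
  assumes "lad_alg (2 * n) y"
  shows "\<exists>y'. lads n (2 * n) y' \<and> low n (y * split_all n - y' * split_all n)"
  using assms
proof (induction "2 * n" y rule: lad_alg.induct)
  case one
  then show ?case
    by (intro exI[of _ "one (2 * n)"]) (simp add: lads.one low.zero)
next
  case (lad x i)
  then obtain y' where "lads n (2 * n) y'" "low n (x * split_all n - y' * split_all n)"
    by blast
  then show ?case
    using lads.lad[of n "2 * n" y' i] lad low_left[of n "x * split_all n - y' * split_all n" "lad (2 * n) i"]
    by (intro exI[of _ "lad (2 * n) i * y'"]) (simp add: right_diff_distrib mult.assoc)
next
  case (cupcap k x i)
  then have "low n (cup k i * (cap k i * x * split_all n))"
    using low_zz_span_split_all[of n k] zz_span_cap_lad_alg[of k x i] by (intro low_left[where A = "cup k i"]) auto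
  then show ?case
    by (intro exI[of _ 0]) (simp add: lads.zero mult.assoc)
next
  case (add x y)
  then obtain x' y' where "lads n (2 * n) x'" "low n (x * split_all n - x' * split_all n)"
     "lads n (2 * n) y'" "low n (y * split_all n - y' * split_all n)"
    by blast
  then show ?case
    using low_add[of n "x * split_all n - x' * split_all n" "y * split_all n - y' * split_all n"]
    by (intro exI[of _ "x' + y'"]) (auto simp: algebra_simps intro: lads.add)
next
  case (sc x c)
  then obtain x' where "lads n (2 * n) x'" "low n (x * split_all n - x' * split_all n)"
    by blast
  then show ?case
    using low_sc[of n "x * split_all n - x' * split_all n" c]
    by (intro exI[of _ "sc c x'"]) (auto simp: sc_diff intro: lads.sc)
next
  case zero
  then show ?case
    by (intro exI[of _ 0]) (simp add: lads.zero low.zero)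
qed

text \<open>\<open>merge_all n\<close> above and \<open>split_all n\<close> below turn each factor
  \<open>evens n n\<close> into \<open>\<delta> ^ n\<close>, so the scalar of
  \<open>evens_sandwich\<close> becomes a multiple of the identity. This replaces the
  multiplicity-one argument for the highest weight.\<close>

theorem endomorphism_scalar:
  assumes "f \<in> Hm (doubles n) (doubles n)"
  shows "\<exists>c l. low n l \<and> f = sc c (idn (doubles n)) + l"
proof -
  obtain y l where yl: "lad_alg (2 * n) y" "low n l" "split_all n * f = y * split_all n + l"
    using splits_hom_decompose[OF assms] by blast
  obtain x where x: "lads n (2 * n) x" "low n (y * split_all n - x * split_all n)"
    using lad_alg_split_all_ladders[OF yl(1)] by blast
  obtain c where c: "lower n (evens n n * x * evens n n - sc c (evens n n))"
    using evens_sandwich[of n n x] x by auto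
  define l' where "l' = merge_all n * ((evens n n * x * evens n n - sc c (evens n n)) * one (2 * n) * split_all n)"
  have "low n l'"
    using c by (auto simp: l'_def lower_def intro: low_left lad_alg.one)
  have "l' = (merge_all n * evens n n) * x * (evens n n * split_all n) - sc c ((merge_all n * evens n n) * split_all n)"
    using idn_mult(1)[OF splits_Hm[of "doubles n"]]
    by (simp add: l'_def left_diff_distrib right_diff_distrib mult.assoc)
  also have "\<dots> = sc (\<delta> ^ n * \<delta> ^ n) (merge_all n * x * split_all n) - sc (c * \<delta> ^ n * \<delta> ^ n) (idn (doubles n))"
    unfolding merge_all_evens[OF order_refl] evens_split_all[OF order_refl]
    by (simp add: merges_splits mult_ac)
  finally have MxS: "sc (\<delta> ^ n * \<delta> ^ n) (merge_all n * x * split_all n) = l' + sc (c * \<delta> ^ n * \<delta> ^ n) (idn (doubles n))"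
    by simp
  have "sc (\<delta> ^ n) f = merge_all n * (split_all n * f)"
    using idn_mult(1)[OF assms] by (simp add: mult.assoc[symmetric] merges_splits)
  also have "\<dots> = merge_all n * (y * split_all n - x * split_all n) + merge_all n * l + merge_all n * x * split_all n"
    unfolding yl(3) by (simp add: distrib_left right_diff_distrib mult.assoc)
  finally have f1: "sc (\<delta> ^ n) f = merge_all n * (y * split_all n - x * split_all n) + merge_all n * l + merge_all n * x * split_all n" .
  have "sc (\<delta> ^ n * \<delta> ^ n * \<delta> ^ n) f = sc (\<delta> ^ n * \<delta> ^ n) (sc (\<delta> ^ n) f)"
    by simp
  also have "\<dots> = sc (\<delta> ^ n * \<delta> ^ n) (merge_all n * (y * split_all n - x * split_all n) + merge_all n * l) +
      (l' + sc (c * \<delta> ^ n * \<delta> ^ n) (idn (doubles n)))"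
    unfolding f1 MxS[symmetric] by (rule sc_add)
  finally have "sc (\<delta> ^ n * \<delta> ^ n * \<delta> ^ n) f = sc (\<delta> ^ n * \<delta> ^ n) (merge_all n * (y * split_all n - x * split_all n) + merge_all n * l) +
      (l' + sc (c * \<delta> ^ n * \<delta> ^ n) (idn (doubles n)))" .
  moreover define m where "m = sc (\<delta> ^ n * \<delta> ^ n) (merge_all n * (y * split_all n - x * split_all n) + merge_all n * l) + l'"
  ultimately have f: "sc (\<delta> ^ n * \<delta> ^ n * \<delta> ^ n) f = sc (c * \<delta> ^ n * \<delta> ^ n) (idn (doubles n)) + m"
    by (simp only: add_ac)
  have "low n m"
    using x yl \<open>low n l'\<close> by (auto simp: m_def intro!: low_add low_sc low_left)
  define e where "e = inverse (\<delta> ^ n * \<delta> ^ n * \<delta> ^ n)"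
  have "\<delta> ^ n * \<delta> ^ n * \<delta> ^ n \<noteq> 0"
    by simp
  from sc_eq_iff[OF this, of f] f have "f = sc e (sc (c * \<delta> ^ n * \<delta> ^ n) (idn (doubles n)) + m)"
    unfolding e_def by blast
  also have "\<dots> = sc (e * (c * \<delta> ^ n * \<delta> ^ n)) (idn (doubles n)) + sc e m"
    by (simp add: sc_add mult.assoc)
  finally show ?thesis
    using low_sc[OF \<open>low n m\<close>] by blast
qed

subsection \<open>Local identities for double strands\<close>

text \<open>Each double strand beside the middle strip is opened and closed again, a bigon worth
  \<open>\<delta>\<close>. In this way identities between single-strand webs are carried back to
  double strands.\<close>

lemma sandwich:
  assumes "y \<in> Hm (ones (width w)) (ones (width w'))"
  shows "merges (u @ w' @ v) * box (ones (width u)) y (ones (width v)) * splits (u @ w @ v) =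
    sc (\<delta> ^ (count_list u Double + count_list v Double)) (box u (merges w' * y * splits w) v)"
proof -
  let ?R = "box (u @ w') (merges v) [] * box [] (merges u) (w' @ ones (width v))"
  have H: "merges w' * y * splits w \<in> Hm w w'"
    using assms by (intro Hm_mult[OF _ splits_Hm] Hm_mult[OF merges_Hm])
  have "merges (u @ w' @ v) * box (ones (width u)) y (ones (width v)) * splits (u @ w @ v) =
     ?R * (box (ones (width u)) (merges w' * y * splits w) (ones (width v)) * rest u w v)"
    unfolding merges_mid splits_mid by (simp add: box_mult mult.assoc)
  also have "\<dots> = (?R * rest u w' v) * box u (merges w' * y * splits w) v"
    unfolding rest_exchange[OF H] by (simp add: mult.assoc)
  also have "?R * rest u w' v = box (u @ w') (merges v) [] *
     (box [] (merges u * splits u) (w' @ ones (width v))) * box (u @ w') (splits v) []"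
    by (simp add: rest_def box_mult mult.assoc)
  also have "\<dots> = sc (\<delta> ^ count_list u Double) (box (u @ w') (merges v) [] * idn (u @ w' @ ones (width v)) * box (u @ w') (splits v) [])"
    by (simp add: merges_splits box_sc)
  also have "box (u @ w') (merges v) [] * idn (u @ w' @ ones (width v)) = box (u @ w') (merges v) []"
    by (rule idn_box_right[OF merges_Hm]) simp
  also have "sc (\<delta> ^ count_list u Double) (box (u @ w') (merges v) [] * box (u @ w') (splits v) []) =
      sc (\<delta> ^ (count_list u Double + count_list v Double)) (idn (u @ w' @ v))"
    unfolding box_comp[OF merges_splits] by (simp add: box_sc power_add)
  finally show ?thesis
    using idn_box_left[OF H, of "u @ w' @ v" u v] by simp
qed

lemma splits_merges_append:
  "splits (u @ v) * merges (u @ v) = box [] (splits u * merges u) (ones (width v)) *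
    box (ones (width u)) (splits v * merges v) []"
proof -
  have hat: "splits v * merges v \<in> Hm (ones (width v)) (ones (width v))"
    by (intro Hm_mult[OF _ merges_Hm] splits_Hm)
  have "splits (u @ v) * merges (u @ v) = box [] (splits u) (ones (width v)) *
      (box u (splits v * merges v) [] * box [] (merges u) (ones (width v)))"
    by (simp add: splits_append merges_append box_mult mult.assoc)
  also have "box u (splits v * merges v) [] * box [] (merges u) (ones (width v)) =
      box [] (merges u) (ones (width v)) * box (ones (width u)) (splits v * merges v) []"
    using exchange0[OF merges_Hm hat, of u "[]"] by simp
  finally show ?thesis
    by (simp add: box_mult mult.assoc)
qed

abbreviation "sp2 \<equiv> splits [Double, Double]"
abbreviation "mg2 \<equiv> merges [Double, Double]"
abbreviation "sp3 \<equiv> splits [Double, Double, Double]"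
abbreviation "mg3 \<equiv> merges [Double, Double, Double]"

lemma splits_single: "splits [Double] = split" "merges [Double] = merge"
  "splits [Single, Single] = one 2" "merges [Single, Single] = one 2"
  using idn_mult(2)[OF gen_typed(5)] idn_mult(1)[OF gen_typed(6)]
  by (simp_all add: numeral_2_eq_2 ones_Suc)

lemma lad_base: "split * merge = lad 2 0"
  by (simp add: lad_def)

lemma sp2_mg2: "sp2 * mg2 = lad 4 0 * lad 4 2"
  using splits_merges_append[of "[Double]" "[Double]"] box_lad[of 0 2 0 2] box_lad[of 0 2 2 0]
  by (simp add: splits_single lad_base eval_nat_numeral del: splits.simps merges.simps)

lemma sp3_mg3: "sp3 * mg3 = lad 6 0 * (lad 6 2 * lad 6 4)"
  using splits_merges_append[of "[Double]" "[Double, Double]"] box_lad[of 0 2 0 4]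
    box_lad[of 0 4 2 0] box_lad[of 2 4 2 0]
  by (simp add: splits_single lad_base sp2_mg2 box_mult eval_nat_numeral del: splits.simps merges.simps)

lemma hdown_eq: "hdown = cap 2 1 * sp2"
  using split_split idn_box_right[OF gen_typed(5), of "[Double, Double]" "[Double]" "[]"]
  by (simp add: hdown_def cap_def box_mult numeral_2_eq_2 ones_Suc mult.assoc)

lemma hup_eq: "hup = mg2 * cup 2 1"
  using merge_merge idn_box_left[OF gen_typed(6), of "[Double, Double]" "[Double]" "[]"]
  by (simp add: hup_def cup_def box_mult numeral_2_eq_2 ones_Suc mult.assoc[symmetric])

text \<open>A quarter turn of a ladder in either direction satisfies the same relation.\<close>

lemma ladder_rotation':
  "cap 2 0 * lad 4 1 * cup 2 2 = lad 2 0 + one 2 - cup 0 0 * cap 0 0"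
proof -
  have "cap 2 0 * lad 4 1 * cup 2 2 = cap 2 1 * (lad 4 0 * cup 2 2) + cap 2 1 * cup 2 2 - cap 2 0 * cup 2 2"
    using cap_lad_next[of 0 2] by (simp add: distrib_right left_diff_distrib mult.assoc)
  also have "lad 4 0 * cup 2 2 = cup 2 2 * lad 2 0"
    using lad_cup[of 0 2 2] by simp
  also have "cap 2 1 * (cup 2 2 * lad 2 0) = lad 2 0"
    using mult_assoc_rule[OF cap_cup_right[of 1 2]] idn_mult(1)[OF lad_Hm[of 0 2]] by (simp add: eval_nat_numeral)
  also have "cap 2 1 * cup 2 2 = one 2"
    using cap_cup_right[of 1 2] by (simp add: eval_nat_numeral)
  also have "cap 2 0 * cup 2 2 = cup 0 0 * cap 0 0"
    using cap_cup[of 0 0 0] by (simp add: eval_nat_numeral)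
  finally show ?thesis .
qed

text \<open>The opened form of \<open>hdown * hup\<close>. One ladder leaves the square through the
  cap above, the other through the cup below, and every resulting term is straightened.\<close>

lemma ladder_square: "cap 2 1 * (lad 4 0 * (lad 4 2 * cup 2 1)) =
    sc (\<delta> + 2) (lad 2 0) - sc (\<delta> + 1) (cup 0 0 * cap 0 0) + sc (\<delta> + \<theta>) (one 2)"
proof -
  have c: "cap 2 1 * lad 4 0 = cap 2 0 * lad 4 1 - cap 2 1 + cap 2 0"
    using cap_lad_next[of 0 2] by simp
  have d: "lad 4 2 * cup 2 1 = lad 4 1 * cup 2 2 + cup 2 2 - cup 2 1"
    using lad_next_cup[of 1 2] by (simp add: eval_nat_numeral)
  have 1: "cap 2 0 * (lad 4 1 * (lad 4 2 * cup 2 1)) = sc (\<delta> + 1) (lad 2 0 + one 2 - cup 0 0 * cap 0 0)"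
  proof -
    have "cap 2 0 * (lad 4 1 * (lad 4 2 * cup 2 1)) = cap 2 0 * (lad 4 1 * lad 4 1) * cup 2 2 +
        cap 2 0 * lad 4 1 * cup 2 2 - cap 2 0 * (lad 4 1 * cup 2 1)"
      by (simp only: d distrib_left right_diff_distrib mult.assoc)
    then show ?thesis
      using lad_lad_same[of 1 4] lad_cup_same[of 1 2] ladder_rotation' by (simp add: sc_add_left)
  qed
  have 2: "cap 2 0 * (lad 4 2 * cup 2 1) = lad 2 0"
    using mult_assoc_rule[OF cap_lad[of 0 0 2]] cap_cup_right[of 0 2] idn_mult(2)[OF lad_Hm[of 0 2]]
    by (simp add: mult.assoc eval_nat_numeral)
  have 3: "cap 2 1 * (lad 4 2 * cup 2 1) = one 2 - sc \<theta> (one 2)"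
  proof -
    have "cap 2 1 * (lad 4 2 * cup 2 1) = (cap 2 1 * lad 4 1) * cup 2 2 + cap 2 1 * cup 2 2 - cap 2 1 * cup 2 1"
      by (simp only: d distrib_left right_diff_distrib mult.assoc)
    then show ?thesis
      using cap_lad_same[of 1 2] cap_cup_right[of 1 2] cap_cup_same[of 1 2]
      by (simp add: eval_nat_numeral)
  qed
  have "cap 2 1 * (lad 4 0 * (lad 4 2 * cup 2 1)) = cap 2 0 * (lad 4 1 * (lad 4 2 * cup 2 1)) -
      cap 2 1 * (lad 4 2 * cup 2 1) + cap 2 0 * (lad 4 2 * cup 2 1)"
    using mult_assoc_rule[OF c] by (simp add: distrib_right left_diff_distrib mult.assoc)
  moreover have "sc 2 x = x + x" for x
    using sc_add_left[of 1 1 x] by simp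
  ultimately show ?thesis
    unfolding 1 2 3 by (simp add: sc_add sc_diff sc_add_left algebra_simps)
qed

lemma hdown_hup: "hdown * hup = sc (\<delta> + 2) (split * merge) - sc (\<delta> + 1) (cupS * capS) + sc (\<delta> + \<theta>) (idn [Single, Single])"
proof -
  have "hdown * hup = cap 2 1 * (sp2 * mg2) * cup 2 1"
    by (simp add: hdown_eq hup_eq mult.assoc del: splits.simps merges.simps)
  then show ?thesis
    using ladder_square by (simp add: sp2_mg2 lad_base mult.assoc del: splits.simps merges.simps)
      (simp add: cap_def cup_def eval_nat_numeral ones_Suc)
qed

definition \<alpha> :: scalar where "\<alpha> = qint 2 ^ 2"

lemma delta_alpha: "\<delta> = - \<alpha>" and alpha_nonzero [simp]: "\<alpha> \<noteq> 0"
  using delta_nonzero by (auto simp: \<alpha>_def \<delta>_def)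

text \<open>With \<open>t = q^(1/2)\<close> one has
  \<open>[6]/[3] = t^3 + t^(-3) = [2]^3 - 3[2]\<close>.\<close>

lemma theta_alpha: "\<theta> = 3 * \<alpha> - \<alpha>\<^sup>2"
proof -
  define t s where "t = qhalf" and "s = inverse qhalf"
  have ts: "t * s = 1" "t - s \<noteq> 0"
    using qhalf_nonzero qhalf_diff by (auto simp: t_def s_def)
  have q: "qint (int k) = (t ^ k - s ^ k) / (t - s)" for k
    by (simp add: qint_def t_def s_def power_int_minus power_inverse)
  have q2: "qint 2 = t + s"
    using q[of 2] by (simp add: nonzero_divide_eq_eq[OF ts(2)] power2_eq_square algebra_simps)
  have q3: "qint 3 \<noteq> 0"
    by (rule qint_nonzero) simp
  have "t ^ 6 - s ^ 6 = (t ^ 3 - s ^ 3) * (t ^ 3 + s ^ 3)"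
    by (simp add: eval_nat_numeral algebra_simps)
  then have "qint 6 = qint 3 * (t ^ 3 + s ^ 3)"
    using q[of 6] q[of 3] by simp
  then have "\<theta> = - ((t ^ 3 + s ^ 3) * (t + s))"
    using q3 by (simp add: \<theta>_def q2)
  also have "t ^ 3 + s ^ 3 = (t + s) ^ 3 - 3 * (t * s) * (t + s)"
    by (simp add: eval_nat_numeral algebra_simps)
  finally show ?thesis
    by (simp add: ts \<alpha>_def q2) (simp add: eval_nat_numeral algebra_simps)
qed

text \<open>The crossing, normalised so as to absorb the powers of \<open>[2]\<close> in the expansion.\<close>

definition xg :: hom where
  "xg = sc (inverse \<alpha>) (hup * hdown)"

lemma xg_Hm [simp]: "xg \<in> Hm [Double, Double] [Double, Double]"
  unfolding xg_def by (intro Hm_sc Hm_mult[OF hup_Hm hdown_Hm])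

text \<open>Of the three terms of \<open>hdown_hup\<close>, the ladder meets \<open>hdown\<close> in
  a triangle and dies, the single cup-cap yields a double cap by \<open>capD_hdown\<close>, and the
  identity keeps \<open>hdown\<close>.\<close>

lemma hdown_xg: "hdown * xg = sc (2 - \<alpha>) hdown + sc (1 - \<alpha>) (cupS * capD)"
proof -
  have "hdown * xg = sc (inverse \<alpha>) ((hdown * hup) * hdown)"
    by (simp add: xg_def mult.assoc)
  also have "(hdown * hup) * hdown = sc (\<delta> + \<theta>) hdown - sc ((\<delta> + 1) * \<delta>) (cupS * capD)"
    unfolding hdown_hup using merge_hdown capD_hdown[symmetric] idn_mult(1)[OF hdown_Hm]
    by (simp add: distrib_right left_diff_distrib mult.assoc)
  also have "sc (inverse \<alpha>) \<dots> = sc (inverse \<alpha> * (\<delta> + \<theta>)) hdown - sc (inverse \<alpha> * ((\<delta> + 1) * \<delta>)) (cupS * capD)"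
    by (simp add: sc_diff)
  also have "inverse \<alpha> * (\<delta> + \<theta>) = 2 - \<alpha>"
    by (simp add: delta_alpha theta_alpha field_simps power2_eq_square)
  also have "inverse \<alpha> * ((\<delta> + 1) * \<delta>) = - (1 - \<alpha>)"
    by (simp add: delta_alpha field_simps)
  finally show ?thesis
    by (simp add: sc_diff_left)
qed

lemma hdown_cupD: "hdown * cupD = sc (1 - \<theta>) cupS"
proof -
  have "sc \<delta> (hdown * cupD) = hdown * hup * cupS"
    using cupD_hup by (metis mult.assoc mult_sc(2))
  also have "\<dots> = sc (\<delta> * (1 - \<theta>)) cupS"
    unfolding hdown_hup using merge_cup loopS idn_mult(1)[OF gen_typed(2)] idn_mult(2)[OF gen_typed(2)]
    by (simp add: distrib_right left_diff_distrib mult.assoc flip: sc_diff_left sc_add_left)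
       (simp add: algebra_simps)
  finally show ?thesis
    using sc_cancel[OF delta_nonzero, of "hdown * cupD" "sc (1 - \<theta>) cupS"] by simp
qed

subsection \<open>Rotation of the tetravalent vertex\<close>

text \<open>Under two nested caps a ladder joining the two parallel strands may travel around the
  bend. Both positions are rewritten through the ladder in between, and the two caps agree on the
  result.\<close>

lemma slide_cap:
  assumes "i \<le> k"
  shows "cap k i * (cap (k + 2) (Suc i) * lad (k + 4) i) = cap k i * (cap (k + 2) (Suc i) * lad (k + 4) (i + 2))"
proof -
  have 1: "cap (k + 2) (Suc i) * lad (k + 4) i = cap (k + 2) i * lad (k + 4) (Suc i) - cap (k + 2) (Suc i) + cap (k + 2) i"
    using cap_lad_next[of i "k + 2"] assms by (simp add: eval_nat_numeral)
  have 2: "cap (k + 2) (Suc i) * lad (k + 4) (i + 2) =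
      cap (k + 2) (i + 2) * lad (k + 4) (Suc i) + cap (k + 2) (i + 2) - cap (k + 2) (Suc i)"
    using cap_lad_next[of "Suc i" "k + 2"] assms by (simp add: eval_nat_numeral)
  have "cap k i * cap (k + 2) (i + 2) = cap k i * cap (k + 2) i"
    using assms by (intro cap_cap) auto
  then show ?thesis
    unfolding 1 2 by (simp only: distrib_left right_diff_distrib mult.assoc[symmetric]) simp
qed

lemma slide_cup:
  assumes "i \<le> k"
  shows "lad (k + 4) i * (cup (k + 2) (Suc i) * cup k i) = lad (k + 4) (i + 2) * (cup (k + 2) (Suc i) * cup k i)"
proof -
  have 1: "lad (k + 4) i * cup (k + 2) (Suc i) = lad (k + 4) (Suc i) * cup (k + 2) i - cup (k + 2) (Suc i) + cup (k + 2) i"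
    using lad_next_cup[of i "k + 2"] assms by (simp add: eval_nat_numeral)
  have 2: "lad (k + 4) (i + 2) * cup (k + 2) (Suc i) =
      lad (k + 4) (Suc i) * cup (k + 2) (i + 2) + cup (k + 2) (i + 2) - cup (k + 2) (Suc i)"
    using lad_next_cup[of "Suc i" "k + 2"] assms by (simp add: eval_nat_numeral)
  have "cup (k + 2) (i + 2) * cup k i = cup (k + 2) i * cup k i"
    using cup_cup[of i i k] assms by auto
  then show ?thesis
    unfolding mult_assoc_rule[OF 1] mult_assoc_rule[OF 2]
    by (simp add: distrib_right left_diff_distrib mult.assoc)
qed

lemma sp3_mid:
  "x \<in> Hm (ones 4) (ones (width w)) \<Longrightarrow> merges (w @ [Double]) * box [] x (ones 2) * sp3 =
     sc \<delta> (box [] (merges w * (x * sp2)) [Double])"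
  "x \<in> Hm (ones 4) (ones (width w)) \<Longrightarrow> merges ([Double] @ w) * box (ones 2) x [] * sp3 =
     sc \<delta> (box [Double] (merges w * (x * sp2)) [])"
  using sandwich[of x "[Double, Double]" w "[]" "[Double]"] sandwich[of x "[Double, Double]" w "[Double]" "[]"]
  by (simp_all add: eval_nat_numeral mult.assoc del: splits.simps merges.simps)

lemma mid_Hm [simp]: "cap 2 1 \<in> Hm (ones 4) (ones 2)" "cap 0 0 * cap 2 1 \<in> Hm (ones 4) (ones 0)"
  "cup 2 1 * cap 2 1 \<in> Hm (ones 4) (ones 4)" "cup 0 0 * (cap 0 0 * cap 2 1) \<in> Hm (ones 4) (ones 2)"
  "cup 2 1 * cup 0 0 \<in> Hm (ones 0) (ones 4)"
  using cap_Hm[of 1 2] cup_Hm[of 1 2] cap_Hm[of 0 0] cup_Hm[of 0 0]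
  by (auto intro!: Hm_mult simp: eval_nat_numeral)

lemma base_gens: "cap 0 0 = capS" "cup 0 0 = cupS"
  by (simp_all add: cap_def cup_def)

lemma capD_eq: "cap 0 0 * cap 2 1 * sp2 = sc \<delta> capD"
  by (simp add: base_gens capD_hdown hdown_eq mult.assoc del: splits.simps)

lemma cupD_eq: "mg2 * (cup 2 1 * cup 0 0) = sc \<delta> cupD"
  by (simp add: base_gens cupD_hup hup_eq mult.assoc del: merges.simps)

lemma crossing_left: "mg3 * (cup 4 1 * cap 4 1) * sp3 = sc \<delta> (box [] (hup * hdown) [Double])"
  using mid_Hm sp3_mid(1)[of "cup 2 1 * cap 2 1" "[Double, Double]"] box_cup[of 1 2 0 2] box_cap[of 1 2 0 2]
  by (simp add: box_mult hup_eq hdown_eq mult.assoc eval_nat_numeral del: splits.simps merges.simps)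

lemma crossing_right: "mg3 * (cup 4 3 * cap 4 3) * sp3 = sc \<delta> (box [Double] (hup * hdown) [])"
  using mid_Hm sp3_mid(2)[of "cup 2 1 * cap 2 1" "[Double, Double]"] box_cup[of 1 2 2 0] box_cap[of 1 2 2 0]
  by (simp add: box_mult hup_eq hdown_eq mult.assoc eval_nat_numeral del: splits.simps merges.simps)

lemma capD_left: "merge * (cap 2 0 * cap 4 1) * sp3 = sc (\<delta> * \<delta>) (box [] capD [Double])"
proof -
  have "box [] (cap 0 0 * cap 2 1) (ones 2) = cap 2 0 * cap 4 1"
    using box_cap[of 0 0 0 2] box_cap[of 1 2 0 2] by (simp add: box_mult eval_nat_numeral)
  moreover have "idn [] * (cap 0 0 * cap 2 1 * sp2) = sc \<delta> capD"
    unfolding capD_eq by (simp add: idn_mult(1)[OF gen_typed(3)])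
  ultimately show ?thesis
    using sp3_mid(1)[of "cap 0 0 * cap 2 1" "[]"] mid_Hm(2)
    by (simp add: splits_single box_sc mult.assoc del: splits.simps merges.simps(2,3))
qed

lemma capD_right: "merge * (cap 2 2 * cap 4 3) * sp3 = sc (\<delta> * \<delta>) (box [Double] capD [])"
proof -
  have "box (ones 2) (cap 0 0 * cap 2 1) [] = cap 2 2 * cap 4 3"
    using box_cap[of 0 0 2 0] box_cap[of 1 2 2 0] by (simp add: box_mult eval_nat_numeral)
  moreover have "idn [] * (cap 0 0 * cap 2 1 * sp2) = sc \<delta> capD"
    unfolding capD_eq by (simp add: idn_mult(1)[OF gen_typed(3)])
  ultimately show ?thesis
    using sp3_mid(2)[of "cap 0 0 * cap 2 1" "[]"] mid_Hm(2)
    by (simp add: splits_single box_sc mult.assoc del: splits.simps merges.simps(2,3))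
qed

lemma cupD_left: "mg3 * (cup 4 1 * cup 2 0) * split = sc (\<delta> * \<delta>) (box [] cupD [Double])"
proof -
  have "box [] (cup 2 1 * cup 0 0) (ones 2) = cup 4 1 * cup 2 0"
    using box_cup[of 0 0 0 2] box_cup[of 1 2 0 2] by (simp add: box_mult eval_nat_numeral)
  moreover have "mg2 * (cup 2 1 * cup 0 0) * idn [] = sc \<delta> cupD"
    unfolding cupD_eq by (simp add: idn_mult(2)[OF gen_typed(4)])
  moreover have "width [Double] = 2" "width [Double, Double] = 4"
    by simp_all
  ultimately show ?thesis
    using sandwich[of "cup 2 1 * cup 0 0" "[]" "[Double, Double]" "[]" "[Double]"] mid_Hm(5)
    by (simp add: splits_single box_sc del: splits.simps(2,3) merges.simps width.simps(2,3))
qed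

lemma cupD_right: "mg3 * (cup 4 3 * cup 2 2) * split = sc (\<delta> * \<delta>) (box [Double] cupD [])"
proof -
  have "box (ones 2) (cup 2 1 * cup 0 0) [] = cup 4 3 * cup 2 2"
    using box_cup[of 0 0 2 0] box_cup[of 1 2 2 0] by (simp add: box_mult eval_nat_numeral)
  moreover have "mg2 * (cup 2 1 * cup 0 0) * idn [] = sc \<delta> cupD"
    unfolding cupD_eq by (simp add: idn_mult(2)[OF gen_typed(4)])
  moreover have "width [Double] = 2" "width [Double, Double] = 4"
    by simp_all
  ultimately show ?thesis
    using sandwich[of "cup 2 1 * cup 0 0" "[]" "[Double, Double]" "[Double]" "[]"] mid_Hm(5)
    by (simp add: splits_single box_sc del: splits.simps(2,3) merges.simps width.simps(2,3))
qed

lemma lad_sp3: "lad 6 0 * sp3 = sc \<delta> sp3" "lad 6 2 * sp3 = sc \<delta> sp3" "lad 6 4 * sp3 = sc \<delta> sp3"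
  using lad_split_all[of 0 3] lad_split_all[of 1 3] lad_split_all[of 2 3]
  by (simp_all add: doubles_def eval_nat_numeral del: splits.simps)

lemma mg3_lad: "mg3 * lad 6 0 = sc \<delta> mg3" "mg3 * lad 6 2 = sc \<delta> mg3" "mg3 * lad 6 4 = sc \<delta> mg3"
  using merge_all_lad[of 0 3] merge_all_lad[of 1 3] merge_all_lad[of 2 3]
  by (simp_all add: doubles_def eval_nat_numeral del: merges.simps)

lemma lad_crossing:
  "lad 6 4 * (cup 4 1 * (cap 4 1 * sp3)) = sc \<delta> (cup 4 1 * (cap 4 1 * sp3))"
  "lad 6 0 * (cup 4 3 * (cap 4 3 * sp3)) = sc \<delta> (cup 4 3 * (cap 4 3 * sp3))"
  using mult_assoc_rule[OF cup_lad[of 1 2 4, symmetric]] mult_assoc_rule[OF cap_lad[of 1 2 4, symmetric]]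
    mult_assoc_rule[OF lad_cup[of 0 3 4]] mult_assoc_rule[OF lad_cap[of 0 3 4]] lad_sp3
  by (simp_all add: mult.assoc eval_nat_numeral del: splits.simps)

lemma crossing_mg3:
  "mg3 * (cup 4 1 * (cap 4 1 * lad 6 4)) = sc \<delta> (mg3 * (cup 4 1 * cap 4 1))"
  "mg3 * (cup 4 3 * (cap 4 3 * lad 6 0)) = sc \<delta> (mg3 * (cup 4 3 * cap 4 3))"
  using cup_lad[of 1 2 4] cap_lad[of 1 2 4] lad_cup[of 0 3 4] lad_cap[of 0 3 4] mg3_lad
  apply (simp_all add: eval_nat_numeral del: merges.simps)
  by (metis mult.assoc mult_sc(1))+

lemma merge_lad: "merge * lad 2 0 = sc \<delta> merge"
  using merge_all_lad[of 0 1] splits_single by (simp add: doubles_def eval_nat_numeral)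

lemma lad_split: "lad 2 0 * split = sc \<delta> split"
  using lad_split_all[of 0 1] splits_single by (simp add: doubles_def eval_nat_numeral)

text \<open>The quarter-turn symmetry of the tetravalent vertex, against a double cap. The product
  \<open>sp3 * mg3\<close> between the opened factors consists of three ladders; each slides to a
  place where it gives \<open>\<delta>\<close>, and both sides straighten to the same nested
  caps.\<close>

lemma cap_rotation_aux: "box [Double] capD [] * box [] (hup * hdown) [Double] =
    box [] capD [Double] * box [Double] (hup * hdown) []"
proof -
  have A: "merge * (cap 2 2 * (cap 4 3 * (lad 6 0 * v))) = sc \<delta> (merge * (cap 2 2 * (cap 4 3 * v)))" for v
    using mult_assoc_rule[OF lad_cap[of 0 3 4], of v] mult_assoc_rule[OF lad_cap[of 0 2 2], of "cap 4 3 * v"]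
      mult_assoc_rule[OF merge_lad, of "cap 2 2 * (cap 4 3 * v)"]
    by (simp add: mult.assoc eval_nat_numeral)
  have B: "merge * (cap 2 0 * (cap 4 1 * (lad 6 4 * v))) = sc \<delta> (merge * (cap 2 0 * (cap 4 1 * v)))" for v
    using mult_assoc_rule[OF cap_lad[of 1 2 4], of v] mult_assoc_rule[OF cap_lad[of 0 0 2], of "cap 4 1 * v"]
      mult_assoc_rule[OF merge_lad, of "cap 2 0 * (cap 4 1 * v)"]
    by (simp add: mult.assoc eval_nat_numeral)
  have slA: "cap 2 2 * (cap 4 3 * (lad 6 2 * v)) = cap 2 2 * (cap 4 3 * (lad 6 4 * v))" for v
    using mult_assoc_rule[OF slide_cap[of 2 2], of v] by (simp add: mult.assoc eval_nat_numeral)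
  have slB: "cap 2 0 * (cap 4 1 * (lad 6 2 * v)) = cap 2 0 * (cap 4 1 * (lad 6 0 * v))" for v
    using mult_assoc_rule[OF slide_cap[of 0 2], of v] by (simp add: mult.assoc eval_nat_numeral)
  have com: "lad 6 2 * (lad 6 4 * v) = lad 6 4 * (lad 6 2 * v)" for v
    using mult_assoc_rule[OF lad_lad[of 2 4 6], of v] by (simp add: mult.assoc)
  have com0: "lad 6 0 * (lad 6 4 * (lad 6 2 * v)) = lad 6 4 * (lad 6 2 * (lad 6 0 * v))" for v
    using mult_assoc_rule[OF lad_lad[of 0 2 6]] mult_assoc_rule[OF lad_lad[of 0 4 6]] by (simp add: mult.assoc)
  have L: "sc (\<delta> * \<delta> * \<delta>) (box [Double] capD [] * box [] (hup * hdown) [Double]) =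
      sc (\<delta> * \<delta> * \<delta>) (merge * (cap 2 2 * (cap 4 3 * (cup 4 1 * (cap 4 1 * sp3)))))"
  proof -
    have "sc (\<delta> * \<delta> * \<delta>) (box [Double] capD [] * box [] (hup * hdown) [Double]) =
      (merge * (cap 2 2 * cap 4 3) * sp3) * (mg3 * (cup 4 1 * cap 4 1) * sp3)"
      unfolding capD_right crossing_left by (simp add: mult_ac)
    also have "\<dots> = merge * (cap 2 2 * (cap 4 3 * ((sp3 * mg3) * (cup 4 1 * (cap 4 1 * sp3)))))"
      by (simp only: mult.assoc)
    finally show ?thesis
      unfolding sp3_mg3 by (simp add: mult.assoc A slA lad_crossing[unfolded One_nat_def] del: splits.simps)
  qed
  have R: "sc (\<delta> * \<delta> * \<delta>) (box [] capD [Double] * box [Double] (hup * hdown) []) =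
      sc (\<delta> * \<delta> * \<delta>) (merge * (cap 2 0 * (cap 4 1 * (cup 4 3 * (cap 4 3 * sp3)))))"
  proof -
    have "sc (\<delta> * \<delta> * \<delta>) (box [] capD [Double] * box [Double] (hup * hdown) []) =
      (merge * (cap 2 0 * cap 4 1) * sp3) * (mg3 * (cup 4 3 * cap 4 3) * sp3)"
      unfolding capD_left crossing_right by (simp add: mult_ac)
    also have "\<dots> = merge * (cap 2 0 * (cap 4 1 * ((sp3 * mg3) * (cup 4 3 * (cap 4 3 * sp3)))))"
      by (simp only: mult.assoc)
    finally show ?thesis
      unfolding sp3_mg3 by (simp add: mult.assoc com0 com lad_crossing[unfolded One_nat_def] B[unfolded One_nat_def] slB[unfolded One_nat_def] del: splits.simps)
  qed
  have a: "cap 2 2 * (cap 4 3 * (cup 4 1 * v)) = cap 2 1 * v" if "v \<in> Hm x (ones 4)" for v x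
    using mult_assoc_rule[OF cup_cap[of 1 1 2], of v] mult_assoc_rule[OF cap_cup_left[of 1 2], of "cap 2 1 * v"]
      idn_mult(1)[OF Hm_mult[OF cap_Hm[of 1 2], of v x]] that
    by (simp add: mult.assoc eval_nat_numeral)
  have b: "cap 2 0 * (cap 4 1 * (cup 4 3 * v)) = cap 2 1 * v" if "v \<in> Hm x (ones 4)" for v x
    using mult_assoc_rule[OF cap_cup[of 1 1 2], of v] mult_assoc_rule[OF cap_cup_right[of 0 2], of "cap 2 1 * v"]
      idn_mult(1)[OF Hm_mult[OF cap_Hm[of 1 2], of v x]] that
    by (simp add: mult.assoc eval_nat_numeral)
  have H: "cap 4 i * sp3 \<in> Hm [Double, Double, Double] (ones 4)" if "i \<le> 4" for i
    using Hm_mult[of "cap 4 i" "ones 6" "ones 4" sp3 "[Double, Double, Double]"] cap_Hm[OF that]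
      splits_Hm[of "[Double, Double, Double]"]
    by (simp add: eval_nat_numeral del: splits.simps)
  have a1: "cap 2 2 * (cap 4 3 * (cup 4 1 * (cap 4 1 * sp3))) = cap 2 1 * (cap 4 1 * sp3)"
    by (rule a[OF H]) simp
  have b1: "cap 2 0 * (cap 4 1 * (cup 4 3 * (cap 4 3 * sp3))) = cap 2 1 * (cap 4 3 * sp3)"
    by (rule b[OF H]) simp
  have ab: "cap 2 1 * (cap 4 3 * sp3) = cap 2 1 * (cap 4 1 * sp3)"
    using mult_assoc_rule[OF cap_cap[of 1 1 2], of sp3] by (simp add: mult.assoc eval_nat_numeral del: splits.simps)
  have "sc (\<delta> * \<delta> * \<delta>) (box [Double] capD [] * box [] (hup * hdown) [Double]) =
      sc (\<delta> * \<delta> * \<delta>) (box [] capD [Double] * box [Double] (hup * hdown) [])"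
    unfolding L R a1 b1 ab ..
  then show ?thesis
    by (subst (asm) sc_cancel) simp_all
qed

lemma cup_rotation_aux: "box [] (hup * hdown) [Double] * box [Double] cupD [] =
    box [Double] (hup * hdown) [] * box [] cupD [Double]"
proof -
  have H2: "cup 2 i * split \<in> Hm [Double] (ones 4)" if "i \<le> 2" for i
    using Hm_mult[of "cup 2 i" "ones 2" "ones 4" split "[Double]"] cup_Hm[OF that] gen_typed(5)
    by (simp add: eval_nat_numeral ones_Suc)
  have A: "lad 6 4 * (cup 4 3 * (cup 2 2 * split)) = lad 6 2 * (cup 4 3 * (cup 2 2 * split))"
    using mult_assoc_rule[OF slide_cup[of 2 2], of split] by (simp add: mult.assoc eval_nat_numeral)
  have A0: "lad 6 0 * (cup 4 3 * (cup 2 2 * split)) = sc \<delta> (cup 4 3 * (cup 2 2 * split))"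
    using mult_assoc_rule[OF lad_cup[of 0 3 4], of "cup 2 2 * split"] mult_assoc_rule[OF lad_cup[of 0 2 2], of split]
      lad_split by (simp add: mult.assoc eval_nat_numeral)
  have B: "lad 6 2 * (cup 4 1 * (cup 2 0 * split)) = lad 6 0 * (cup 4 1 * (cup 2 0 * split))"
    using mult_assoc_rule[OF slide_cup[of 0 2], of split] by (simp add: mult.assoc eval_nat_numeral)
  have B0: "lad 6 4 * (cup 4 1 * (cup 2 0 * split)) = sc \<delta> (cup 4 1 * (cup 2 0 * split))"
    using mult_assoc_rule[OF cup_lad[of 1 2 4, symmetric], of "cup 2 0 * split"]
      mult_assoc_rule[OF cup_lad[of 0 0 2, symmetric], of split]
      lad_split by (simp add: mult.assoc eval_nat_numeral)
  have L1: "(mg3 * (cup 4 1 * cap 4 1)) * (lad 6 0 * (lad 6 2 * lad 6 4)) * (cup 4 3 * (cup 2 2 * split)) =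
     sc (\<delta> * \<delta> * \<delta>) (mg3 * (cup 4 1 * (cap 4 1 * (cup 4 3 * (cup 2 2 * split)))))"
  proof -
    let ?x = "cup 4 3 * (cup 2 2 * split)" and ?m = "mg3 * (cup 4 1 * cap 4 1)"
    have "?m * (lad 6 0 * (lad 6 2 * lad 6 4)) * ?x = ?m * (lad 6 0 * (lad 6 2 * (lad 6 4 * ?x)))"
      by (simp only: mult.assoc)
    also have "\<dots> = ?m * (lad 6 0 * (lad 6 2 * lad 6 2) * ?x)"
      unfolding A by (simp only: mult.assoc)
    also have "\<dots> = ?m * (lad 6 0 * (lad 6 4 * (sc \<delta> ?x)))"
      using lad_lad_same[of 2 6] A by (simp add: mult.assoc)
    also have "\<dots> = sc \<delta> (?m * (lad 6 4 * (lad 6 0 * ?x)))"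
      using mult_assoc_rule[OF lad_lad[of 0 4 6], of ?x] by (simp add: mult.assoc)
    also have "\<dots> = sc (\<delta> * \<delta>) (?m * lad 6 4 * ?x)"
      unfolding A0 by (simp add: mult.assoc)
    also have "?m * lad 6 4 = sc \<delta> ?m"
      using crossing_mg3(1) by (simp add: mult.assoc)
    finally show ?thesis
      by (simp add: mult.assoc)
  qed
  have R1: "(mg3 * (cup 4 3 * cap 4 3)) * (lad 6 0 * (lad 6 2 * lad 6 4)) * (cup 4 1 * (cup 2 0 * split)) =
     sc (\<delta> * \<delta> * \<delta>) (mg3 * (cup 4 3 * (cap 4 3 * (cup 4 1 * (cup 2 0 * split)))))"
  proof -
    let ?x = "cup 4 1 * (cup 2 0 * split)" and ?m = "mg3 * (cup 4 3 * cap 4 3)"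
    have "?m * (lad 6 0 * (lad 6 2 * lad 6 4)) * ?x = ?m * (lad 6 0 * (lad 6 2 * (lad 6 4 * ?x)))"
      by (simp only: mult.assoc)
    also have "\<dots> = sc \<delta> (?m * (lad 6 0 * (lad 6 0 * ?x)))"
      unfolding B0 using B by simp
    also have "\<dots> = sc \<delta> ((?m * lad 6 0) * (lad 6 0 * ?x))"
      by (simp only: mult.assoc)
    also have "?m * lad 6 0 = sc \<delta> ?m"
      using crossing_mg3(2) by (simp add: mult.assoc)
    also have "sc \<delta> (sc \<delta> ?m * (lad 6 0 * ?x)) = sc (\<delta> * \<delta>) ((?m * lad 6 0) * ?x)"
      by (simp add: mult.assoc)
    also have "?m * lad 6 0 = sc \<delta> ?m"
      using crossing_mg3(2) by (simp add: mult.assoc)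
    finally show ?thesis
      by (simp add: mult.assoc)
  qed
  have a: "cap 4 1 * (cup 4 3 * (cup 2 2 * split)) = cup 2 1 * split"
    using mult_assoc_rule[OF cap_cup[of 1 1 2], of "cup 2 2 * split"] mult_assoc_rule[OF cap_cup_right[of 1 2], of split]
      idn_mult(1)[OF gen_typed(5)]
    by (simp add: mult.assoc eval_nat_numeral ones_Suc)
  have b: "cap 4 3 * (cup 4 1 * (cup 2 0 * split)) = cup 2 1 * split"
    using mult_assoc_rule[OF cup_cap[of 1 1 2, symmetric], of "cup 2 0 * split"] mult_assoc_rule[OF cap_cup_left[of 0 2], of split]
      idn_mult(1)[OF gen_typed(5)]
    by (simp add: mult.assoc eval_nat_numeral ones_Suc)
  have c: "cup 4 1 * (cup 2 1 * split) = cup 4 3 * (cup 2 1 * split)"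
    using mult_assoc_rule[OF cup_cup[of 1 1 2], of split] by (simp add: mult.assoc eval_nat_numeral)
  have "sc (\<delta> * \<delta> * \<delta>) (box [] (hup * hdown) [Double] * box [Double] cupD []) =
      (mg3 * (cup 4 1 * cap 4 1) * sp3) * (mg3 * (cup 4 3 * cup 2 2) * split)"
    unfolding crossing_left cupD_right by (simp add: mult_ac)
  also have "\<dots> = (mg3 * (cup 4 1 * cap 4 1)) * (sp3 * mg3) * (cup 4 3 * (cup 2 2 * split))"
    by (simp only: mult.assoc)
  also have "\<dots> = sc (\<delta> * \<delta> * \<delta>) (mg3 * (cup 4 1 * (cup 2 1 * split)))"
    unfolding sp3_mg3 L1 a ..
  also have "\<dots> = (mg3 * (cup 4 3 * cap 4 3)) * (sp3 * mg3) * (cup 4 1 * (cup 2 0 * split))"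
    unfolding sp3_mg3 R1 b c ..
  also have "\<dots> = (mg3 * (cup 4 3 * cap 4 3) * sp3) * (mg3 * (cup 4 1 * cup 2 0) * split)"
    by (simp only: mult.assoc)
  also have "\<dots> = sc (\<delta> * \<delta> * \<delta>) (box [Double] (hup * hdown) [] * box [] cupD [Double])"
    unfolding crossing_right cupD_left by (simp add: mult_ac)
  finally show ?thesis
    by (subst (asm) sc_cancel) simp_all
qed

lemma cap_rotation: "box [Double] capD [] * box [] xg [Double] = box [] capD [Double] * box [Double] xg []"
  using cap_rotation_aux by (simp add: xg_def box_sc)

lemma cup_rotation: "box [] xg [Double] * box [Double] cupD [] = box [Double] xg [] * box [] cupD [Double]"
  using cup_rotation_aux by (simp add: xg_def box_sc)

subsection \<open>Sliding \<open>hdown\<close> through two crossings\<close>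

text \<open>The terms that drop out in \<open>hh_xx_xx\<close>, whose argument is killed by
  \<open>hdown\<close> on the two left strands.\<close>

definition idl :: "hom \<Rightarrow> bool" where
  "idl x \<longleftrightarrow> (\<exists>A. x = A * box [] hdown [Double])"

lemma idl_left: "idl x \<Longrightarrow> idl (A * x)"
  unfolding idl_def by (metis mult.assoc)

lemma idl_add: "idl x \<Longrightarrow> idl y \<Longrightarrow> idl (x + y)"
  unfolding idl_def by (metis distrib_right)

lemma idl_sc: "idl x \<Longrightarrow> idl (sc c x)"
  unfolding idl_def by (metis mult_sc(1))

lemma idl_uminus: "idl x \<Longrightarrow> idl (- x)"
  using idl_sc[of x "-1"] by (simp add: sc_uminus_left)

lemma idl_diff: "idl x \<Longrightarrow> idl y \<Longrightarrow> idl (x - y)"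
  using idl_add[of x "- y"] idl_uminus by simp

text \<open>Computed on opened strands. The three terms on the right are \<open>hdown\<close> itself
  and two corrections in which the strands under \<open>hdown\<close> are joined by a double
  cap.\<close>

lemma hdown_crossings_aux:
  "idl (box [Double] hdown [] * box [] (hup * hdown) [Double] * box [Double] (hup * hdown) [] -
    sc (\<delta> * \<delta>) (box [Double] hdown [] + box [Double] (cupS * capD) [] +
      box [Double] hdown [] * box [] cupD [Double] * box [Double] capD []))"
proof -
  \<comment> \<open>The target word is \<open>[Double, Single, Single]\<close>, so \<open>m0\<close>
    closes only the first two of four strands. Up to scalars and closing, \<open>s\<close> and
    \<open>z\<close> are \<open>hdown\<close> and the double cap on the two right double
    strands.\<close>
  define m0 where "m0 = merges [Double, Single, Single]"
  define s where "s = cap 4 3 * sp3"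
  define z where "z = cap 2 2 * s"
  have m0_eq: "m0 = box [] merge (ones 2)"
    using idn_box_left[OF gen_typed(6), of "[Double, Single, Single]" "[]" "[Single, Single]"]
    by (simp add: m0_def eval_nat_numeral ones_Suc)
  have m0_lad: "m0 * lad 4 0 = sc \<delta> m0"
    using box_comp[OF merge_lad, of "[]" "ones 2"] box_lad[of 0 2 0 2] by (simp add: m0_eq box_sc eval_nat_numeral)
  have s_Hm: "s \<in> Hm [Double, Double, Double] (ones 4)"
    using Hm_mult[of "cap 4 3" "ones 6" "ones 4" sp3 "[Double, Double, Double]"] cap_Hm[of 3 4]
      splits_Hm[of "[Double, Double, Double]"]
    by (simp add: s_def eval_nat_numeral del: splits.simps)
  have s_rest: "s = box (ones 2) hdown [] * rest [Double] [Double, Double] []"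
    using splits_mid[of "[Double]" "[Double, Double]" "[]"] box_cap[of 1 2 2 0]
    by (simp add: s_def hdown_eq box_mult mult.assoc[symmetric] eval_nat_numeral del: splits.simps)
  \<comment> \<open>A triangle again: the ladder sits directly on the single strands of
    \<open>hdown\<close>.\<close>
  have lad2_s: "lad 4 2 * s = 0"
  proof -
    have "(split * merge) * hdown = 0"
      using merge_hdown by (simp add: mult.assoc)
    from box_comp[OF this, of "ones 2" "[]"] show ?thesis
      unfolding s_rest using box_lad[of 0 2 2 0] by (simp add: lad_base mult.assoc[symmetric])
  qed
  have lad0_s: "lad 4 0 * s = sc \<delta> s"
    using mult_assoc_rule[OF lad_cap[of 0 3 4], of sp3] lad_sp3
    by (simp add: s_def mult.assoc eval_nat_numeral del: splits.simps)
  \<comment> \<open>Exchanging the two caps shows \<open>hdown\<close> on the two left strands. From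
    here on every term containing \<open>cap 2 1 * s\<close> is negligible.\<close>
  have cap1_s: "idl (cap 2 1 * s)"
  proof -
    have "cap 2 1 * s = cap 2 1 * (cap 4 1 * sp3)"
      using mult_assoc_rule[OF cap_cap[of 1 1 2], of sp3] by (simp add: s_def mult.assoc eval_nat_numeral del: splits.simps)
    also have "cap 4 1 * sp3 = box [] hdown (ones 2) * rest [] [Double, Double] [Double]"
      using splits_mid[of "[]" "[Double, Double]" "[Double]"] box_cap[of 1 2 0 2]
      by (simp add: hdown_eq box_mult mult.assoc[symmetric] eval_nat_numeral del: splits.simps)
    also have "\<dots> = rest [] [Single, Single] [Double] * box [] hdown [Double]"
      using rest_exchange[OF hdown_Hm, of "[]" "[Double]"] by (simp add: eval_nat_numeral)
    finally have "cap 2 1 * s = (cap 2 1 * rest [] [Single, Single] [Double]) * box [] hdown [Double]"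
      by (simp add: mult.assoc)
    then show ?thesis
      unfolding idl_def by blast
  qed
  have lad0_z: "lad 2 0 * z = sc \<delta> z"
    using mult_assoc_rule[OF lad_cap[of 0 2 2], of s] lad0_s by (simp add: z_def mult.assoc eval_nat_numeral)
  have z_Hm: "z \<in> Hm [Double, Double, Double] (ones 2)"
    using Hm_mult[of "cap 2 2" "ones 4" "ones 2" s "[Double, Double, Double]"] cap_Hm[of 2 2] s_Hm
    by (simp add: z_def eval_nat_numeral)
  have cap2lad1_s: "cap 2 2 * (lad 4 1 * s) = cap 2 1 * s - z"
    using mult_assoc_rule[OF cap_lad_next[of 1 2], of s] lad2_s
    by (simp add: z_def distrib_right left_diff_distrib mult.assoc eval_nat_numeral algebra_simps)
  define w where "w = lad 4 2 * (lad 4 1 * s)"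
  have braid0: "lad 4 0 * (lad 4 1 * (lad 4 0 * v)) = lad 4 0 * (cup 2 1 * (cap 2 1 * (lad 4 0 * v))) - sc \<delta> (lad 4 0 * v)" for v
    using mult_assoc_rule[OF lad_lad_lad[of 0 2], of v] by (simp add: left_diff_distrib mult.assoc eval_nat_numeral)
  have m0lad: "m0 * (lad 4 0 * v) = sc \<delta> (m0 * v)" for v
    using mult_assoc_rule[OF m0_lad, of v] by simp
  have m0_lad1: "sc (\<delta> * \<delta>) (m0 * (lad 4 1 * v)) = sc (\<delta> * \<delta>) (m0 * (cup 2 1 * (cap 2 1 * v)) - m0 * v)"
    if "lad 4 0 * v = sc \<delta> v" for v
  proof -
    have "sc (\<delta> * \<delta>) (m0 * (lad 4 1 * v)) = m0 * (lad 4 0 * (lad 4 1 * (lad 4 0 * v)))"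
      by (simp add: m0lad that)
    also have "\<dots> = sc (\<delta> * \<delta>) (m0 * (cup 2 1 * (cap 2 1 * v)) - m0 * v)"
      unfolding braid0 by (simp add: right_diff_distrib m0lad that sc_diff)
    finally show ?thesis .
  qed
  have m0_lad1': "m0 * (lad 4 1 * v) = m0 * (cup 2 1 * (cap 2 1 * v)) - m0 * v" if "lad 4 0 * v = sc \<delta> v" for v
    using m0_lad1[OF that] by (subst (asm) sc_cancel) simp_all
  \<comment> \<open>The factor \<open>\<delta> * \<delta>\<close> supplies a ladder at 0 on either
    side of the one at 1. After \<open>braid0\<close> the cup-cap term is negligible and the other
    one contains \<open>lad 4 2 * s = 0\<close>.\<close>
  have m0_w: "idl (m0 * w)"
  proof -
    have "sc \<delta> (m0 * w) = m0 * (lad 4 2 * (lad 4 0 * (lad 4 1 * s)))"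
      using mult_assoc_rule[OF lad_lad[of 0 2 4], of "lad 4 1 * s"] by (simp add: w_def m0lad[symmetric] mult.assoc)
    then have "sc (\<delta> * \<delta>) (m0 * w) = m0 * (lad 4 2 * (lad 4 0 * (lad 4 1 * (lad 4 0 * s))))"
      by (simp add: lad0_s flip: sc_sc)
    also have "\<dots> = sc \<delta> (m0 * (lad 4 2 * (lad 4 0 * (cup 2 1 * (cap 2 1 * s)))))"
      unfolding braid0 by (simp add: lad0_s lad2_s right_diff_distrib)
    finally have "idl (sc (\<delta> * \<delta>) (m0 * w))"
      using cap1_s by (auto intro!: idl_sc idl_left)
    from idl_sc[OF this, of "inverse (\<delta> * \<delta>)"] have "idl (sc (inverse (\<delta> * \<delta>) * (\<delta> * \<delta>)) (m0 * w))"
      by (simp only: sc_sc)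
    moreover have "inverse (\<delta> * \<delta>) * (\<delta> * \<delta>) = 1"
      by (rule left_inverse) simp
    ultimately show ?thesis
      by (simp only: sc_1)
  qed
  have lad1_w: "lad 4 1 * w = lad 4 1 * (cup 2 2 * (cap 2 1 * s - z)) - sc \<delta> (lad 4 1 * s)"
    using mult_assoc_rule[OF lad_lad_lad[of 1 2], of s] cap2lad1_s
    by (simp add: w_def left_diff_distrib mult.assoc eval_nat_numeral)
  have cap1_w: "cap 2 1 * w = sc (\<delta> + 1) (cap 2 1 * s - z)"
    using mult_assoc_rule[OF cap_lad_next[of 1 2], of "lad 4 1 * s"] mult_assoc_rule[OF lad_lad_same[of 1 4], of s]
      mult_assoc_rule[OF cap_lad_same[of 1 2], of s] cap2lad1_s
    by (simp add: w_def distrib_right left_diff_distrib mult.assoc eval_nat_numeral sc_add_left)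
  have m0cup2: "m0 * (lad 4 1 * (cup 2 2 * z)) = m0 * (cup 2 1 * z) - m0 * (cup 2 2 * z)"
  proof -
    have "lad 4 0 * (cup 2 2 * z) = sc \<delta> (cup 2 2 * z)"
      using mult_assoc_rule[OF lad_cup[of 0 2 2], of z] lad0_z by (simp add: mult.assoc)
    moreover have "cap 2 1 * (cup 2 2 * z) = z"
      using mult_assoc_rule[OF cap_cup_right[of 1 2], of z] idn_mult(1)[OF z_Hm] by (simp add: eval_nat_numeral)
    ultimately show ?thesis
      using m0_lad1' by simp
  qed
  \<comment> \<open>The two copies of \<open>sp3 * mg3\<close> in the triple product contribute six
    ladders. Three of them become scalars, and \<open>R\<close> is the web with the other
    three.\<close>
  define R where "R = m0 * (cap 4 3 * (lad 6 2 * (cup 4 1 * (cap 4 1 * (lad 6 2 * (lad 6 4 * (cup 4 3 * s)))))))"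
  have R: "idl (R - (m0 * (cup 2 2 * z) + sc \<delta> (m0 * (cup 2 1 * z)) + sc \<delta> (m0 * s)))"
  proof -
    define v where "v = lad 6 4 * (cup 4 3 * s)"
    have e1: "cap 4 2 * (lad 6 1 * v) = w"
      using mult_assoc_rule[OF lad_lad[of 1 4 6], of "cup 4 3 * s"] mult_assoc_rule[OF cap_lad[of 2 2 4]]
        mult_assoc_rule[OF lad_cup[of 1 3 4], of s] mult_assoc_rule[OF cap_cup_right[of 2 4], of "lad 4 1 * s"]
        idn_mult(1)[OF Hm_mult[OF lad_Hm[of 1 4] s_Hm]]
      by (simp add: v_def w_def mult.assoc eval_nat_numeral)
    have e2: "cap 4 2 * v = 0"
      using mult_assoc_rule[OF cap_lad[of 2 2 4]] mult_assoc_rule[OF cap_cup_right[of 2 4], of s]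
        idn_mult(1)[OF s_Hm] lad2_s
      by (simp add: v_def mult.assoc eval_nat_numeral)
    have e3: "cap 4 1 * v = lad 4 2 * (cup 2 1 * (cap 2 1 * s))"
      using mult_assoc_rule[OF cap_lad[of 1 2 4]] mult_assoc_rule[OF cap_cup[of 1 1 2], of s]
      by (simp add: v_def mult.assoc eval_nat_numeral)
    have e4: "cap 4 1 * (lad 6 2 * v) = w - lad 4 2 * (cup 2 1 * (cap 2 1 * s))"
      using mult_assoc_rule[OF cap_lad_next[of 1 4], of v] e1 e2 e3
      by (simp add: distrib_right left_diff_distrib mult.assoc eval_nat_numeral)
    have w_Hm: "w \<in> Hm [Double, Double, Double] (ones 4)"
      unfolding w_def by (intro Hm_mult[OF lad_Hm] s_Hm) auto
    have f1: "cap 4 2 * (lad 6 3 * (cup 4 1 * w)) = lad 4 1 * w"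
      using mult_assoc_rule[OF cup_lad[of 1 1 4, symmetric], of w] mult_assoc_rule[OF cap_cup_left[of 1 4], of "lad 4 1 * w"]
        idn_mult(1)[OF Hm_mult[OF lad_Hm[of 1 4] w_Hm]]
      by (simp add: mult.assoc eval_nat_numeral)
    have f2: "cap 4 2 * (cup 4 1 * w) = w"
      using mult_assoc_rule[OF cap_cup_left[of 1 4], of w] idn_mult(1)[OF w_Hm] by (simp add: eval_nat_numeral)
    have f3: "cap 4 3 * (cup 4 1 * w) = cup 2 1 * (cap 2 1 * w)"
      using mult_assoc_rule[OF cup_cap[of 1 1 2, symmetric], of w] by (simp add: mult.assoc eval_nat_numeral)
    have f4: "cap 4 3 * (lad 6 2 * (cup 4 1 * w)) = lad 4 1 * w - cup 2 1 * (cap 2 1 * w) + w"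
    proof -
      have "cap 4 3 * lad 6 2 = cap 4 2 * lad 6 3 - cap 4 3 + cap 4 2"
        using cap_lad_next[of 2 4] by (simp add: eval_nat_numeral)
      from mult_assoc_rule[OF this, of "cup 4 1 * w"] show ?thesis
        using f1 f2 f3 by (simp add: distrib_right left_diff_distrib mult.assoc)
    qed
    define B where "B = m0 * cap 4 3 * lad 6 2 * cup 4 1 * lad 4 2 * cup 2 1"
    have "R = m0 * (cap 4 3 * (lad 6 2 * (cup 4 1 * w))) - B * (cap 2 1 * s)"
      unfolding R_def v_def[symmetric] e4 B_def by (simp add: right_diff_distrib mult.assoc)
    also have "\<dots> = m0 * (lad 4 1 * w) - m0 * (cup 2 1 * (cap 2 1 * w)) + m0 * w - B * (cap 2 1 * s)"
      unfolding f4 by (simp add: distrib_left right_diff_distrib)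
    also have "m0 * (lad 4 1 * w) = m0 * (lad 4 1 * (cup 2 2 * (cap 2 1 * s))) - m0 * (lad 4 1 * (cup 2 2 * z))
        - sc \<delta> (m0 * (lad 4 1 * s))"
      unfolding lad1_w by (simp add: right_diff_distrib)
    also have "m0 * (cup 2 1 * (cap 2 1 * w)) = sc (\<delta> + 1) (m0 * (cup 2 1 * (cap 2 1 * s))) - sc (\<delta> + 1) (m0 * (cup 2 1 * z))"
      unfolding cap1_w by (simp add: right_diff_distrib sc_diff)
    also have "m0 * (lad 4 1 * (cup 2 2 * z)) = m0 * (cup 2 1 * z) - m0 * (cup 2 2 * z)"
      by (rule m0cup2)
    also have "m0 * (lad 4 1 * s) = m0 * (cup 2 1 * (cap 2 1 * s)) - m0 * s"
      by (rule m0_lad1'[OF lad0_s])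
    \<comment> \<open>All that is left carries \<open>cap 2 1 * s\<close> or is
      \<open>m0 * w\<close>.\<close>
    finally have Req: "R - (m0 * (cup 2 2 * z) + sc \<delta> (m0 * (cup 2 1 * z)) + sc \<delta> (m0 * s)) =
        (m0 * lad 4 1 * cup 2 2) * (cap 2 1 * s) - sc \<delta> ((m0 * cup 2 1) * (cap 2 1 * s))
        - sc (\<delta> + 1) ((m0 * cup 2 1) * (cap 2 1 * s)) + m0 * w - B * (cap 2 1 * s)"
      by (simp add: sc_diff sc_add_left mult.assoc algebra_simps)
    have "idl (X * (cap 2 1 * s))" for X
      using cap1_s by (rule idl_left)
    then show ?thesis
      unfolding Req by (intro idl_diff idl_add idl_sc m0_w)
  qed
  have Hm4: "cap 2 1 \<in> Hm (ones 4) (ones (width [Single, Single]))"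
    "cup 0 0 * (cap 0 0 * cap 2 1) \<in> Hm (ones 4) (ones (width [Single, Single]))"
    using mid_Hm by (simp_all add: eval_nat_numeral)
  have m1: "m0 * s = sc \<delta> (box [Double] hdown [])"
  proof -
    have "box (ones 2) (cap 2 1) [] = cap 4 3"
      using box_cap[of 1 2 2 0] by (simp add: eval_nat_numeral)
    moreover have "one 2 * (cap 2 1 * sp2) = hdown"
      unfolding hdown_eq[symmetric] using idn_mult(1)[OF hdown_Hm] by (simp add: eval_nat_numeral ones_Suc)
    ultimately show ?thesis
      using sp3_mid(2)[OF Hm4(1)]
      by (simp add: m0_def s_def splits_single mult.assoc del: splits.simps merges.simps)
  qed
  have m2: "m0 * (cup 2 2 * z) = sc (\<delta> * \<delta>) (box [Double] (cupS * capD) [])"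
  proof -
    have "box (ones 2) (cup 0 0 * (cap 0 0 * cap 2 1)) [] = cup 2 2 * (cap 2 2 * cap 4 3)"
      using box_cap[of 1 2 2 0] box_cap[of 0 0 2 0] box_cup[of 0 0 2 0] by (simp add: box_mult eval_nat_numeral)
    moreover have "one 2 * (cup 0 0 * (cap 0 0 * cap 2 1) * sp2) = sc \<delta> (cupS * capD)"
      using capD_eq idn_mult(1)[OF gen_typed(2)] mult_assoc_rule[OF idn_mult(1)[OF gen_typed(2)]]
      by (simp add: base_gens mult.assoc eval_nat_numeral ones_Suc del: splits.simps)
    ultimately show ?thesis
      using sp3_mid(2)[OF Hm4(2)]
      by (simp add: m0_def s_def z_def splits_single box_sc mult.assoc del: splits.simps merges.simps)
  qed
  have m3: "m0 * (cup 2 1 * z) = sc \<delta> (box [Double] hdown [] * box [] cupD [Double] * box [Double] capD [])"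
  proof -
    let ?v = "cup 4 1 * (cup 2 0 * z)"
    have v0: "lad 6 2 * ?v = lad 6 0 * ?v"
      using mult_assoc_rule[OF slide_cup[of 0 2], of z] by (simp add: mult.assoc eval_nat_numeral)
    have v4: "lad 6 4 * ?v = sc \<delta> ?v"
      using mult_assoc_rule[OF cup_lad[of 1 2 4, symmetric], of "cup 2 0 * z"]
        mult_assoc_rule[OF cup_lad[of 0 0 2, symmetric], of z] lad0_z by (simp add: mult.assoc eval_nat_numeral)
    have c3: "cap 4 3 * ?v = cup 2 1 * z"
      using mult_assoc_rule[OF cup_cap[of 1 1 2, symmetric], of "cup 2 0 * z"] mult_assoc_rule[OF cap_cup_left[of 0 2], of z]
        idn_mult(1)[OF z_Hm]
      by (simp add: mult.assoc eval_nat_numeral ones_Suc)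
    have m0c: "m0 * (cap 4 3 * (lad 6 0 * u)) = sc \<delta> (m0 * (cap 4 3 * u))" for u
      using mult_assoc_rule[OF lad_cap[of 0 3 4, symmetric], of u] m0lad by (simp add: mult.assoc eval_nat_numeral)
    have h': "m0 * (cap 4 3 * sp3) = sc \<delta> (box [Double] hdown [])"
      using m1 by (simp add: s_def)
    have "sc (\<delta> * \<delta> * \<delta> * \<delta> * \<delta>) (box [Double] hdown [] * box [] cupD [Double] * box [Double] capD []) =
      (m0 * (cap 4 3 * sp3)) * (mg3 * (cup 4 1 * cup 2 0) * split) * (merge * (cap 2 2 * cap 4 3) * sp3)"
      unfolding h' cupD_left capD_right by (simp add: mult_ac)
    also have "\<dots> = m0 * (cap 4 3 * ((sp3 * mg3) * (cup 4 1 * (cup 2 0 * ((split * merge) * z)))))"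
      by (simp only: z_def s_def mult.assoc)
    also have "\<dots> = sc \<delta> (m0 * (cap 4 3 * (lad 6 0 * (lad 6 2 * (lad 6 4 * ?v)))))"
      unfolding sp3_mg3 lad_base lad0_z by (simp add: mult.assoc)
    also have "\<dots> = sc (\<delta> * \<delta> * \<delta> * \<delta>) (m0 * (cup 2 1 * z))"
      unfolding v4 by (simp add: v0[unfolded One_nat_def] m0c c3[unfolded One_nat_def] mult.assoc)
    finally have "sc (\<delta> * \<delta> * \<delta> * \<delta>) (sc \<delta> (box [Double] hdown [] * box [] cupD [Double] * box [Double] capD [])) =
       sc (\<delta> * \<delta> * \<delta> * \<delta>) (m0 * (cup 2 1 * z))"
      by (simp add: mult_ac)
    then show ?thesis
      by (subst (asm) sc_cancel) simp_all
  qed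
  have LHS: "box [Double] hdown [] * box [] (hup * hdown) [Double] * box [Double] (hup * hdown) [] = R"
  proof -
    have h': "m0 * (cap 4 3 * sp3) = sc \<delta> (box [Double] hdown [])"
      using m1 by (simp add: s_def)
    have m0c: "m0 * (cap 4 3 * (lad 6 0 * u)) = sc \<delta> (m0 * (cap 4 3 * u))" for u
      using mult_assoc_rule[OF lad_cap[of 0 3 4, symmetric], of u] m0lad by (simp add: mult.assoc eval_nat_numeral)
    let ?y = "cup 4 3 * (cap 4 3 * sp3)"
    have com: "lad 6 0 * (lad 6 2 * (lad 6 4 * ?y)) = sc \<delta> (lad 6 2 * (lad 6 4 * ?y))"
      using mult_assoc_rule[OF lad_lad[of 0 2 6]] mult_assoc_rule[OF lad_lad[of 0 4 6]] lad_crossing(2)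
      by (simp add: mult.assoc del: splits.simps)
    have com4: "lad 6 4 * (cup 4 1 * (cap 4 1 * u)) = cup 4 1 * (cap 4 1 * (lad 6 4 * u))" for u
      using mult_assoc_rule[OF cup_lad[of 1 2 4, symmetric], of "cap 4 1 * u"] mult_assoc_rule[OF cap_lad[of 1 2 4, symmetric], of u]
      by (simp add: mult.assoc eval_nat_numeral)
    have "sc (\<delta> * \<delta> * \<delta>) (box [Double] hdown [] * box [] (hup * hdown) [Double] * box [Double] (hup * hdown) []) =
      (m0 * (cap 4 3 * sp3)) * (mg3 * (cup 4 1 * cap 4 1) * sp3) * (mg3 * (cup 4 3 * cap 4 3) * sp3)"
      unfolding h' crossing_left crossing_right by (simp add: mult_ac)
    also have "\<dots> = m0 * (cap 4 3 * ((sp3 * mg3) * (cup 4 1 * (cap 4 1 * ((sp3 * mg3) * ?y)))))"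
      by (simp only: mult.assoc)
    also have "\<dots> = m0 * (cap 4 3 * (lad 6 0 * (lad 6 2 * (lad 6 4 * (cup 4 1 * (cap 4 1 * (lad 6 0 * (lad 6 2 * (lad 6 4 * ?y)))))))))"
      unfolding sp3_mg3 by (simp only: mult.assoc)
    also have "\<dots> = sc (\<delta> * \<delta>) (m0 * (cap 4 3 * (lad 6 2 * (cup 4 1 * (cap 4 1 * (lad 6 4 * (lad 6 2 * (lad 6 4 * ?y))))))))"
      unfolding com com4 m0c by (simp add: com4)
    also have "lad 6 4 * (lad 6 2 * (lad 6 4 * ?y)) = sc \<delta> (lad 6 2 * (lad 6 4 * ?y))"
      using mult_assoc_rule[OF lad_lad[of 2 4 6, symmetric], of "lad 6 4 * ?y"] mult_assoc_rule[OF lad_lad_same[of 4 6], of ?y]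
      by (simp add: mult.assoc del: splits.simps)
    finally have "sc (\<delta> * \<delta> * \<delta>) (box [Double] hdown [] * box [] (hup * hdown) [Double] * box [Double] (hup * hdown) []) =
        sc (\<delta> * \<delta> * \<delta>) R"
      by (simp add: R_def s_def del: splits.simps)
    then show ?thesis
      by (subst (asm) sc_cancel) simp_all
  qed
  show ?thesis
    using R unfolding LHS m1 m2 m3 by (simp add: sc_add add_ac)
qed

text \<open>Dividing each crossing by \<open>\<alpha>\<close> turns the common factor
  \<open>\<delta> * \<delta>\<close> into 1.\<close>

lemma hdown_crossings:
  "\<exists>A. box [Double] hdown [] * box [] xg [Double] * box [Double] xg [] =
    box [Double] hdown [] + box [Double] (cupS * capD) [] +
      box [Double] hdown [] * box [] cupD [Double] * box [Double] capD [] + A * box [] hdown [Double]"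
proof -
  let ?L = "box [Double] hdown [] * box [] (hup * hdown) [Double] * box [Double] (hup * hdown) []"
  let ?R = "box [Double] hdown [] + box [Double] (cupS * capD) [] +
      box [Double] hdown [] * box [] cupD [Double] * box [Double] capD []"
  obtain A where A: "?L - sc (\<delta> * \<delta>) ?R = A * box [] hdown [Double]"
    using hdown_crossings_aux unfolding idl_def by blast
  have "box [Double] hdown [] * box [] xg [Double] * box [Double] xg [] = sc (inverse \<alpha> * inverse \<alpha>) ?L"
    by (simp add: xg_def box_sc mult_ac)
  also have "?L = sc (\<delta> * \<delta>) ?R + A * box [] hdown [Double]"
    using A by (simp add: algebra_simps)
  also have "sc (inverse \<alpha> * inverse \<alpha>) \<dots> = sc (inverse \<alpha> * inverse \<alpha> * (\<delta> * \<delta>)) ?R +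
      sc (inverse \<alpha> * inverse \<alpha>) A * box [] hdown [Double]"
    by (simp add: sc_add)
  also have "inverse \<alpha> * inverse \<alpha> * (\<delta> * \<delta>) = 1"
    by (simp add: delta_alpha field_simps)
  finally show ?thesis
    unfolding sc_1 by blast
qed

subsection \<open>The expansion on double strands\<close>

lemma doubles_snoc: "doubles l @ [Double] = doubles (Suc l)"
  by (simp add: doubles_def flip: replicate_append_same)

lemma doubles_Cons: "doubles l @ Double # r = Double # doubles l @ r"
  by (induction l) (auto simp: doubles_Suc)

lemma doubles_comm: "Double # doubles r = doubles (Suc r)"
  by (simp add: doubles_Suc)

text \<open>\<open>l\<close> and \<open>r\<close> count the double strands on either side of the
  piece. The single cup \<open>us\<close> is what \<open>hdown\<close> makes of a double cup, and
  part of what it makes of a crossing.\<close>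

definition hh :: "nat \<Rightarrow> nat \<Rightarrow> hom" where "hh l r = box (doubles l) hdown (doubles r)"
definition xx :: "nat \<Rightarrow> nat \<Rightarrow> hom" where "xx l r = box (doubles l) xg (doubles r)"
definition cc :: "nat \<Rightarrow> nat \<Rightarrow> hom" where "cc l r = box (doubles l) capD (doubles r)"
definition uu :: "nat \<Rightarrow> nat \<Rightarrow> hom" where "uu l r = box (doubles l) cupD (doubles r)"
definition us :: "nat \<Rightarrow> nat \<Rightarrow> hom" where "us l r = box (doubles l) cupS (doubles r)"
abbreviation idd :: "nat \<Rightarrow> hom" where "idd n \<equiv> idn (doubles n)"
abbreviation ww :: "nat \<Rightarrow> nat \<Rightarrow> word" where "ww l r \<equiv> doubles l @ [Single, Single] @ doubles r"

lemma doubles_mid: "doubles l @ [Double, Double] @ doubles r = doubles (l + r + 2)"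
  using doubles_add[of l "Suc (Suc r)"] by (simp add: doubles_Suc)

lemma hh_Hm: "hh l r \<in> Hm (doubles (l + r + 2)) (ww l r)"
  and xx_Hm: "xx l r \<in> Hm (doubles (l + r + 2)) (doubles (l + r + 2))"
  and cc_Hm: "cc l r \<in> Hm (doubles (l + r + 2)) (doubles (l + r))"
  and uu_Hm: "uu l r \<in> Hm (doubles (l + r)) (doubles (l + r + 2))"
  and us_Hm: "us l r \<in> Hm (doubles (l + r)) (ww l r)"
  unfolding hh_def xx_def cc_def uu_def us_def
  using Hm_box[OF hdown_Hm, of "doubles l" "doubles r"] Hm_box[OF xg_Hm, of "doubles l" "doubles r"]
    Hm_box[OF gen_typed(2), of "doubles l" "doubles r"]
    Hm_box[OF gen_typed(3), of "doubles l" "doubles r"] Hm_box[OF gen_typed(4), of "doubles l" "doubles r"]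
  by (simp_all only: doubles_mid append_Nil doubles_add)

lemma hh_xx: "hh l r * (xx l r * z) = sc (2 - \<alpha>) (hh l r * z) + sc (1 - \<alpha>) (us l r * (cc l r * z))"
  using mult_assoc_rule[OF box_comp[OF hdown_xg, of "doubles l" "doubles r"], of z]
  by (simp add: hh_def xx_def us_def cc_def box_add box_sc box_mult distrib_right mult.assoc)

lemma hh_uu: "hh l r * (uu l r * z) = sc (1 - \<theta>) (us l r * z)"
  using mult_assoc_rule[OF box_comp[OF hdown_cupD, of "doubles l" "doubles r"], of z]
  by (simp add: hh_def uu_def us_def box_sc)

lemma xx_hh: "hh l r * z = 0 \<Longrightarrow> xx l r * z = 0"
  by (simp add: hh_def xx_def xg_def box_sc box_mult mult.assoc)

lemma cc_rotation: "cc (Suc l) r * (xx l (Suc r) * z) = cc l (Suc r) * (xx (Suc l) r * z)"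
  using mult_assoc_rule[OF arg_cong[OF cap_rotation, of "\<lambda>x. box (doubles l) x (doubles r)", unfolded box_mult], of z]
  by (simp add: cc_def xx_def doubles_snoc doubles_comm mult.assoc)

lemma uu_rotation: "xx l (Suc r) * (uu (Suc l) r * z) = xx (Suc l) r * (uu l (Suc r) * z)"
  using mult_assoc_rule[OF arg_cong[OF cup_rotation, of "\<lambda>x. box (doubles l) x (doubles r)", unfolded box_mult], of z]
  by (simp add: uu_def xx_def doubles_snoc doubles_comm mult.assoc)

lemma cc_uu_right: "cc l (Suc r) * uu (Suc l) r = idd (Suc (l + r))"
  using box_comp[OF zigzag_right[of Double], of "doubles l" "doubles r"] doubles_add[of l "Suc r"]
  by (simp add: cc_def uu_def doubles_snoc doubles_comm)

lemma cc_uu_left: "cc (Suc l) r * uu l (Suc r) = idd (Suc (l + r))"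
  using box_comp[OF zigzag_left[of Double], of "doubles l" "doubles r"] doubles_add[of l "Suc r"]
  by (simp add: cc_def uu_def doubles_snoc doubles_comm)

lemma hh_xx_xx:
  assumes "hh l (Suc r) * z = 0"
  shows "hh (Suc l) r * (xx l (Suc r) * (xx (Suc l) r * z)) =
    hh (Suc l) r * z + us (Suc l) r * (cc (Suc l) r * z) + hh (Suc l) r * (uu l (Suc r) * (cc (Suc l) r * z))"
proof -
  obtain A where A: "box [Double] hdown [] * box [] xg [Double] * box [Double] xg [] =
    box [Double] hdown [] + box [Double] (cupS * capD) [] +
      box [Double] hdown [] * box [] cupD [Double] * box [Double] capD [] + A * box [] hdown [Double]"
    using hdown_crossings by blast
  have "box (doubles l) A (doubles r) * (hh l (Suc r) * z) = 0"
    using assms by simp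
  then show ?thesis
    using arg_cong[OF A, of "\<lambda>x. box (doubles l) x (doubles r) * z"]
    by (simp add: hh_def xx_def cc_def uu_def us_def doubles_snoc doubles_comm box_add box_mult distrib_right mult.assoc)
qed

text \<open>The sum \<open>[2k] + [2k - 2] x + [2k - 4] x x + \<dots>\<close> that collects the terms \<open>D\<^sub>i\<^sub>,\<^sub>j\<close> with a common
  \<open>i\<close>: a strand coming from the right crosses \<open>0, 1, 2, \<dots>\<close> strands to its left.\<close>

fun vv :: "nat \<Rightarrow> hom" where
  "vv 0 = 0"
| "vv (Suc k) = sc (qint (2 * int (Suc k))) (idd (Suc k)) + box [] (vv k) [Double] * xx (k - 1) 0"

lemma vv_Hm: "vv k \<in> Hm (doubles k) (doubles k)"
proof (induction k)
  case (Suc k)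
  show ?case
  proof (cases k)
    case 0
    then show ?thesis
      by (auto simp: box_0)
  next
    case (Suc k')
    have "box [] (vv k) [Double] \<in> Hm (doubles (Suc k)) (doubles (Suc k))"
      using Hm_box[OF Suc.IH, of "[]" "[Double]"] by (simp add: doubles_snoc)
    moreover have "xx (k - 1) 0 \<in> Hm (doubles (Suc k)) (doubles (Suc k))"
      using xx_Hm[of k' 0] Suc by simp
    ultimately show ?thesis
      by (auto intro: Hm_mult)
  qed
qed simp

definition VV :: "nat \<Rightarrow> nat \<Rightarrow> hom" where
  "VV k r = box [] (vv k) (doubles r)"

lemma VV_0 [simp]: "VV 0 r = 0"
  by (simp add: VV_def)

lemma VV_1: "VV (Suc 0) r = sc (qint 2) (idd (Suc r))"
  by (simp add: VV_def box_add box_sc doubles_Suc)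

lemma VV_Suc: "VV (Suc (Suc k)) r = sc (qint (2 * int (Suc (Suc k)))) (idd (k + r + 2)) + VV (Suc k) (Suc r) * xx k r"
  using doubles_add[of "Suc (Suc k)" r]
  by (simp add: VV_def xx_def box_add box_sc box_mult doubles_comm)

lemma VV_Hm: "VV k r \<in> Hm (doubles (k + r)) (doubles (k + r))"
  using Hm_box[OF vv_Hm, of "[]" k "doubles r"] by (simp add: VV_def doubles_add)

text \<open>Every term of \<open>VV k r\<close> except the leading one has the same lowest crossing,
  and that crossing factors through an \<open>hdown\<close> that kills \<open>z\<close>.\<close>

lemma VV_kill:
  assumes "z \<in> Hm t (doubles (k + r))" "\<And>l. k = l + 2 \<Longrightarrow> hh l r * z = 0"
  shows "VV k r * z = sc (qint (2 * int k)) z"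
proof (cases k)
  case 0
  then show ?thesis by (simp add: qint_def)
next
  case (Suc k1)
  show ?thesis
  proof (cases k1)
    case 0
    then show ?thesis
      using Suc assms idn_mult(1)[OF assms(1)] by (simp add: VV_1)
  next
    case (Suc k2)
    then show ?thesis
      using \<open>k = Suc k1\<close> assms xx_hh[OF assms(2)[of k2]] idn_mult(1)[OF assms(1)]
      by (simp add: VV_Suc distrib_right mult.assoc)
  qed
qed

lemma hh_VV: "hh l r * VV l (r + 2) = box [] (vv l) ([Single, Single] @ doubles r) * hh l r"
  using exchange[OF vv_Hm[of l] hdown_Hm, of "[]" "[]" "doubles r"]
  by (simp add: hh_def VV_def doubles_Suc)

lemma us_VV: "us l r * VV l r = box [] (vv l) ([Single, Single] @ doubles r) * us l r"
  using exchange[OF vv_Hm[of l] gen_typed(2), of "[]" "[]" "doubles r"]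
  by (simp add: us_def VV_def)

lemma cc_VV: "cc l r * VV l (r + 2) = VV l r * cc l r"
  using exchange[OF vv_Hm[of l] gen_typed(3), of "[]" "[]" "doubles r"]
  by (simp add: cc_def VV_def doubles_Suc)

section \<open>Pieces disjoint from \<open>hdown\<close>\<close>

lemma hh_right:
  assumes "y \<in> Hm (doubles a) (doubles b)"
  shows "hh l (m + b + r) * box (doubles (l + 2 + m)) y (doubles r) =
    box (doubles l @ [Single, Single] @ doubles m) y (doubles r) * hh l (m + a + r)"
  using exchange[OF hdown_Hm assms, of "doubles l" "doubles m" "doubles r"]
  by (simp add: hh_def doubles_add doubles_Suc doubles_Cons)

lemma hh_left:
  assumes "y \<in> Hm (doubles a) (doubles b)"
  shows "hh (l + b + m) r * box (doubles l) y (doubles (m + 2 + r)) =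
    box (doubles l) y (doubles m @ [Single, Single] @ doubles r) * hh (l + a + m) r"
  using exchange[OF assms hdown_Hm, of "doubles l" "doubles m" "doubles r"]
  by (simp add: hh_def doubles_add doubles_Suc doubles_Cons)

lemma hh_xx_far: "i + 2 \<le> r \<Longrightarrow> hh l r * z = 0 \<Longrightarrow> hh l r * (xx (l + r - i) i * z) = 0"
proof -
  assume "i + 2 \<le> r" "hh l r * z = 0"
  then obtain m where m: "r = m + 2 + i"
    by (metis add.commute add.left_commute le_iff_add)
  show ?thesis
    using mult_assoc_rule[OF hh_right[of xg 2 2 l m i], of z] \<open>hh l r * z = 0\<close> m xg_Hm
    by (simp add: xx_def doubles_def eval_nat_numeral mult.assoc)
qed

lemma hh_uu_right: "hh l (m + r) * z = 0 \<Longrightarrow> hh l (m + 2 + r) * (uu (l + 2 + m) r * z) = 0"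
  using mult_assoc_rule[OF hh_right[of cupD 0 2 l m r], of z] gen_typed(4)
  by (simp add: uu_def doubles_def eval_nat_numeral mult.assoc)

lemma hh_cc_right: "hh l (m + 2 + r) * z = 0 \<Longrightarrow> hh l (m + r) * (cc (l + 2 + m) r * z) = 0"
  using mult_assoc_rule[OF hh_right[of capD 2 0 l m r], of z] gen_typed(3)
  by (simp add: cc_def doubles_def eval_nat_numeral mult.assoc)

lemma hh_uu_left: "hh (l + m) r * z = 0 \<Longrightarrow> hh (l + 2 + m) r * (uu l (m + 2 + r) * z) = 0"
  using mult_assoc_rule[OF hh_left[of cupD 0 2 l m r], of z] gen_typed(4)
  by (simp add: uu_def doubles_def eval_nat_numeral mult.assoc)

lemma hh_VV_left: "hh (k + m) r * z = 0 \<Longrightarrow> hh (k + m) r * (VV k (m + 2 + r) * z) = 0"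
  using mult_assoc_rule[OF hh_left[OF vv_Hm[of k], of 0 m r], of z]
  by (simp add: VV_def mult.assoc)

subsection \<open>Annihilation of the expansion by \<open>hdown\<close>\<close>

lemma qint_eq: "qint k = (qhalf powi k - inverse qhalf powi k) / (qhalf - inverse qhalf)"
  by (simp add: qint_def power_int_minus power_int_inverse)

lemma qint_0 [simp]: "qint 0 = 0"
  by (simp add: qint_def)

lemma qint_2: "qint 2 = qhalf + inverse qhalf"
  using qhalf_diff by (simp add: qint_def power_int_minus power_inverse
      nonzero_divide_eq_eq power2_eq_square algebra_simps)

text \<open>\<open>\<alpha> - 2\<close> equals \<open>q + 1/q\<close>, and both powers in
  \<open>qint k\<close> satisfy this recurrence.\<close>

lemma qint_rec: "qint (k + 2) + qint (k - 2) = (\<alpha> - 2) * qint k"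
proof -
  define t s where "t = qhalf" and "s = inverse qhalf"
  have ts: "t * s = 1" "t \<noteq> 0" "s \<noteq> 0"
    using qhalf_nonzero by (auto simp: t_def s_def)
  have q2: "qint 2 = t + s"
    by (simp add: qint_2 t_def s_def)
  have "t powi (k + 2) + t powi (k - 2) = (t\<^sup>2 + s\<^sup>2) * t powi k" if "t * s = 1" "t \<noteq> 0" for t s :: scalar
  proof -
    have "s\<^sup>2 * t\<^sup>2 = 1"
      using that by (simp add: power_mult_distrib[symmetric] mult.commute)
    then have "t powi (k - 2) = s\<^sup>2 * t powi k"
      using that by (simp add: power_int_diff field_simps)
    then show ?thesis
      using that by (simp add: power_int_add field_simps)
  qed
  from this[of t s] this[of s t] ts
  have "(t powi (k + 2) - s powi (k + 2)) + (t powi (k - 2) - s powi (k - 2)) = (t\<^sup>2 + s\<^sup>2) * (t powi k - s powi k)"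
    by (simp add: algebra_simps)
  moreover have "t\<^sup>2 + s\<^sup>2 = \<alpha> - 2"
    using ts by (simp add: \<alpha>_def q2 power2_eq_square algebra_simps)
  ultimately show ?thesis
    by (simp add: qint_eq t_def s_def add_divide_distrib[symmetric])
qed

text \<open>The condition for the single-cup terms to cancel in \<open>hh_QQ\<close>. After clearing
  \<open>t - s\<close> it is a polynomial identity in \<open>t\<close>, \<open>s\<close>,
  \<open>p\<close>, \<open>q\<close> modulo \<open>t * s = 1\<close>.\<close>

lemma loop_scalars:
  "qint (k + 4) * ((1 - \<alpha>) * qint (k + 1) + qint (k - 1)) +
   qint (k + 2) * ((1 - \<theta>) * qint (k + 1) + (1 - \<alpha>) * qint (k - 1)) = 0"
proof -
  define t s where "t = qhalf" and "s = inverse qhalf"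
  define p q where "p = t powi k" and "q = s powi k"
  have ts: "t * s = 1" "t \<noteq> 0" "s \<noteq> 0"
    using qhalf_nonzero by (auto simp: t_def s_def)
  have a: "\<alpha> = (t + s)\<^sup>2"
    by (simp add: \<alpha>_def qint_2 t_def s_def)
  have th: "\<theta> = 3 * (t + s)\<^sup>2 - ((t + s)\<^sup>2)\<^sup>2"
    by (simp add: theta_alpha a)
  have q: "(t - s) * qint j = t powi j - s powi j" for j
    using qhalf_diff by (simp add: qint_eq t_def s_def)
  have 4: "(t - s) * qint (k + 4) = p * t ^ 4 - q * s ^ 4"
    and 2: "(t - s) * qint (k + 2) = p * t\<^sup>2 - q * s\<^sup>2"
    and 1: "(t - s) * qint (k + 1) = p * t - q * s"
    using ts by (simp_all add: q p_def q_def power_int_add)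
  have "t powi (k - 1) = p * s" "s powi (k - 1) = q * t"
    using ts by (simp_all add: p_def q_def power_int_diff nonzero_divide_eq_eq mult.assoc mult.commute[of s t])
  then have 0: "(t - s) * qint (k - 1) = p * s - q * t"
    by (simp add: q)
  have "(p * t ^ 4 - q * s ^ 4) * ((1 - (t + s)\<^sup>2) * (p * t - q * s) + (p * s - q * t)) +
      (p * t\<^sup>2 - q * s\<^sup>2) * ((1 - (3 * (t + s)\<^sup>2 - ((t + s)\<^sup>2)\<^sup>2)) * (p * t - q * s) + (1 - (t + s)\<^sup>2) * (p * s - q * t)) = 0"
    using ts(1) by algebra
  then have "((t - s) * (t - s)) * (qint (k + 4) * ((1 - \<alpha>) * qint (k + 1) + qint (k - 1)) +
      qint (k + 2) * ((1 - \<theta>) * qint (k + 1) + (1 - \<alpha>) * qint (k - 1))) = 0"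
    unfolding 4[symmetric] 2[symmetric] 1[symmetric] 0[symmetric] a[symmetric] theta_alpha[symmetric]
    by (simp add: algebra_simps)
  then show ?thesis
    using qhalf_diff by (simp add: t_def s_def)
qed

text \<open>Unfolding \<open>VV\<close> twice gives summands with no, one and at least two crossings
  next to \<open>hdown\<close>. Their multiples of \<open>hh l r * z\<close> have coefficients
  \<open>[2l + 4]\<close>, \<open>(2 - \<alpha>) [2l + 2]\<close> and \<open>[2l]\<close>, whose sum
  is 0; only the cap terms of \<open>hh_xx\<close> and \<open>hh_xx_xx\<close> remain.\<close>

lemma VV_step:
  assumes z: "z \<in> Hm t (doubles (l + r + 2))"
    and kill: "\<And>l' r'. l' + r' = l + r \<Longrightarrow> r < r' \<Longrightarrow> hh l' r' * z = 0"
  shows "hh l r * (VV (l + 2) r * z) =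
    sc ((1 - \<alpha>) * qint (2 * int l + 2) + qint (2 * int l)) (us l r * (cc l r * z)) +
    hh l r * (VV l (r + 2) * (uu (l - 1) (r + 1) * (cc l r * z)))"
proof -
  have rec: "qint (2 * int (Suc (Suc l))) + (2 - \<alpha>) * qint (2 * int (Suc l)) + qint (2 * int l) = 0"
    using qint_rec[of "2 * int (Suc l)"] by (simp add: algebra_simps)
  have V2: "hh l r * (VV (l + 2) r * z) = sc (qint (2 * int (Suc (Suc l)))) (hh l r * z) +
      hh l r * (VV (Suc l) (Suc r) * (xx l r * z))"
    using VV_Suc[of l r] idn_mult(1)[OF z] by (simp add: distrib_left distrib_right mult.assoc)
  have xz: "xx l r * z \<in> Hm t (doubles (l + r + 2))"
    using xx_Hm z by (rule Hm_mult)
  have cz: "cc l r * z \<in> Hm t (doubles (l + r))"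
    using cc_Hm z by (rule Hm_mult)
  show ?thesis
  proof (cases l)
    \<comment> \<open>There is no second unfolding here. The formula stays valid because
      \<open>qint 0 = 0\<close>, and \<open>VV 0 = 0\<close> makes the truncated
      \<open>l - 1\<close> harmless.\<close>
    case 0
    have "hh l r * (VV (Suc l) (Suc r) * (xx l r * z)) = sc (qint 2) (hh l r * (xx l r * z))"
      using 0 idn_mult(1)[OF xz] by (simp add: VV_1)
    then have "hh l r * (VV (l + 2) r * z) =
       sc (qint (2 * int (Suc (Suc l))) + (2 - \<alpha>) * qint (2 * int (Suc l)) + qint (2 * int l)) (hh l r * z) +
       sc (qint 2 * (1 - \<alpha>)) (us l r * (cc l r * z))"
      unfolding V2 hh_xx using 0 by (simp add: sc_add sc_add_left mult.commute)
    then show ?thesis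
      unfolding rec using 0 by (simp add: mult.commute)
  next
    case (Suc l1)
    have k1: "hh l1 (Suc r) * z = 0"
      using kill[of l1 "Suc r"] Suc by simp
    have Vz: "VV l (r + 2) * z = sc (qint (2 * int l)) z"
    proof (rule VV_kill)
      show "z \<in> Hm t (doubles (l + (r + 2)))"
        using z by (simp add: add.assoc)
      show "hh l' (r + 2) * z = 0" if "l = l' + 2" for l'
        using kill[of l' "r + 2"] that by simp
    qed
    let ?v = "box [] (vv l) ([Single, Single] @ doubles r)"
    have "hh l r * (VV (Suc l) (Suc r) * (xx l r * z)) = sc (qint (2 * int (Suc l))) (hh l r * (xx l r * z)) +
        hh l r * (VV l (r + 2) * (xx l1 (Suc r) * (xx l r * z)))"
      using VV_Suc[of l1 "Suc r"] Suc idn_mult(1)[OF xz] by (simp add: distrib_left distrib_right mult.assoc)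
    also have "hh l r * (VV l (r + 2) * (xx l1 (Suc r) * (xx l r * z))) =
        ?v * (hh l r * (xx l1 (Suc r) * (xx l r * z)))"
      using mult_assoc_rule[OF hh_VV] by (simp add: mult.assoc)
    also have "hh l r * (xx l1 (Suc r) * (xx l r * z)) =
        hh l r * z + us l r * (cc l r * z) + hh l r * (uu l1 (Suc r) * (cc l r * z))"
      using hh_xx_xx[OF k1] Suc by simp
    also have "?v * \<dots> = hh l r * (VV l (r + 2) * z) + us l r * (VV l r * (cc l r * z)) +
        hh l r * (VV l (r + 2) * (uu l1 (Suc r) * (cc l r * z)))"
      using mult_assoc_rule[OF hh_VV] mult_assoc_rule[OF us_VV] by (simp add: distrib_left mult.assoc)
    also have "VV l r * (cc l r * z) = cc l r * (VV l (r + 2) * z)"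
      using mult_assoc_rule[OF cc_VV] by (simp add: mult.assoc)
    finally have "hh l r * (VV (l + 2) r * z) =
       sc (qint (2 * int (Suc (Suc l))) + (2 - \<alpha>) * qint (2 * int (Suc l)) + qint (2 * int l)) (hh l r * z) +
       sc ((1 - \<alpha>) * qint (2 * int l + 2) + qint (2 * int l)) (us l r * (cc l r * z)) +
       hh l r * (VV l (r + 2) * (uu l1 (Suc r) * (cc l r * z)))"
      unfolding V2 hh_xx Vz by (simp add: sc_add sc_add_left sc_diff sc_diff_left algebra_simps)
    then show ?thesis
      unfolding rec using Suc by simp
  qed
qed

text \<open>The strand comes from the right of \<open>hdown\<close>. Crossings met before
  \<open>hdown\<close> are moved into \<open>z\<close> one at a time, which shrinks the range where
  \<open>z\<close> is killed by one place; on arrival \<open>VV_step\<close> applies.\<close>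

lemma VV_far:
  assumes "z \<in> Hm t (doubles (l + r + 2))" "i < r"
    and "\<And>l' r'. l' + r' = l + r \<Longrightarrow> i < r' \<Longrightarrow> hh l' r' * z = 0"
  shows "hh l r * (VV (l + r + 2 - i) i * z) = 0"
  using assms
proof (induction "r - i" arbitrary: i z)
  case 0
  then show ?case by simp
next
  case (Suc d)
  define k where "k = l + r - i"
  have k: "l + r + 2 - i = Suc (Suc k)" "k + i = l + r" "Suc k = l + r + 2 - Suc i"
    using Suc.prems by (auto simp: k_def)
  let ?z = "xx k i * z"
  have zH: "?z \<in> Hm t (doubles (l + r + 2))"
    using Hm_mult[OF xx_Hm[of k i]] Suc.prems(1) k by simp
  have kill: "hh l' r' * ?z = 0" if "l' + r' = l + r" "Suc i < r'" for l' r'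
    using hh_xx_far[of i r' l' z] Suc.prems(3)[of l' r'] that k by (simp add: k_def)
  have "hh l r * z = 0"
    using Suc.prems by simp
  then have e: "hh l r * (VV (l + r + 2 - i) i * z) = hh l r * (VV (Suc k) (Suc i) * ?z)"
    using VV_Suc[of k i] k Suc.prems(1) idn_mult(1)[OF Suc.prems(1)]
    by (simp add: distrib_left distrib_right mult.assoc)
  show ?case
  proof (cases "Suc i < r")
    case True
    then have "hh l r * (VV (l + r + 2 - Suc i) (Suc i) * ?z) = 0"
      using Suc zH kill by (intro Suc.hyps(1)) auto
    then show ?thesis
      using e k by simp
  next
    case False
    then have r: "r = Suc i" "k = Suc l"
      using Suc.prems k by auto
    \<comment> \<open>Rotating the last crossing exchanges it for one on the neighbouring pair,
      where \<open>z\<close> is killed.\<close>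
    have "cc l r * ?z = 0"
      using cc_rotation[of l i z] xx_hh[of l "Suc i" z] Suc.prems(3)[of l r] r by simp
    then show ?thesis
      using VV_step[OF zH kill] r e by simp
  qed
qed

definition ZZ :: "nat \<Rightarrow> hom \<Rightarrow> nat \<Rightarrow> hom" where
  "ZZ n G i = (if i = 0 then G else uu (n - 1 - i) (i - 1) * (cc (n - 2) 0 * G))"

text \<open>The expansion cleared of its denominator \<open>[2n] [2n + 1]\<close>; the sum over
  \<open>j\<close> is contained in \<open>VV\<close>.\<close>

definition QQ :: "nat \<Rightarrow> hom \<Rightarrow> hom" where
  "QQ n G = (\<Sum>i<n. sc (qint (2 * int n + 1 - 2 * int i)) (VV (n - i) i * ZZ n G i))"

text \<open>For \<open>l = 0\<close> the index \<open>r + 2\<close> lies outside the range of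
  summation, hence the last assumption.\<close>

lemma sum_three:
  fixes f :: "nat \<Rightarrow> 'a::comm_monoid_add"
  assumes "\<And>i. i < r \<Longrightarrow> f i = 0" "\<And>i. i > r + 2 \<Longrightarrow> f i = 0" "l = 0 \<Longrightarrow> f (r + 2) = 0"
  shows "(\<Sum>i<l + r + 2. f i) = f r + f (r + 1) + f (r + 2)"
proof -
  have "(\<Sum>i<l + r + 2. f i) = (\<Sum>i\<in>{r, r + 1, r + 2}. f i)"
  proof (rule sum.mono_neutral_cong)
    show "f i = 0" if "i \<in> {..<l + r + 2} - {r, r + 1, r + 2}" for i
    proof -
      have "i < r \<or> r + 2 < i"
        using that by (simp; arith)
      then show ?thesis using assms(1,2) by auto
    qed
    show "f i = 0" if "i \<in> {r, r + 1, r + 2} - {..<l + r + 2}" for i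
      using that assms(3) by auto
  qed auto
  then show ?thesis
    by (simp add: add.assoc)
qed

text \<open>For \<open>i < r\<close> the strand passes \<open>hdown\<close> completely and
  \<open>VV_far\<close> applies; for \<open>i > r + 2\<close> it stays to the left and
  \<open>hdown\<close> sinks to \<open>C\<close>. The middle terms are multiples of only two webs,
  \<open>us l r * C\<close> and \<open>T\<close>, with total coefficients 0 by
  \<open>loop_scalars\<close> and by \<open>qint_rec\<close>.\<close>

lemma hh_QQ:
  assumes n: "n = l + r + 2" and G: "G \<in> Hm (doubles n) (doubles n)"
    and kill: "\<And>l' r'. l' + r' = l + r \<Longrightarrow> r' > 0 \<Longrightarrow> hh l' r' * G = 0"
  shows "hh l r * QQ n G = 0"
proof -
  define C where "C = cc (l + r) 0 * G"
  define Z where "Z = ZZ n G"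
  have Z0: "Z 0 = G" and ZSuc: "Z (Suc i) = uu (l + r - i) i * C" for i
    by (simp_all add: Z_def ZZ_def C_def n)
  have C_Hm: "C \<in> Hm (doubles n) (doubles (l + r))"
    using Hm_mult[OF cc_Hm[of "l + r" 0]] G n by (simp add: C_def)
  \<comment> \<open>The cap takes the two rightmost strands, so \<open>hdown\<close> passes it and
    reaches \<open>G\<close> with at least two strands on its right.\<close>
  have killC: "hh l' r' * C = 0" if "l' + 2 + r' = l + r" for l' r'
    using hh_cc_right[of l' r' 0 G] kill[of l' "r' + 2"] that by (simp add: C_def ac_simps)
  have Z_Hm: "Z i \<in> Hm (doubles n) (doubles n)" if "i < n" for i
  proof (cases i)
    case (Suc i')
    then show ?thesis
      using that Hm_mult[OF uu_Hm[of "l + r - i'" i'], of C "doubles n"] C_Hm n by (simp add: ZSuc)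
  qed (simp add: Z0 G)
  have killZ: "hh l' r' * Z i = 0" if "l' + r' = l + r" "i < r'" for l' r' i
  proof (cases i)
    case 0
    then show ?thesis using kill[of l' r'] that by (simp add: Z0)
  next
    case (Suc i')
    define m where "m = r' - Suc (Suc i')"
    have r': "r' = m + 2 + i'"
      using that Suc by (simp add: m_def)
    show ?thesis
    proof -
      have "hh l' (m + 2 + i') * (uu (l' + 2 + m) i' * C) = 0"
        by (rule hh_uu_right, rule killC) (use that r' in simp)
      moreover have "l + r - i' = l' + 2 + m"
        using that r' by simp
      ultimately show ?thesis
        by (simp only: r' Suc ZSuc)
    qed
  qed
  have CZ: "cc l r * Z r = C"
  proof (cases r)
    case 0
    then show ?thesis by (simp add: Z0 C_def)
  next
    case (Suc r1)
    then show ?thesis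
      using mult_assoc_rule[OF cc_uu_right[of l r1], of C] idn_mult(1)[OF C_Hm]
      by (simp add: ZSuc)
  qed
  define T where "T = hh l r * (VV l (r + 2) * (uu (l - 1) (r + 1) * C))"
  define f where "f i = hh l r * (VV (n - i) i * Z i)" for i
  have f_r: "f r = sc ((1 - \<alpha>) * qint (2 * int l + 2) + qint (2 * int l)) (us l r * C) + T"
  proof -
    have "Z r \<in> Hm (doubles n) (doubles (l + r + 2))"
      using Z_Hm[of r] n by simp
    from VV_step[OF this killZ] show ?thesis
      using n by (simp add: f_def T_def CZ)
  qed
  have f_r1: "f (r + 1) = sc ((1 - \<theta>) * qint (2 * int l + 2) + (1 - \<alpha>) * qint (2 * int l)) (us l r * C) + sc (2 - \<alpha>) T"
  proof -
    have f1: "f (Suc r) = hh l r * (VV (Suc l) (Suc r) * (uu l r * C))"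
      using n by (simp add: f_def ZSuc)
    have uC: "uu l r * C \<in> Hm (doubles n) (doubles (l + r + 2))"
      using uu_Hm C_Hm by (rule Hm_mult)
    show ?thesis
    proof (cases l)
      case 0
      then have "VV (Suc l) (Suc r) * (uu l r * C) = sc (qint 2) (uu l r * C)"
        using idn_mult(1)[OF uC] by (simp add: VV_1)
      then show ?thesis
        using 0 by (simp add: f1 hh_uu T_def mult.commute)
    next
      case (Suc l1)
      let ?v = "box [] (vv l) ([Single, Single] @ doubles r)"
      have "VV (Suc l) (Suc r) * (uu l r * C) = sc (qint (2 * int (Suc l))) (uu l r * C) +
          VV l (r + 2) * (xx l1 (Suc r) * (uu l r * C))"
        using VV_Suc[of l1 "Suc r"] Suc idn_mult(1)[OF uC] by (simp add: distrib_right mult.assoc)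
      \<comment> \<open>Rotation moves the crossing to the pair of strands on which
        \<open>hdown\<close> acts, and the cup one place to the left, which gives the web
        \<open>T\<close>.\<close>
      also have "xx l1 (Suc r) * (uu l r * C) = xx l r * (uu l1 (Suc r) * C)"
        using uu_rotation[of l1 r C] Suc by simp
      finally have "f (r + 1) = sc (qint (2 * int (Suc l)) * (1 - \<theta>)) (us l r * C) +
          hh l r * (VV l (r + 2) * (xx l r * (uu l1 (Suc r) * C)))"
        by (simp add: f1 distrib_left hh_uu)
      also have "hh l r * (VV l (r + 2) * (xx l r * (uu l1 (Suc r) * C))) =
          ?v * (hh l r * (xx l r * (uu l1 (Suc r) * C)))"
        using mult_assoc_rule[OF hh_VV] by (simp add: mult.assoc)
      also have "\<dots> = sc (2 - \<alpha>) (hh l r * (VV l (r + 2) * (uu l1 (Suc r) * C))) +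
          sc (1 - \<alpha>) (us l r * (VV l r * (cc l r * (uu l1 (Suc r) * C))))"
        unfolding hh_xx using mult_assoc_rule[OF hh_VV] mult_assoc_rule[OF us_VV]
        by (simp add: distrib_left mult.assoc)
      also have "cc l r * (uu l1 (Suc r) * C) = C"
        using mult_assoc_rule[OF cc_uu_left[of l1 r], of C] Suc idn_mult(1)[OF C_Hm] by simp
      also have "VV l r * C = sc (qint (2 * int l)) C"
        using C_Hm killC by (intro VV_kill) auto
      finally show ?thesis
        using Suc by (simp add: T_def sc_add_left sc_diff_left algebra_simps)
    qed
  qed
  have f_r2: "f (r + 2) = T"
    using n by (cases l) (simp_all add: f_def T_def ZSuc numeral_2_eq_2)
  have f_low: "f i = 0" if "i < r" for i
  proof -
    have "hh l r * (VV (l + r + 2 - i) i * Z i) = 0"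
      using that n Z_Hm[of i] by (intro VV_far[of _ "doubles n"] killZ) (auto simp: add.commute)
    then show ?thesis
      by (simp add: f_def n)
  qed
  have f_high: "f i = 0" if high: "i > r + 2" for i
  proof (cases "i < n")
    case False
    then show ?thesis by (simp add: f_def)
  next
    case True
    obtain m where m: "i = r + 2 + Suc m"
      using less_imp_Suc_add[OF high] by auto
    define k where "k = l - Suc m"
    have k: "n - i = k" "l = k + Suc m" "k > 0"
      using m True n by (auto simp: k_def)
    obtain k1 where k1: "k = Suc k1"
      using k by (cases k) auto
    have "hh (k1 + m) r * C = 0"
      using k k1 by (intro killC) simp
    then have "hh (k1 + 2 + m) r * (uu k1 (m + 2 + r) * C) = 0"
      by (rule hh_uu_left)
    moreover have "Z i = uu k1 (m + 2 + r) * C"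
      using ZSuc[of "m + 2 + r"] m k k1 by (simp add: ac_simps)
    ultimately have "hh (k + Suc m) r * Z i = 0"
      using k1 by simp
    then have "hh (k + Suc m) r * (VV k (Suc m + 2 + r) * Z i) = 0"
      by (rule hh_VV_left)
    then show ?thesis
      using k m by (simp add: f_def ac_simps)
  qed
  have T0: "l = 0 \<Longrightarrow> T = 0"
    by (simp add: T_def)
  define F where "F i = sc (qint (2 * int n + 1 - 2 * int i)) (f i)" for i
  have "hh l r * QQ n G = (\<Sum>i<l + r + 2. F i)"
    unfolding QQ_def Z_def[symmetric] sum_distrib_left F_def f_def n[symmetric] by simp
  also have "\<dots> = F r + F (r + 1) + F (r + 2)"
    by (rule sum_three) (use f_low f_high f_r2 T0 in \<open>auto simp: F_def\<close>)
  also have "\<dots> = sc (qint (2 * int l + 5)) (f r) + sc (qint (2 * int l + 3)) (f (r + 1)) + sc (qint (2 * int l + 1)) (f (r + 2))"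
    by (simp add: F_def n algebra_simps)
  also have "\<dots> = sc (qint (2 * int l + 5) * ((1 - \<alpha>) * qint (2 * int l + 2) + qint (2 * int l)) +
      qint (2 * int l + 3) * ((1 - \<theta>) * qint (2 * int l + 2) + (1 - \<alpha>) * qint (2 * int l))) (us l r * C) +
      sc (qint (2 * int l + 5) + qint (2 * int l + 3) * (2 - \<alpha>) + qint (2 * int l + 1)) T"
    unfolding f_r f_r1 f_r2 by (simp add: sc_add sc_add_left distrib_left add_ac)
  also have "qint (2 * int l + 5) * ((1 - \<alpha>) * qint (2 * int l + 2) + qint (2 * int l)) +
      qint (2 * int l + 3) * ((1 - \<theta>) * qint (2 * int l + 2) + (1 - \<alpha>) * qint (2 * int l)) = 0"
    using loop_scalars[of "2 * int l + 1"] by (simp add: algebra_simps)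
  also have "qint (2 * int l + 5) + qint (2 * int l + 3) * (2 - \<alpha>) + qint (2 * int l + 1) = 0"
    using qint_rec[of "2 * int l + 3"] by (simp add: algebra_simps)
  finally show ?thesis
    by simp
qed

subsection \<open>Clasps\<close>

lemma low_kill:
  assumes "low n x" "\<And>p. p + 2 \<le> n \<Longrightarrow> hdown_at n p * y = 0"
  shows "x * y = 0"
  using assms(1) by (induction rule: low.induct) (auto simp: distrib_right mult.assoc assms(2))

lemma hdown_at_hh: "p + 2 \<le> n \<Longrightarrow> hdown_at n p = hh p (n - p - 2)"
  by (simp add: hdown_at_def hh_def)

lemma weight_less_ww: "weight_less (word_weight (ww l r)) (word_weight (doubles (l + r + 2)))"
  using weight_less.step2[of 0 "int (l + r + 2)"] by (simp add: word_weight_def)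

lemma weight_less_ww': "weight_less (word_weight (ww l r @ [Double])) (word_weight (doubles (Suc (l + r + 2))))"
  using weight_less.step2[of 0 "int (Suc (l + r + 2))"] by (simp add: word_weight_def)

context
  fixes n :: nat and P :: lin
  assumes P: "is_clasp (doubles n) P"
begin

lemma clasp_Hm: "cls P \<in> Hm (doubles n) (doubles n)"
  using P by (auto simp: is_clasp_def)

lemma clasp_nonzero: "cls P \<noteq> 0"
proof -
  have "P \<in> combos (doubles n) (doubles n)"
    using P by (simp add: is_clasp_def)
  then show ?thesis
    using P hom_eq_cls[of P "doubles n" "doubles n" 0] by (simp add: is_clasp_def)
qed

lemma clasp_idem: "cls P * cls P = cls P"
proof -
  have "P \<in> combos (doubles n) (doubles n)" "hom_eq (doubles n) (doubles n) (P \<circ>\<^sub>w P) P"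
    using P by (auto simp: is_clasp_def)
  then show ?thesis
    using hom_eq_cls[OF combos_comp] cls_comp by metis
qed

lemma clasp_kill:
  assumes "weight_less (word_weight t) (word_weight (doubles n))"
  shows "x \<in> Hm (doubles n) t \<Longrightarrow> x * cls P = 0" "x \<in> Hm t (doubles n) \<Longrightarrow> cls P * x = 0"
proof -
  have PC: "P \<in> combos (doubles n) (doubles n)"
    using P by (simp add: is_clasp_def)
  show "x * cls P = 0" if "x \<in> Hm (doubles n) t"
  proof -
    obtain W where W: "W \<in> combos (doubles n) t" "x = cls W"
      using \<open>x \<in> _\<close> by (auto simp: Hm_def)
    then have "hom_eq (doubles n) t (W \<circ>\<^sub>w P) 0"
      using P assms by (auto simp: is_clasp_def)
    then show ?thesis
      using hom_eq_cls[OF combos_comp[OF W(1) PC] combos_0] cls_comp[OF W(1) PC] W(2) by simp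
  qed
  show "cls P * x = 0" if "x \<in> Hm t (doubles n)"
  proof -
    obtain W where W: "W \<in> combos t (doubles n)" "x = cls W"
      using \<open>x \<in> _\<close> by (auto simp: Hm_def)
    then have "hom_eq t (doubles n) (P \<circ>\<^sub>w W) 0"
      using P assms by (auto simp: is_clasp_def)
    then show ?thesis
      using hom_eq_cls[OF combos_comp[OF PC W(1)] combos_0] cls_comp[OF PC W(1)] W(2) by simp
  qed
qed

lemma clasp_hh: "l + r + 2 = n \<Longrightarrow> hh l r * cls P = 0"
  using clasp_kill(1)[of "ww l r" "hh l r"] weight_less_ww[of l r] hh_Hm[of l r] by simp

text \<open>The lower part kills the clasp, so squaring gives \<open>c\<close> times the clasp;
  idempotence and nonvanishing force \<open>c = 1\<close>.\<close>

lemma clasp_low: "\<exists>x. low n x \<and> cls P = idd n + x"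
proof -
  obtain c x where x: "low n x" "cls P = sc c (idd n) + x"
    using endomorphism_scalar[OF clasp_Hm] by blast
  have "x * cls P = 0"
    using x(1) by (rule low_kill) (simp add: hdown_at_hh clasp_hh)
  then have "cls P * cls P = sc c (cls P)"
    using idn_mult(1)[OF clasp_Hm] by (subst x(2)) (simp add: distrib_right)
  then have "sc (c - 1) (cls P) = 0"
    by (simp add: clasp_idem sc_diff_left)
  then have "c = 1"
    using clasp_nonzero sc_cancel[of "c - 1" "cls P" 0] by auto
  then show ?thesis
    using x by auto
qed

lemma clasp_absorb:
  assumes "\<And>l r. n = l + r + 2 \<Longrightarrow> hh l r * y = 0" "y \<in> Hm t (doubles n)"
  shows "cls P * y = y"
proof -
  obtain x where x: "low n x" "cls P = idd n + x"
    using clasp_low by blast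
  have "x * y = 0"
    using x(1) by (rule low_kill) (simp add: hdown_at_hh assms(1))
  then show ?thesis
    using idn_mult(1)[OF assms(2)] by (simp add: x(2) distrib_right)
qed

lemma clasp_hup: "l + r + 2 = n \<Longrightarrow> cls P * box (doubles l) hup (doubles r) = 0"
  using clasp_kill(2)[of "ww l r" "box (doubles l) hup (doubles r)"] weight_less_ww[of l r]
    Hm_box[OF hup_Hm, of "doubles l" "doubles r"] doubles_mid[of l r] by simp

lemma clasp_xx: "l + r + 2 = n \<Longrightarrow> cls P * (xx l r * z) = 0"
  using mult_assoc_rule[OF clasp_hup[of l r]] by (simp add: xx_def xg_def box_sc box_mult mult.assoc)

lemma clasp_uu: "l + r + 2 = n \<Longrightarrow> cls P * (uu l r * z) = 0"
proof -
  assume "l + r + 2 = n"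
  have "cupD = sc (inverse \<delta>) (hup * cupS)"
    by (simp flip: cupD_hup)
  then have "uu l r = sc (inverse \<delta>) (box (doubles l) hup (doubles r) * us l r)"
    by (simp add: uu_def us_def box_sc box_mult)
  then show ?thesis
    using mult_assoc_rule[OF clasp_hup[OF \<open>l + r + 2 = n\<close>]] by (simp add: mult.assoc)
qed

lemma clasp_VV: "k + r = n \<Longrightarrow> cls P * (VV k r * z) = sc (qint (2 * int k)) (cls P * z)"
proof (induction k arbitrary: r z)
  case (Suc k)
  show ?case
  proof (cases k)
    case 0
    then show ?thesis
      using mult_assoc_rule[OF idn_mult(2)[OF clasp_Hm], of z] Suc.prems by (simp add: VV_1)
  next
    case (Suc k')
    then have "cls P * (VV (Suc k) r * z) = sc (qint (2 * int (Suc k))) (cls P * z) +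
        cls P * (VV k (Suc r) * (xx k' r * z))"
      using VV_Suc[of k' r] mult_assoc_rule[OF idn_mult(2)[OF clasp_Hm], of z] Suc.prems \<open>Suc k + r = n\<close>
      by (simp add: distrib_left distrib_right mult.assoc)
    then show ?thesis
      using Suc.IH[of "Suc r" "xx k' r * z"] clasp_xx[of k' r z] Suc \<open>Suc k + r = n\<close> by simp
  qed
qed simp

text \<open>The coefficients in \<open>low\<close> carry no type, so identities are inserted on both
  sides. Each term then contains a morphism from a word of lower weight to \<open>doubles n\<close>,
  which the clasp kills.\<close>

lemma clasp_low_pad:
  assumes "low m x" "n = Suc m"
  shows "cls P * box [] (idd m * x) [Double] = 0"
  using assms(1)
proof (induction rule: low.induct)
  case (add x p A)
  define r where "r = m - p - 2"
  have p: "hdown_at m p = hh p r" "m = p + r + 2"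
    using add(2) by (auto simp: hdown_at_hh r_def)
  have "hdown_at m p = idn (ww p r) * hdown_at m p"
    using idn_mult(1)[OF hh_Hm[of p r]] p by simp
  then have "idd m * (A * hdown_at m p) = (idd m * A * idn (ww p r)) * hdown_at m p"
    by (metis mult.assoc)
  moreover have 0: "cls P * box [] (idd m * A * idn (ww p r)) [Double] = 0"
  proof (rule clasp_kill(2))
    show "weight_less (word_weight (ww p r @ [Double])) (word_weight (doubles n))"
      using weight_less_ww'[of p r] p assms(2) by simp
    show "box [] (idd m * A * idn (ww p r)) [Double] \<in> Hm (ww p r @ [Double]) (doubles n)"
      using Hm_box[OF Hm_sandwich[of "doubles m" A "ww p r"], of "[]" "[Double]"] assms(2)
      by (simp add: doubles_snoc doubles_Cons doubles_Suc)
  qed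
  ultimately show ?case
    using add(3) mult_assoc_rule[OF 0, of "box [] (hdown_at m p) [Double]"]
    by (simp add: distrib_left box_add box_mult mult.assoc)
qed simp

end

lemma clasp_clasp:
  assumes P: "is_clasp (doubles (Suc m)) P" and Q: "is_clasp (doubles m) Q"
  shows "cls P * box [] (cls Q) [Double] = cls P"
proof -
  obtain x where x: "low m x" "cls Q = idd m + x"
    using clasp_low[OF Q] by blast
  then have "cls Q = idd m + idd m * x"
    using idn_mult(1)[OF clasp_Hm[OF Q]] by (simp add: distrib_left)
  moreover have "cls P * idn (doubles m @ [Double]) = cls P"
    using idn_mult(2)[OF clasp_Hm[OF P]] by (simp add: doubles_snoc)
  ultimately show ?thesis
    using clasp_low_pad[OF P x(1)] by (simp add: box_add distrib_left)
qed

lemma clasp_QQ: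
  assumes P: "is_clasp (doubles (Suc m)) P" and Q: "is_clasp (doubles m) Q"
  shows "cls P = sc (1 / (qint (2 * int (Suc m)) * qint (2 * int (Suc m) + 1))) (QQ (Suc m) (box [] (cls Q) [Double]))"
proof -
  define n G N where "n = Suc m" and "G = box [] (cls Q) [Double]" and "N = qint (2 * int n) * qint (2 * int n + 1)"
  have N: "N \<noteq> 0"
    by (auto simp: N_def n_def qint_nonzero)
  have G: "G \<in> Hm (doubles n) (doubles n)"
    using Hm_box[OF clasp_Hm[OF Q], of "[]" "[Double]"] by (simp add: G_def n_def doubles_snoc)
  \<comment> \<open>\<open>r > 0\<close> spares the rightmost strand, so \<open>hdown\<close> acts
    inside the smaller clasp.\<close>
  have kill: "hh l r * G = 0" if lr: "l + r + 2 = n" "r > 0" for l r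
  proof -
    obtain r' where r': "r = Suc r'"
      using lr by (cases r) auto
    have "hh l r' * cls Q = 0"
      using clasp_hh[OF Q, of l r'] lr r' by (simp add: n_def)
    moreover have "hh l r = box [] (hh l r') [Double]"
      by (simp add: hh_def r' doubles_snoc)
    ultimately show ?thesis
      by (simp add: G_def flip: box_mult)
  qed
  have QQ_Hm: "QQ n G \<in> Hm (doubles n) (doubles n)"
    unfolding QQ_def
  proof (intro Hm_sum Hm_sc)
    fix i assume "i \<in> {..<n}"
    then have i: "i < n" by simp
    have "ZZ n G i \<in> Hm (doubles n) (doubles n)"
    proof (cases i)
      case (Suc i')
      have "uu (n - 2 - i') i' \<in> Hm (doubles (n - 2)) (doubles n)" "cc (n - 2) 0 \<in> Hm (doubles n) (doubles (n - 2))"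
        using uu_Hm[of "n - 2 - i'" i'] cc_Hm[of "n - 2" 0] i Suc by (simp_all add: Suc_diff_Suc numeral_2_eq_2)
      then show ?thesis
        using Suc G by (auto simp: ZZ_def numeral_2_eq_2 intro!: Hm_mult[OF _ Hm_mult[OF _ G]])
    qed (simp add: ZZ_def G)
    then show "VV (n - i) i * ZZ n G i \<in> Hm (doubles n) (doubles n)"
      using VV_Hm[of "n - i" i] i by (auto intro: Hm_mult)
  qed
  have "cls P * QQ n G = QQ n G"
  proof (rule clasp_absorb)
    show "is_clasp (doubles n) P"
      using P by (simp add: n_def)
    show "hh l r * QQ n G = 0" if "n = l + r + 2" for l r
      using that G kill by (intro hh_QQ) auto
  qed (rule QQ_Hm)
  moreover have "cls P * QQ n G = sc N (cls P)"
  proof -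
    have "cls P * QQ n G = (\<Sum>i<n. sc (qint (2 * int n + 1 - 2 * int i)) (cls P * (VV (n - i) i * ZZ n G i)))"
      by (simp add: QQ_def sum_distrib_left)
    \<comment> \<open>\<open>clasp_VV\<close> reduces each inner sum to its leading coefficient and
      \<open>clasp_uu\<close> kills the terms with a cup. For \<open>i = 0\<close> there remain
      \<open>[2n]\<close> from \<open>VV\<close> and the weight \<open>[2n + 1]\<close>.\<close>
    also have "\<dots> = (\<Sum>i<n. if i = 0 then sc N (cls P) else 0)"
    proof (rule sum.cong)
      fix i assume "i \<in> {..<n}"
      then have i: "i < n" by simp
      have "cls P * (VV (n - i) i * ZZ n G i) = sc (qint (2 * int (n - i))) (cls P * ZZ n G i)"
        using clasp_VV[of n P "n - i" i] P i by (simp add: n_def)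
      moreover have "cls P * ZZ n G i = (if i = 0 then cls P else 0)"
        using clasp_clasp[OF P Q] clasp_uu[of n P "n - 1 - i" "i - 1"] P i by (auto simp: ZZ_def G_def n_def)
      ultimately show "sc (qint (2 * int n + 1 - 2 * int i)) (cls P * (VV (n - i) i * ZZ n G i)) =
          (if i = 0 then sc N (cls P) else 0)"
        by (simp add: N_def mult.commute)
    qed simp
    also have "\<dots> = sc N (cls P)"
      by (simp add: n_def)
    finally show ?thesis .
  qed
  ultimately have "sc N (cls P) = QQ n G"
    by simp
  then show ?thesis
    using sc_eq_iff[OF N, of "cls P" "QQ n G"] by (simp add: n_def G_def N_def inverse_eq_divide)
qed

subsection \<open>The webs \<open>D_web\<close>\<close>

lemma tensor_ident_right: "F \<otimes>\<^sub>w ident r = lpad [] F r"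
  by (induction F rule: lin_induct)
     (simp_all add: lin_tensor_lext ident_def lpad_def lext_fun_add web_tensor_def web_id_def wpad_def case_prod_beta)

lemma ident_tensor_left: "ident l \<otimes>\<^sub>w F = lpad l F []"
  using lpad_tensor[of l F "[]"] unfolding tensor_ident_right by (simp add: lpad_def)

lemma crossing_combos: "crossing \<in> combos [Double, Double] [Double, Double]"
  by (simp add: crossing_def webs_iff)

fun strand_over :: "nat \<Rightarrow> nat \<Rightarrow> nat \<Rightarrow> hom" where
  "strand_over n i 0 = idd n"
| "strand_over n i (Suc m) = xx (n - i - m - 2) (i + m) * strand_over n i m"

lemma xx_Hm': "l + r + 2 = n \<Longrightarrow> xx l r \<in> Hm (doubles n) (doubles n)"
  using xx_Hm[of l r] by simp

text \<open>Each tetravalent vertex is \<open>\<alpha>\<close> times \<open>xg\<close>; these powers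
  of \<open>\<alpha>\<close> later cancel the powers of \<open>[2]\<close> in the expansion.\<close>

lemma cls_crossings:
  "i + m < n \<or> m = 0 \<Longrightarrow> crossings n i m \<in> combos (doubles n) (doubles n) \<and>
    cls (crossings n i m) = sc (\<alpha> ^ m) (strand_over n i m)"
proof (induction m)
  case 0
  then show ?case
    by (simp add: idn_def)
next
  case (Suc m)
  define l where "l = n - i - m - 2"
  have n: "n = l + (i + m) + 2"
    using Suc.prems by (auto simp: l_def)
  let ?L = "lpad (doubles l) crossing (doubles (i + m))"
  have L: "?L \<in> combos (doubles n) (doubles n)"
    using combos_lpad[OF crossing_combos, of "doubles l" "doubles (i + m)"] by (simp only: n doubles_mid)
  have "cls ?L = sc \<alpha> (xx l (i + m))"
    using cls_lpad[OF crossing_combos, of "doubles l" "doubles (i + m)"]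
    by (simp add: crossing_hom xx_def xg_def box_sc)
  moreover have "crossings n i (Suc m) = ?L \<circ>\<^sub>w crossings n i m"
    by (simp add: lpad_tensor l_def)
  moreover have "crossings n i m \<in> combos (doubles n) (doubles n)"
    "cls (crossings n i m) = sc (\<alpha> ^ m) (strand_over n i m)"
    using Suc by auto
  ultimately show ?case
    using combos_comp[OF L] cls_comp[OF L] by (simp add: l_def)
qed

text \<open>\<open>strand_over\<close> grows at the top while \<open>vv\<close> grows at the bottom;
  splitting off the lowest crossing reconciles the two recursions.\<close>

lemma strand_over_first: "i + Suc m < n \<Longrightarrow>
    strand_over n i (Suc m) = strand_over n (Suc i) m * xx (n - i - 2) i"
proof (induction m)
  case 0
  then show ?case
    using idn_mult[OF xx_Hm'[of "n - i - 2" i n]] by simp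
next
  case (Suc m)
  have "strand_over n i (Suc (Suc m)) = xx (n - i - Suc m - 2) (i + Suc m) * strand_over n i (Suc m)"
    by (simp only: strand_over.simps)
  also have "\<dots> = (xx (n - Suc i - m - 2) (Suc i + m) * strand_over n (Suc i) m) * xx (n - i - 2) i"
    using Suc by (simp add: mult.assoc)
  finally show ?case
    by simp
qed

lemma VV_strand_over: "VV k i = (\<Sum>m<k. sc (qint (2 * int (k - m))) (strand_over (k + i) i m))"
proof (induction k arbitrary: i)
  case (Suc k)
  show ?case
  proof (cases k)
    case 0
    then show ?thesis
      by (simp add: VV_1)
  next
    case (Suc k')
    have "VV (Suc k) i = sc (qint (2 * int (Suc k))) (idd (Suc k + i)) + VV k (Suc i) * xx k' i"
      using Suc VV_Suc[of k' i] by (simp add: add.commute)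
    also have "VV k (Suc i) * xx k' i = (\<Sum>m<k. sc (qint (2 * int (k - m))) (strand_over (k + Suc i) (Suc i) m * xx k' i))"
      by (subst Suc.IH) (simp add: sum_distrib_right)
    also have "\<dots> = (\<Sum>m<k. sc (qint (2 * int (Suc k - Suc m))) (strand_over (Suc k + i) i (Suc m)))"
      by (rule sum.cong) (use Suc strand_over_first[of i _ "Suc k + i"] in auto)
    finally show ?thesis
      by (subst sum.lessThan_Suc_shift) simp
  qed
qed simp

lemma cls_turnback:
  assumes "1 \<le> i" "i < n"
  shows "turnback n i \<in> combos (doubles n) (doubles n) \<and> cls (turnback n i) = uu (n - 1 - i) (i - 1) * cc (n - 2) 0"
proof -
  let ?A = "lpad (doubles (n - i - 1)) (lin_web (Web [] [([], Cup Double, [])])) (doubles (i - 1))"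
  let ?B = "lpad (doubles (n - 2)) (lin_web (Web [Double, Double] [([], Cap Double, [])])) []"
  have a: "lin_web (Web [] [([], Cup Double, [])]) \<in> combos [] [Double, Double]"
    and b: "lin_web (Web [Double, Double] [([], Cap Double, [])]) \<in> combos [Double, Double] []"
    by (simp_all add: webs_iff)
  have A: "?A \<in> combos (doubles (n - 2)) (doubles n)"
  proof -
    have "n - i - 1 + (i - 1) + 2 = n" "n - i - 1 + (i - 1) = n - 2"
      using assms by auto
    then show ?thesis
      using combos_lpad[OF a, of "doubles (n - i - 1)" "doubles (i - 1)"]
      by (simp only: doubles_mid append_Nil doubles_add[symmetric])
  qed
  have B: "?B \<in> combos (doubles n) (doubles (n - 2))"
  proof -
    have "n - 2 + 0 + 2 = n"
      using assms by auto
    then have "doubles (n - 2) @ [Double, Double] = doubles n"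
      using doubles_mid[of "n - 2" 0] by (simp only: doubles_0 append_Nil2)
    then show ?thesis
      using combos_lpad[OF b, of "doubles (n - 2)" "[]"] by (simp only: append_Nil append_Nil2)
  qed
  have "cls ?A = uu (n - 1 - i) (i - 1)" "cls ?B = cc (n - 2) 0"
    using cls_lpad[OF a] cls_lpad[OF b] by (simp_all add: uu_def cc_def gen_def)
  then show ?thesis
    unfolding turnback_def lpad_tensor unfolding ident_tensor_left
    using combos_comp[OF A B] cls_comp[OF A B] by simp
qed

lemma cls_D_web:
  assumes Q: "Q \<in> combos (doubles (n - 1)) (doubles (n - 1))" and "i < j" "j \<le> n"
  shows "D_web n Q i j \<in> combos (doubles n) (doubles n) \<and>
    cls (D_web n Q i j) = sc (\<alpha> ^ (j - i - 1)) (strand_over n i (j - i - 1) * ZZ n (box [] (cls Q) [Double]) i)"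
proof -
  have n: "doubles (n - 1) @ [Double] = doubles n"
    using assms by (simp add: doubles_snoc)
  have R: "Q \<otimes>\<^sub>w ident [Double] \<in> combos (doubles n) (doubles n)"
    "cls (Q \<otimes>\<^sub>w ident [Double]) = box [] (cls Q) [Double]"
    using combos_lpad[OF Q, of "[]" "[Double]"] cls_lpad[OF Q, of "[]" "[Double]"]
    by (simp_all add: tensor_ident_right n del: One_nat_def)
  have ij: "i + (j - i - 1) < n \<or> j - i - 1 = 0"
    using assms by arith
  have C: "crossings n i (j - i - 1) \<in> combos (doubles n) (doubles n)"
    "cls (crossings n i (j - i - 1)) = sc (\<alpha> ^ (j - i - 1)) (strand_over n i (j - i - 1))"
    using cls_crossings[of i "j - i - 1" n] ij by blast+
  show ?thesis
  proof (cases "i = 0")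
    case True
    then show ?thesis
      using combos_comp[OF C(1) R(1)] cls_comp[OF C(1) R(1)] C(2) R(2) by (simp add: D_web_def ZZ_def)
  next
    case False
    then have T: "turnback n i \<in> combos (doubles n) (doubles n)"
      "cls (turnback n i) = uu (n - 1 - i) (i - 1) * cc (n - 2) 0"
      using cls_turnback[of i n] assms by auto
    show ?thesis
      using combos_comp[OF combos_comp[OF C(1) T(1)] R(1)] cls_comp[OF combos_comp[OF C(1) T(1)] R(1)]
        cls_comp[OF C(1) T(1)] C(2) T(2) R(2) False
      by (simp add: D_web_def ZZ_def mult.assoc)
  qed
qed

lemma cls_expansion:
  assumes Q: "Q \<in> combos (doubles (n - 1)) (doubles (n - 1))" and "n > 0"
  defines "N \<equiv> qint (2 * int n) * qint (2 * int n + 1)"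
  shows "cls (\<Sum>i = 0..n - 1. \<Sum>j = i + 1..n.
       (qint 2 powi (2 * (1 + int i - int j)) *
          (qint (2 * int n + 1 - 2 * int i) * qint (2 * int n - 2 * int j + 2) / N))
       *\<^sub>w D_web n Q i j) = sc (1 / N) (QQ n (box [] (cls Q) [Double]))"
proof -
  define G where "G = box [] (cls Q) [Double]"
  have inner: "(\<Sum>j = i + 1..n. sc (qint 2 powi (2 * (1 + int i - int j)) *
          (qint (2 * int n + 1 - 2 * int i) * qint (2 * int n - 2 * int j + 2) / N)) (cls (D_web n Q i j))) =
      sc (1 / N) (sc (qint (2 * int n + 1 - 2 * int i)) (VV (n - i) i * ZZ n G i))" if "i < n" for i
  proof -
    have "(\<Sum>j = i + 1..n. sc (qint 2 powi (2 * (1 + int i - int j)) *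
          (qint (2 * int n + 1 - 2 * int i) * qint (2 * int n - 2 * int j + 2) / N)) (cls (D_web n Q i j))) =
        (\<Sum>m<n - i. sc (1 / N * qint (2 * int n + 1 - 2 * int i) * qint (2 * int (n - i - m))) (strand_over n i m * ZZ n G i))"
    \<comment> \<open>The new index \<open>m = j - i - 1\<close> is the number of crossings of the
      arc.\<close>
    proof (rule sum.reindex_bij_witness[of _ "\<lambda>m. i + 1 + m" "\<lambda>j. j - i - 1"])
      fix j assume j: "j \<in> {i + 1..n}"
      define m where "m = j - i - 1"
      have m: "j = i + 1 + m" "m < n - i"
        using j by (auto simp: m_def)
      have "qint 2 powi (2 * (1 + int i - int j)) = qint 2 powi (- int (2 * m))"
        by (simp add: m(1))
      also have "\<dots> = inverse (\<alpha> ^ m)"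
        unfolding power_int_minus power_int_of_nat by (simp add: \<alpha>_def power_mult)
      finally have c: "qint 2 powi (2 * (1 + int i - int j)) = inverse (\<alpha> ^ m)" .
      have d: "2 * int n - 2 * int j + 2 = 2 * int (n - i - m)"
        using m by (simp add: of_nat_diff)
      have "cls (D_web n Q i j) = sc (\<alpha> ^ m) (strand_over n i m * ZZ n G i)"
        using cls_D_web[OF Q, of i j] j by (simp add: m_def G_def)
      then show "sc (1 / N * qint (2 * int n + 1 - 2 * int i) * qint (2 * int (n - i - (j - i - 1))))
          (strand_over n i (j - i - 1) * ZZ n G i) =
        sc (qint 2 powi (2 * (1 + int i - int j)) *
          (qint (2 * int n + 1 - 2 * int i) * qint (2 * int n - 2 * int j + 2) / N)) (cls (D_web n Q i j))"
        unfolding c d m_def[symmetric] by (simp add: field_simps)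
    qed auto
    also have "\<dots> = sc (1 / N) (sc (qint (2 * int n + 1 - 2 * int i)) (VV (n - i) i * ZZ n G i))"
      using that by (simp add: VV_strand_over sum_distrib_right sc_sum mult.assoc)
    finally show ?thesis .
  qed
  have "{0..n - 1} = {..<n}"
    using \<open>n > 0\<close> by auto
  then show ?thesis
    using inner by (simp add: cls_sum cls_scale QQ_def sc_sum G_def del: sc_sc)
qed

theorem theorem4p4:
  fixes g :: "nat \<Rightarrow> lin" and n :: nat
  assumes "\<And>m. is_clasp (doubles m) (g m)"
    and "n > 0"
  shows "hom_eq (doubles n) (doubles n) (g n)
    (\<Sum>i = 0..n - 1. \<Sum>j = i + 1..n.
       (qint 2 powi (2 * (1 + int i - int j)) *
          (qint (2 * int n + 1 - 2 * int i) * qint (2 * int n - 2 * int j + 2) /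
             (qint (2 * int n) * qint (2 * int n + 1))))
       *\<^sub>w D_web n (g (n - 1)) i j)"
proof -
  obtain m where m: "n = Suc m"
    using assms(2) by (cases n) auto
  have g: "g k \<in> combos (doubles k) (doubles k)" for k
    using assms(1)[of k] by (simp add: is_clasp_def)
  show ?thesis
  proof (subst hom_eq_cls)
    show "(\<Sum>i = 0..n - 1. \<Sum>j = i + 1..n.
       (qint 2 powi (2 * (1 + int i - int j)) *
          (qint (2 * int n + 1 - 2 * int i) * qint (2 * int n - 2 * int j + 2) /
             (qint (2 * int n) * qint (2 * int n + 1))))
       *\<^sub>w D_web n (g (n - 1)) i j) \<in> combos (doubles n) (doubles n)"
      using cls_D_web[OF g] by (intro combos_sum combos_scale) auto
  next
    show "cls (g n) = cls (\<Sum>i = 0..n - 1. \<Sum>j = i + 1..n.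
       (qint 2 powi (2 * (1 + int i - int j)) *
          (qint (2 * int n + 1 - 2 * int i) * qint (2 * int n - 2 * int j + 2) /
             (qint (2 * int n) * qint (2 * int n + 1))))
       *\<^sub>w D_web n (g (n - 1)) i j)"
      unfolding cls_expansion[OF g assms(2)]
      using clasp_QQ[OF assms(1)[of "Suc m"] assms(1)[of m]] m by simp
  qed (rule g)
qed

end
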